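(* Let $Y=Y_\Sigma$ be a smooth projective toric variety with $-K_Y$ base-point free, let $S$ be its homogeneous coordinate ring and $G=\mathrm{Aut}_g(S)$. Then the tautological system $\tau_Y(G,-K_Y,\beta_\chi)$ is equivalent to the extended GKZ system on $Y$ (i.e. they define the same left ideal of differential operators in the coordinates $b_\mu$ on $H^0(Y,-K_Y)$).
   Context: Let $N\cong\mathbb Z^n$, $M=\mathrm{Hom}(N,\mathbb Z)$, $\Sigma$ the fan of $Y$, $\Sigma(1)$ its rays (identified with their primitive generators $\rho$), $r=|\Sigma(1)|$, $e_1,\dots,e_n$ the standard basis of $N$. $S=\mathbb C[w_\rho:\rho\in\Sigma(1)]$ is graded by $\mathrm{Cl}(Y)$, $\deg w_\rho=[D_\rho]$, and $\mathrm{Aut}_g(S)$ is the group of graded $\mathbb C$-algebra automorphisms. Let $\Delta=\{m\in M_{\mathbb R}:\langle m,\rho\rangle\ge-1\ \forall\rho\}$. $H^0(Y,-K_Y)$ has basis $t^\mu$, $\mu\in\Delta\cap M$, with coordinates $b_\mu$ (general section $\sum b_\mu t^\mu$), and is identified with the graded piece of $S$ of degree $[-K_Y]$ by $t^\mu\mapsto\prod_\rho w_\rho^{\langle\mu,\rho\rangle+1}$; this makes it a $G$-module. Character. Declare $\rho\sim\rho'$ iff $\deg w_\rho=\deg w_{\rho'}$, with classes $\Sigma_1,\dots,\Sigma_h$ of degrees $d_1,\dots,d_h$. Write $S_{d_i}=S'_{d_i}\oplus S''_{d_i}$, with $S'_{d_i}$ spanned by the $w_\rho$, $\rho\in\Sigma_i$,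 and $S''_{d_i}$ by the remaining monomials. There is a surjection $\mathrm{Aut}_g(S)\to\prod_i GL(S'_{d_i})$ with unipotent kernel; $\chi:\mathrm{Aut}_g(S)\to\mathbb C^\times$ is the pull-back of the product of the determinants (so $\chi(\lambda_1,\dots,\lambda_r)=\lambda_1\cdots\lambda_r$ on the torus $(\mathbb C^\times)^r$). Put $\hat G=G\times\mathbb C^\times$, $\hat{\mathfrak g}=\mathrm{Lie}(\hat G)$, and $\beta_\chi=(d\chi;\mathrm{id}):\hat{\mathfrak g}=\mathfrak g\times\mathbb C\to\mathbb C$. Tautological system. Let $V=H^0(Y,-K_Y)^*$; $\mathbb C^\times$ acts on $V$ by scaling. $Z:\hat{\mathfrak g}\to\mathrm{End}(V)$ is the resulting Lie algebra map; an element of $\mathrm{End}(V)$ is viewed as a linear derivation (first-order operator) on $V^*=H^0(Y,-K_Y)$, since $V$ is the space of linear functions on $V^*$. The convention is: if the degree-preserving derivation $x\in\mathfrak g$ of $S$ sends $t^\mu\mapsto\sum_\nu c_{\nu\mu}t^\nu$, then $Z(x)=\sum_{\mu,\nu}c_{\nu\mu}b_\mu\partial/\partial b_\nu$, and the generator $1$ of $\mathbb C$ gives $\sum_\mu b_\mu\partial/\partial b_\mu$. Let $\hat Y\subset V$ be the cone over the image of $Y\to\mathbb P(V)$ and $I=I(\hat Y,V)\subset\mathbb C[V]=\mathrm{Sym}(V^* )$ its homogeneous ideal; for $\zeta\in V^*$, $\partial_\zeta$ is the derivation on $V^*$ with $\partial_\zeta(a)=\langle a,\zeta\rangle$ for $a\in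 V$. Then $$\tau_Y(G,-K_Y,\beta_\chi)=D_{V^*}\big/\big(D_{V^*}\langle p(\partial_\zeta):p(\zeta)\in I\rangle+D_{V^*}\langle Z(x)+\beta_\chi(x):x\in\hat{\mathfrak g}\rangle\big).$$ Extended GKZ system. It is generated by: - $\prod_{\mu}(\partial/\partial b_\mu)^{l_\mu^+}-\prod_\mu(\partial/\partial b_\mu)^{l_\mu^-}$ for $l\in\mathbb Z^{\Delta\cap M}$ with $\sum l_\mu=0$, $\sum l_\mu\mu=0$, where $l=l^+-l^-$ with $l^\pm\geq 0$ the positive and negative parts; - $\sum_\mu\langle\mu,e_j\rangle b_\mu\partial/\partial b_\mu$, $j=1,\dots,n$; - $\sum_\mu b_\mu\partial/\partial b_\mu+1$; - $Z_\alpha=\sum_{\mu\in\Delta\cap M}\langle\mu-\alpha,\rho_\alpha\rangle\,b_\mu\,\partial/\partial b_{\mu+\alpha}$ for every root $\alpha\in R(\Sigma,N)$, where $R(\Sigma,N)$ is the set of $\alpha\in M$ for which there is a unique ray $\rho_\alpha$ with $\langle\alpha,\rho_\alpha\rangle=-1$ and $\langle\alpha,\rho\rangle\ge0$ for all $\rho\ne\rho_\alpha$ (if $\mu+\alpha\notin\Delta$ the coefficient is zero). *)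

theory Defs
  imports "HOL-Analysis.Analysis" "HOL-Library.Poly_Mapping"
begin

hide_const (open) Poly_Mapping.range

section \<open>Lattices, fans and toric varieties\<close>

text \<open>
  The lattice \<open>N\<close> is \<open>\<int>\<^sup>n\<close>, rendered as \<^typ>\<open>int ^ 'n\<close> with \<open>n = CARD('n)\<close>.  The dual lattice
  \<open>M\<close> is the same type, paired with \<open>N\<close> by the dot product.  Toric varieties are given by their
  fans; smoothness and projectivity are the standard fan conditions, while the points
  of the variety (needed for base points and for the cone over its image) are taken in homogeneous
  coordinates.
\<close>

definition pairing :: "int ^ 'n \<Rightarrow> int ^ 'n \<Rightarrow> int" where
  "pairing m u = (\<Sum>i\<in>UNIV. m $ i * u $ i)"

definition real_vec :: "int ^ 'n \<Rightarrow> real ^ 'n" where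
  "real_vec v = (\<chi> i. real_of_int (v $ i))"

definition strongly_convex_rational_cone :: "(real ^ 'n) set \<Rightarrow> bool" where
  "strongly_convex_rational_cone \<sigma> \<longleftrightarrow>
     (\<exists>A :: (int ^ 'n) set. finite A \<and> \<sigma> = convex_cone hull (real_vec ` A)) \<and>
     \<sigma> \<inter> uminus ` \<sigma> = {0}"

text \<open>The empty set is a \<^const>\<open>face_of\<close> every convex set, but it is not a cone.\<close>

definition is_fan :: "(real ^ 'n) set set \<Rightarrow> bool" where
  "is_fan \<Sigma> \<longleftrightarrow>
     finite \<Sigma> \<and> \<Sigma> \<noteq> {} \<and>
     (\<forall>\<sigma>\<in>\<Sigma>. strongly_convex_rational_cone \<sigma>) \<and>
     (\<forall>\<sigma>\<in>\<Sigma>. \<forall>\<tau>. \<tau> face_of \<sigma> \<and> \<tau> \<noteq> {} \<longrightarrow> \<tau> \<in> \<Sigma>) \<and>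
     (\<forall>\<sigma>\<in>\<Sigma>. \<forall>\<tau>\<in>\<Sigma>. (\<sigma> \<inter> \<tau>) face_of \<sigma> \<and> (\<sigma> \<inter> \<tau>) face_of \<tau>)"

definition lattice_basis :: "(int ^ 'n) set \<Rightarrow> bool" where
  "lattice_basis B \<longleftrightarrow>
     finite B \<and>
     (\<forall>v. \<exists>!c :: int ^ 'n \<Rightarrow> int. (\<forall>u. u \<notin> B \<longrightarrow> c u = 0) \<and> v = (\<Sum>u\<in>B. c u *s u))"

definition smooth_fan :: "(real ^ 'n) set set \<Rightarrow> bool" where
  "smooth_fan \<Sigma> \<longleftrightarrow>
     (\<forall>\<sigma>\<in>\<Sigma>. \<exists>B A. lattice_basis B \<and> A \<subseteq> B \<and> \<sigma> = convex_cone hull (real_vec ` A))"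

text \<open>
  \<open>normal_cone P F\<close> is the cone of those \<open>u\<close> in \<open>N\<^sub>\<real>\<close> that attain their minimum over \<open>P\<close> along
  \<open>F\<close> (inward normals).  The variety of a fan is projective iff the fan is the normal fan of a
  full-dimensional lattice polytope in \<open>M\<^sub>\<real>\<close>.
\<close>

definition normal_cone :: "(real ^ 'n) set \<Rightarrow> (real ^ 'n) set \<Rightarrow> (real ^ 'n) set" where
  "normal_cone P F = {u. \<forall>m\<in>F. \<forall>m'\<in>P. m \<bullet> u \<le> m' \<bullet> u}"

definition full_dim_lattice_polytope :: "(real ^ 'n) set \<Rightarrow> bool" where
  "full_dim_lattice_polytope P \<longleftrightarrow>
     (\<exists>V :: (int ^ 'n) set. finite V \<and> P = convex hull (real_vec ` V)) \<and>
     aff_dim P = int (CARD('n))"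

definition projective_fan :: "(real ^ 'n) set set \<Rightarrow> bool" where
  "projective_fan \<Sigma> \<longleftrightarrow>
     (\<exists>P. full_dim_lattice_polytope P \<and> \<Sigma> = {normal_cone P F | F. F face_of P \<and> F \<noteq> {}})"

definition primitive :: "int ^ 'n \<Rightarrow> bool" where
  "primitive \<rho> \<longleftrightarrow> (\<forall>k v. \<rho> = k *s v \<longrightarrow> is_unit k)"

definition rays :: "(real ^ 'n) set set \<Rightarrow> (int ^ 'n) set" where
  "rays \<Sigma> = {\<rho>. primitive \<rho> \<and> convex_cone hull {real_vec \<rho>} \<in> \<Sigma>}"

section \<open>Polynomials\<close>

type_synonym 'v monom = "'v \<Rightarrow>\<^sub>0 nat"
type_synonym 'v cpoly = "'v monom \<Rightarrow>\<^sub>0 complex"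

definition Const :: "complex \<Rightarrow> 'v cpoly" where
  "Const c = Poly_Mapping.single 0 c"

definition Monom :: "'v monom \<Rightarrow> 'v cpoly" where
  "Monom m = Poly_Mapping.single m 1"

definition Var :: "'v \<Rightarrow> 'v cpoly" where
  "Var v = Monom (Poly_Mapping.single v 1)"

definition poly_ring :: "'v set \<Rightarrow> 'v cpoly set" where
  "poly_ring A = {f. \<forall>m\<in>Poly_Mapping.keys f. Poly_Mapping.keys m \<subseteq> A}"

definition eval_poly :: "'v cpoly \<Rightarrow> ('v \<Rightarrow> complex) \<Rightarrow> complex" where
  "eval_poly f a =
     (\<Sum>m\<in>Poly_Mapping.keys f. Poly_Mapping.lookup f m *
        (\<Prod>v\<in>Poly_Mapping.keys m. a v ^ Poly_Mapping.lookup m v))"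

definition partial :: "'v \<Rightarrow> 'v cpoly \<Rightarrow> 'v cpoly" where
  "partial v f =
     (\<Sum>m\<in>Poly_Mapping.keys f.
        Poly_Mapping.single (m - Poly_Mapping.single v 1)
          (of_nat (Poly_Mapping.lookup m v) * Poly_Mapping.lookup f m))"

section \<open>The homogeneous coordinate ring\<close>

text \<open>
  \<open>Cl(Y)\<close> is the group of torus-invariant divisors \<open>\<Sum>\<^sub>\<rho> a\<^sub>\<rho> D\<^sub>\<rho>\<close> modulo the divisors
  \<open>\<Sum>\<^sub>\<rho> \<langle>m,\<rho>\<rangle> D\<^sub>\<rho>\<close> of characters; \<open>div_class \<Sigma> a\<close> is the coset of \<open>\<Sum>\<^sub>\<rho> a\<^sub>\<rho> D\<^sub>\<rho>\<close>.
\<close>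

definition invariant_divisors :: "(real ^ 'n) set set \<Rightarrow> (int ^ 'n \<Rightarrow> int) set" where
  "invariant_divisors \<Sigma> = {a. \<forall>\<rho>. \<rho> \<notin> rays \<Sigma> \<longrightarrow> a \<rho> = 0}"

definition div_class :: "(real ^ 'n) set set \<Rightarrow> (int ^ 'n \<Rightarrow> int) \<Rightarrow> (int ^ 'n \<Rightarrow> int) set" where
  "div_class \<Sigma> a =
     {b \<in> invariant_divisors \<Sigma>. \<exists>m. \<forall>\<rho>\<in>rays \<Sigma>. b \<rho> = a \<rho> + pairing m \<rho>}"

definition class_group :: "(real ^ 'n) set set \<Rightarrow> (int ^ 'n \<Rightarrow> int) set set" where
  "class_group \<Sigma> = div_class \<Sigma> ` invariant_divisors \<Sigma>"

definition anticanonical_class :: "(real ^ 'n) set set \<Rightarrow> (int ^ 'n \<Rightarrow> int) set" where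
  "anticanonical_class \<Sigma> = div_class \<Sigma> (\<lambda>\<rho>. if \<rho> \<in> rays \<Sigma> then 1 else 0)"

definition cox_ring :: "(real ^ 'n) set set \<Rightarrow> (int ^ 'n) cpoly set" where
  "cox_ring \<Sigma> = poly_ring (rays \<Sigma>)"

definition monom_deg :: "(real ^ 'n) set set \<Rightarrow> (int ^ 'n) monom \<Rightarrow> (int ^ 'n \<Rightarrow> int) set" where
  "monom_deg \<Sigma> m = div_class \<Sigma> (\<lambda>\<rho>. int (Poly_Mapping.lookup m \<rho>))"

definition graded_piece ::
    "(real ^ 'n) set set \<Rightarrow> (int ^ 'n \<Rightarrow> int) set \<Rightarrow> (int ^ 'n) cpoly set" where
  "graded_piece \<Sigma> d = {f \<in> cox_ring \<Sigma>. \<forall>m\<in>Poly_Mapping.keys f. monom_deg \<Sigma> m = d}"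

text \<open>
  \<open>Y\<close> is the quotient by \<open>Hom(Cl(Y), \<complex>\<^sup>\<times>)\<close> of the complement of the zero set of the irrelevant
  ideal, which is generated by the monomials \<open>\<Prod> w\<^sub>\<rho>\<close> over the rays \<open>\<rho>\<close> outside a
  cone of the fan.  Only the coordinates indexed by rays matter.
\<close>

definition homogeneous_points :: "(real ^ 'n) set set \<Rightarrow> (int ^ 'n \<Rightarrow> complex) set" where
  "homogeneous_points \<Sigma> = {w. \<exists>\<sigma>\<in>\<Sigma>. (\<Prod>\<rho>\<in>{\<rho>\<in>rays \<Sigma>. real_vec \<rho> \<notin> \<sigma>}. w \<rho>) \<noteq> 0}"

text \<open>
  Global sections of \<open>-K\<^sub>Y\<close> are the elements of degree \<open>[-K\<^sub>Y]\<close>; base-point freeness says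
  that no point of \<open>Y\<close> is a common zero of them.
\<close>

definition anticanonical_base_point_free :: "(real ^ 'n) set set \<Rightarrow> bool" where
  "anticanonical_base_point_free \<Sigma> \<longleftrightarrow>
     (\<forall>w\<in>homogeneous_points \<Sigma>. \<exists>f\<in>graded_piece \<Sigma> (anticanonical_class \<Sigma>). eval_poly f w \<noteq> 0)"

section \<open>Anticanonical sections\<close>

definition anticanonical_polytope :: "(real ^ 'n) set set \<Rightarrow> (real ^ 'n) set" where
  "anticanonical_polytope \<Sigma> = {m. \<forall>\<rho>\<in>rays \<Sigma>. m \<bullet> real_vec \<rho> \<ge> -1}"

definition lattice_points :: "(real ^ 'n) set set \<Rightarrow> (int ^ 'n) set" where
  "lattice_points \<Sigma> = {\<mu>. real_vec \<mu> \<in> anticanonical_polytope \<Sigma>}"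

text \<open>The exponent of the monomial \<open>\<Prod>\<^sub>\<rho> w\<^sub>\<rho>\<^bsup>\<langle>\<mu>,\<rho>\<rangle>+1\<^esup>\<close> identified with the section \<open>t\<^sup>\<mu>\<close>.\<close>

definition section_exponent :: "(real ^ 'n) set set \<Rightarrow> int ^ 'n \<Rightarrow> (int ^ 'n) monom" where
  "section_exponent \<Sigma> \<mu> = (\<Sum>\<rho>\<in>rays \<Sigma>. Poly_Mapping.single \<rho> (nat (pairing \<mu> \<rho> + 1)))"

definition section_monom :: "(real ^ 'n) set set \<Rightarrow> int ^ 'n \<Rightarrow> (int ^ 'n) cpoly" where
  "section_monom \<Sigma> \<mu> = Monom (section_exponent \<Sigma> \<mu>)"

text \<open>
  Elements of \<open>V = H\<^sup>0(Y, -K\<^sub>Y)\<^sup>*\<close> are written as functions of \<open>\<mu>\<close> in the basis dual to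
  the \<open>t\<^sup>\<mu>\<close>.  A point of \<open>Y\<close> is sent to the evaluation functional at that point.
\<close>

definition cone_over_image :: "(real ^ 'n) set set \<Rightarrow> (int ^ 'n \<Rightarrow> complex) set" where
  "cone_over_image \<Sigma> =
     {a. \<exists>c. \<exists>w\<in>homogeneous_points \<Sigma>.
           a = (\<lambda>\<mu>. if \<mu> \<in> lattice_points \<Sigma> then c * eval_poly (section_monom \<Sigma> \<mu>) w else 0)}"

text \<open>The variable indexed by \<open>\<mu>\<close> stands for the linear function \<open>t\<^sup>\<mu>\<close> on \<open>V\<close>.\<close>

definition vanishing_ideal :: "(real ^ 'n) set set \<Rightarrow> (int ^ 'n) cpoly set" where
  "vanishing_ideal \<Sigma> =
     {p \<in> poly_ring (lattice_points \<Sigma>). \<forall>a\<in>cone_over_image \<Sigma>. eval_poly p a = 0}"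

section \<open>The graded automorphism group, its Lie algebra and the character\<close>

definition Aut_g :: "(real ^ 'n) set set \<Rightarrow> ((int ^ 'n) cpoly \<Rightarrow> (int ^ 'n) cpoly) set" where
  "Aut_g \<Sigma> =
     {\<phi> \<in> cox_ring \<Sigma> \<rightarrow>\<^sub>E cox_ring \<Sigma>.
        bij_betw \<phi> (cox_ring \<Sigma>) (cox_ring \<Sigma>) \<and>
        \<phi> 1 = 1 \<and>
        (\<forall>f\<in>cox_ring \<Sigma>. \<forall>g\<in>cox_ring \<Sigma>. \<phi> (f + g) = \<phi> f + \<phi> g \<and> \<phi> (f * g) = \<phi> f * \<phi> g) \<and>
        (\<forall>c. \<forall>f\<in>cox_ring \<Sigma>. \<phi> (Const c * f) = Const c * \<phi> f) \<and>
        (\<forall>d\<in>class_group \<Sigma>. \<phi> ` graded_piece \<Sigma> d \<subseteq> graded_piece \<Sigma> d)}"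

text \<open>
  \<open>Lie(G)\<close> consists of the velocities at \<open>0\<close> of the complex one-parameter subgroups of \<open>G\<close>.
  The derivative is taken coefficientwise, which is the usual one on each
  finite-dimensional graded piece of \<open>S\<close>.
\<close>

definition one_parameter_subgroup ::
    "(real ^ 'n) set set \<Rightarrow> (complex \<Rightarrow> (int ^ 'n) cpoly \<Rightarrow> (int ^ 'n) cpoly) \<Rightarrow>
     ((int ^ 'n) cpoly \<Rightarrow> (int ^ 'n) cpoly) \<Rightarrow> bool" where
  "one_parameter_subgroup \<Sigma> \<gamma> x \<longleftrightarrow>
     (\<forall>t. \<gamma> t \<in> Aut_g \<Sigma>) \<and>
     (\<forall>s t. \<gamma> (s + t) = compose (cox_ring \<Sigma>) (\<gamma> s) (\<gamma> t)) \<and>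
     (\<forall>f\<in>cox_ring \<Sigma>. \<forall>m.
        ((\<lambda>t. Poly_Mapping.lookup (\<gamma> t f) m) has_field_derivative Poly_Mapping.lookup (x f) m) (at 0))"

definition Lie_Aut_g :: "(real ^ 'n) set set \<Rightarrow> ((int ^ 'n) cpoly \<Rightarrow> (int ^ 'n) cpoly) set" where
  "Lie_Aut_g \<Sigma> =
     {x \<in> cox_ring \<Sigma> \<rightarrow>\<^sub>E cox_ring \<Sigma>. \<exists>\<gamma>. one_parameter_subgroup \<Sigma> \<gamma> x}"

text \<open>Determinant of a square matrix indexed by a finite set (Leibniz formula).\<close>

definition det_on :: "'a set \<Rightarrow> ('a \<Rightarrow> 'a \<Rightarrow> complex) \<Rightarrow> complex" where
  "det_on K A = (\<Sum>p | p permutes K. of_int (sign p) * (\<Prod>i\<in>K. A i (p i)))"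

definition ray_classes :: "(real ^ 'n) set set \<Rightarrow> (int ^ 'n) set set" where
  "ray_classes \<Sigma> = rays \<Sigma> //
     {(\<rho>, \<rho>'). \<rho> \<in> rays \<Sigma> \<and> \<rho>' \<in> rays \<Sigma> \<and>
        monom_deg \<Sigma> (Poly_Mapping.single \<rho> 1) = monom_deg \<Sigma> (Poly_Mapping.single \<rho>' 1)}"

text \<open>
  For a class \<open>K\<close> of rays of degree \<open>d\<close>, the coefficients of the \<open>w\<^sub>\<rho>\<^sub>'\<close> in \<open>\<phi>(w\<^sub>\<rho>)\<close>, with
  \<open>\<rho>, \<rho>'\<close> in \<open>K\<close>, form the matrix of the image of \<open>\<phi>\<close> in \<open>GL(S'\<^sub>d)\<close>: the component of
  \<open>\<phi>(w\<^sub>\<rho>)\<close> in \<open>S''\<^sub>d\<close> is discarded.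
\<close>

definition chi :: "(real ^ 'n) set set \<Rightarrow> ((int ^ 'n) cpoly \<Rightarrow> (int ^ 'n) cpoly) \<Rightarrow> complex" where
  "chi \<Sigma> \<phi> =
     (\<Prod>K\<in>ray_classes \<Sigma>.
        det_on K (\<lambda>\<rho> \<rho>'. Poly_Mapping.lookup (\<phi> (Var \<rho>)) (Poly_Mapping.single \<rho>' 1)))"

definition dchi :: "(real ^ 'n) set set \<Rightarrow> ((int ^ 'n) cpoly \<Rightarrow> (int ^ 'n) cpoly) \<Rightarrow> complex" where
  "dchi \<Sigma> x =
     (THE c. \<exists>\<gamma>. one_parameter_subgroup \<Sigma> \<gamma> x \<and>
        ((\<lambda>t. chi \<Sigma> (\<gamma> t)) has_field_derivative c) (at 0))"

text \<open>Elements of the Lie algebra of \<open>G \<times> \<complex>\<^sup>\<times>\<close> are pairs \<open>(x, c)\<close>.\<close>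

definition beta_chi ::
    "(real ^ 'n) set set \<Rightarrow> ((int ^ 'n) cpoly \<Rightarrow> (int ^ 'n) cpoly) \<times> complex \<Rightarrow> complex" where
  "beta_chi \<Sigma> = (\<lambda>(x, c). dchi \<Sigma> x + c)"

section \<open>Differential operators\<close>

text \<open>
  The Weyl algebra in the variables \<open>b\<^sub>\<mu>\<close>, \<open>\<mu> \<in> A\<close>, is the algebra of endomorphisms of the polynomial
  ring generated by the constants, the multiplications by the \<open>b\<^sub>\<mu>\<close> and the
  \<open>\<partial>/\<partial>b\<^sub>\<mu>\<close>.  Letting it act on polynomials that may contain further variables does
  not change the algebra, since its action on the polynomials in the \<open>b\<^sub>\<mu>\<close>,
  \<open>\<mu> \<in> A\<close>, is already faithful.
\<close>

inductive_set weyl_algebra :: "'v set \<Rightarrow> ('v cpoly \<Rightarrow> 'v cpoly) set" for A where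
  const: "(\<lambda>f. Const c * f) \<in> weyl_algebra A"
| mult: "\<mu> \<in> A \<Longrightarrow> (\<lambda>f. Var \<mu> * f) \<in> weyl_algebra A"
| partial: "\<mu> \<in> A \<Longrightarrow> partial \<mu> \<in> weyl_algebra A"
| add: "P \<in> weyl_algebra A \<Longrightarrow> Q \<in> weyl_algebra A \<Longrightarrow> (\<lambda>f. P f + Q f) \<in> weyl_algebra A"
| comp: "P \<in> weyl_algebra A \<Longrightarrow> Q \<in> weyl_algebra A \<Longrightarrow> P \<circ> Q \<in> weyl_algebra A"

inductive_set left_ideal ::
    "'v set \<Rightarrow> ('v cpoly \<Rightarrow> 'v cpoly) set \<Rightarrow> ('v cpoly \<Rightarrow> 'v cpoly) set" for A X where
  zero: "(\<lambda>f. 0) \<in> left_ideal A X"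
| mult: "P \<in> weyl_algebra A \<Longrightarrow> Q \<in> X \<Longrightarrow> P \<circ> Q \<in> left_ideal A X"
| add: "P \<in> left_ideal A X \<Longrightarrow> Q \<in> left_ideal A X \<Longrightarrow> (\<lambda>f. P f + Q f) \<in> left_ideal A X"

text \<open>\<open>\<Prod>\<^sub>\<mu> (\<partial>/\<partial>b\<^sub>\<mu>)\<^bsup>k \<mu>\<^esup>\<close> over \<open>\<mu> \<in> A\<close>; the order is irrelevant as these operators commute.\<close>

definition partial_power :: "'v set \<Rightarrow> ('v \<Rightarrow> nat) \<Rightarrow> 'v cpoly \<Rightarrow> 'v cpoly" where
  "partial_power A k f = Finite_Set.fold (\<lambda>\<mu>. partial \<mu> ^^ k \<mu>) f A"

text \<open>\<open>p(\<partial>\<^sub>\<zeta>)\<close>: the variable \<open>t\<^sup>\<mu>\<close> of \<open>p\<close> is replaced by \<open>\<partial>/\<partial>b\<^sub>\<mu>\<close>.\<close>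

definition poly_in_partials :: "'v cpoly \<Rightarrow> 'v cpoly \<Rightarrow> 'v cpoly" where
  "poly_in_partials p f =
     (\<Sum>m\<in>Poly_Mapping.keys p. Const (Poly_Mapping.lookup p m) *
        partial_power (Poly_Mapping.keys m) (Poly_Mapping.lookup m) f)"

definition euler_operator :: "'v set \<Rightarrow> 'v cpoly \<Rightarrow> 'v cpoly" where
  "euler_operator A f = (\<Sum>\<mu>\<in>A. Var \<mu> * partial \<mu> f)"

section \<open>The tautological system\<close>

definition Z_operator ::
    "(real ^ 'n) set set \<Rightarrow> ((int ^ 'n) cpoly \<Rightarrow> (int ^ 'n) cpoly) \<times> complex \<Rightarrow>
     (int ^ 'n) cpoly \<Rightarrow> (int ^ 'n) cpoly" where
  "Z_operator \<Sigma> = (\<lambda>(x, c) f.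
     (\<Sum>\<mu>\<in>lattice_points \<Sigma>. \<Sum>\<nu>\<in>lattice_points \<Sigma>.
        Const (Poly_Mapping.lookup (x (section_monom \<Sigma> \<mu>)) (section_exponent \<Sigma> \<nu>)) *
        (Var \<mu> * partial \<nu> f)) +
     Const c * euler_operator (lattice_points \<Sigma>) f)"

text \<open>The left ideal by which \<open>D\<close> is divided in the definition of \<open>\<tau>\<^sub>Y(G, -K\<^sub>Y, \<beta>)\<close>, for \<open>G = Aut\<^sub>g(S)\<close>.\<close>

definition tautological_ideal ::
    "(real ^ 'n) set set \<Rightarrow> (((int ^ 'n) cpoly \<Rightarrow> (int ^ 'n) cpoly) \<times> complex \<Rightarrow> complex) \<Rightarrow>
     ((int ^ 'n) cpoly \<Rightarrow> (int ^ 'n) cpoly) set" where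
  "tautological_ideal \<Sigma> \<beta> =
     left_ideal (lattice_points \<Sigma>)
       ({poly_in_partials p | p. p \<in> vanishing_ideal \<Sigma>} \<union>
        {(\<lambda>f. Z_operator \<Sigma> \<xi> f + Const (\<beta> \<xi>) * f) | \<xi>. \<xi> \<in> Lie_Aut_g \<Sigma> \<times> UNIV})"

section \<open>The extended GKZ system\<close>

definition is_root_ray :: "(real ^ 'n) set set \<Rightarrow> int ^ 'n \<Rightarrow> int ^ 'n \<Rightarrow> bool" where
  "is_root_ray \<Sigma> \<alpha> \<rho> \<longleftrightarrow>
     \<rho> \<in> rays \<Sigma> \<and> pairing \<alpha> \<rho> = -1 \<and> (\<forall>\<rho>'\<in>rays \<Sigma> - {\<rho>}. pairing \<alpha> \<rho>' \<ge> 0)"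

definition roots :: "(real ^ 'n) set set \<Rightarrow> (int ^ 'n) set" where
  "roots \<Sigma> = {\<alpha>. \<exists>!\<rho>. is_root_ray \<Sigma> \<alpha> \<rho>}"

definition root_ray :: "(real ^ 'n) set set \<Rightarrow> int ^ 'n \<Rightarrow> int ^ 'n" where
  "root_ray \<Sigma> \<alpha> = (THE \<rho>. is_root_ray \<Sigma> \<alpha> \<rho>)"

definition box_operator ::
    "(real ^ 'n) set set \<Rightarrow> (int ^ 'n \<Rightarrow> int) \<Rightarrow> (int ^ 'n) cpoly \<Rightarrow> (int ^ 'n) cpoly" where
  "box_operator \<Sigma> l f =
     partial_power (lattice_points \<Sigma>) (\<lambda>\<mu>. nat (l \<mu>)) f -
     partial_power (lattice_points \<Sigma>) (\<lambda>\<mu>. nat (- l \<mu>)) f"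

definition torus_operator ::
    "(real ^ 'n) set set \<Rightarrow> 'n \<Rightarrow> (int ^ 'n) cpoly \<Rightarrow> (int ^ 'n) cpoly" where
  "torus_operator \<Sigma> j f =
     (\<Sum>\<mu>\<in>lattice_points \<Sigma>. Const (of_int (pairing \<mu> (axis j 1))) * (Var \<mu> * partial \<mu> f))"

definition root_operator ::
    "(real ^ 'n) set set \<Rightarrow> int ^ 'n \<Rightarrow> (int ^ 'n) cpoly \<Rightarrow> (int ^ 'n) cpoly" where
  "root_operator \<Sigma> \<alpha> f =
     (\<Sum>\<mu>\<in>lattice_points \<Sigma>.
        if \<mu> + \<alpha> \<in> lattice_points \<Sigma>
        then Const (of_int (pairing (\<mu> - \<alpha>) (root_ray \<Sigma> \<alpha>))) * (Var \<mu> * partial (\<mu> + \<alpha>) f)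
        else 0)"

definition extended_gkz_ideal ::
    "(real ^ 'n) set set \<Rightarrow> ((int ^ 'n) cpoly \<Rightarrow> (int ^ 'n) cpoly) set" where
  "extended_gkz_ideal \<Sigma> =
     left_ideal (lattice_points \<Sigma>)
       ({box_operator \<Sigma> l | l.
           (\<Sum>\<mu>\<in>lattice_points \<Sigma>. l \<mu>) = 0 \<and> (\<Sum>\<mu>\<in>lattice_points \<Sigma>. l \<mu> *s \<mu>) = 0} \<union>
        Set.range (torus_operator \<Sigma>) \<union>
        {\<lambda>f. euler_operator (lattice_points \<Sigma>) f + f} \<union>
        root_operator \<Sigma> ` roots \<Sigma>)"

end

theory Submission
  imports Defs
begin

text \<open>
  A degree-preserving derivation of \<open>S\<close> sends \<open>w\<^sub>\<rho>\<close> to a combination of monomials of degree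
  \<open>[D\<^sub>\<rho>]\<close>, which are \<open>w\<^sub>\<rho>\<close> itself and the \<open>w\<^sub>\<rho> t\<^sup>\<alpha>\<close> for the roots
  \<open>\<alpha>\<close> with \<open>\<rho>\<^sub>\<alpha> = \<rho>\<close>, because the rays of a complete fan positively span \<open>N\<^sub>\<real>\<close>.
  So \<open>Lie(G)\<close> is spanned by \<open>w\<^sub>\<rho> \<partial>/\<partial>w\<^sub>\<rho>\<close> and the root derivations
  \<open>w\<^sub>\<rho> t\<^sup>\<alpha> \<partial>/\<partial>w\<^sub>\<rho>\<close>.  The former have \<open>d\<chi> = 1\<close> and give
  \<open>\<Sum>\<^sub>\<mu> (\<langle>\<mu>,\<rho>\<rangle> + 1) b\<^sub>\<mu> \<partial>\<^sub>\<mu> + 1\<close>, a torus operator plus the Euler operator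
  of the GKZ system; the latter have \<open>d\<chi> = 0\<close> and give \<open>Z\<^sub>\<alpha>\<close>.
  The ideal of the cone is the toric ideal, spanned by binomials since distinct characters of a torus are
  linearly independent, and this accounts for the box operators.
\<close>

section \<open>Polynomials and differential operators\<close>

text \<open>\<open>Lie_Aut_g\<close> consists of velocities of one-parameter subgroups, so a
  spanning set has to be replaced by something computable. For an arbitrary velocity
  \<open>x\<close>, the Leibniz rule expresses Z(x) through the values x(w_\<rho>), and the
  coefficient of t^\<nu> in x(t^\<mu>) sees x(w_\<rho>) only at the exponent of w_\<rho>
  t^(\<nu>-\<mu>). Hence Z(x) + d\<chi>(x) is a finite combination of ray and root operators, with
  no basis chosen. Conversely, two explicit flows, w_\<rho> -> e^t w_\<rho> and w_\<rho> -> w_\<rho>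
  + t w_\<rho> t^\<alpha>, realise each of these operators. The generator Euler + 1 is separated
  from the ray operators by the scaling factor of the group: changing \<open>c\<close> in
  \<open>(x, c)\<close> adds a multiple of Euler + 1. The torus operators are then real combinations
  of ray operators, because the rays span the whole space. Completeness of the fan also enters
  through a bound on characters in terms of their pairings with the rays. It makes the set of
  sections finite and recovers a character from these pairings.\<close>

abbreviation "lookup \<equiv> Poly_Mapping.lookup"
abbreviation "keys \<equiv> Poly_Mapping.keys"
abbreviation "single \<equiv> Poly_Mapping.single"

lemma keys_add_nat: "keys (a + b :: 'v monom) = keys a \<union> keys b"
  by (auto simp: in_keys_iff lookup_add)

lemma Const_add: "Const (a + b) = Const a + Const b"
  by (simp add: Const_def single_add)

lemma Const_mult: "Const (a * b) = Const a * Const b"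
  by (simp add: Const_def mult_single)

lemma Const_0 [simp]: "Const 0 = 0"
  by (simp add: Const_def)

lemma Const_1 [simp]: "Const 1 = 1"
  by (simp add: Const_def)

lemma Const_sum: "Const (sum f A) = (\<Sum>i\<in>A. Const (f i))"
  by (induction A rule: infinite_finite_induct) (auto simp: Const_add)

lemma Const_mult_single: "Const c * single m d = single m (c * d)"
  by (simp add: Const_def mult_single)

lemma single_conv_Monom: "single m c = Const c * Monom m"
  by (simp add: Monom_def Const_mult_single)

lemma Monom_0 [simp]: "Monom 0 = 1"
  by (simp add: Monom_def)

lemma Monom_add: "Monom (a + b) = Monom a * Monom b"
  by (simp add: Monom_def mult_single)

lemma keys_Monom [simp]: "keys (Monom m) = {m}"
  by (simp add: Monom_def)

lemma lookup_Monom: "lookup (Monom m) k = (if m = k then 1 else 0)"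
  by (simp add: Monom_def lookup_single when_def)

lemma poly_eq_sum: "f = (\<Sum>m\<in>keys f. single m (lookup f m))"
proof (rule poly_mapping_eqI)
  fix k
  have "(\<Sum>m\<in>keys f. lookup (single m (lookup f m)) k)
      = (\<Sum>m\<in>keys f. if m = k then lookup f k else 0)"
    by (intro sum.cong) (auto simp: lookup_single when_def)
  then show "lookup f k = lookup (\<Sum>m\<in>keys f. single m (lookup f m)) k"
    by (simp add: lookup_sum in_keys_iff)
qed

lemma cpoly_induct [case_names zero single add]:
  assumes "P 0" "\<And>m c. P (single m c)" "\<And>f g. P f \<Longrightarrow> P g \<Longrightarrow> P (f + g)"
  shows "P (f :: 'v cpoly)"
proof -
  have "P (\<Sum>m\<in>K. single m (lookup f m))" if "finite K" for K
    using that by induction (auto intro: assms)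
  from this[of "keys f"] show ?thesis
    by (simp flip: poly_eq_sum)
qed

lemma poly_ring_induct [consumes 1, case_names zero single add]:
  assumes "f \<in> poly_ring A" "P 0" "\<And>m c. keys m \<subseteq> A \<Longrightarrow> P (single m c)"
    "\<And>f g. f \<in> poly_ring A \<Longrightarrow> g \<in> poly_ring A \<Longrightarrow> P f \<Longrightarrow> P g \<Longrightarrow> P (f + g)"
  shows "P f"
proof -
  have "P (\<Sum>m\<in>K. single m (lookup f m)) \<and> (\<Sum>m\<in>K. single m (lookup f m)) \<in> poly_ring A"
    if "finite K" "K \<subseteq> keys f" for K
    using that
  proof induction
    case (insert m K)
    have "single m (lookup f m) \<in> poly_ring A" "keys m \<subseteq> A"
      using assms(1) insert.prems by (auto simp: poly_ring_def split: if_splits)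
    moreover have "u + v \<in> poly_ring A" if "u \<in> poly_ring A" "v \<in> poly_ring A" for u v
      using that keys_add[of u v] by (force simp: poly_ring_def)
    ultimately show ?case
      using insert by (auto intro!: assms(3,4))
  qed (auto intro: assms(2) simp: poly_ring_def)
  from this[of "keys f"] show ?thesis
    by (simp flip: poly_eq_sum)
qed

lemma poly_ring_0 [intro]: "0 \<in> poly_ring A"
  by (simp add: poly_ring_def)

lemma poly_ring_single: "keys m \<subseteq> A \<Longrightarrow> single m c \<in> poly_ring A"
  by (auto simp: poly_ring_def split: if_splits)

lemma poly_ring_Monom: "keys m \<subseteq> A \<Longrightarrow> Monom m \<in> poly_ring A"
  by (simp add: poly_ring_single Monom_def)

lemma poly_ring_1 [intro]: "1 \<in> poly_ring A"
  by (simp add: poly_ring_def)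

lemma poly_ring_Const [intro]: "Const c \<in> poly_ring A"
  by (simp add: Const_def poly_ring_single)

lemma poly_ring_Var: "v \<in> A \<Longrightarrow> Var v \<in> poly_ring A"
  by (simp add: Var_def poly_ring_Monom)

lemma poly_ring_add: "f \<in> poly_ring A \<Longrightarrow> g \<in> poly_ring A \<Longrightarrow> f + g \<in> poly_ring A"
  using keys_add[of f g] by (force simp: poly_ring_def)

lemma poly_ring_mult: "f \<in> poly_ring A \<Longrightarrow> g \<in> poly_ring A \<Longrightarrow> f * g \<in> poly_ring A"
  using keys_mult[of f g] by (fastforce simp: poly_ring_def keys_add_nat)

lemma poly_ring_prod: "(\<And>i. i \<in> I \<Longrightarrow> f i \<in> poly_ring A) \<Longrightarrow> prod f I \<in> poly_ring A"
  by (induction I rule: infinite_finite_induct) (auto intro: poly_ring_mult)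

lemma poly_ring_power: "f \<in> poly_ring A \<Longrightarrow> f ^ n \<in> poly_ring A"
  by (induction n) (auto intro: poly_ring_mult)

section \<open>Coefficients of products\<close>

lemma finite_decompositions: "finite {(a, b). a + b = (k :: 'v monom)}"
proof -
  \<comment> \<open>In a decomposition \<open>a + b = k\<close> the exponents of \<open>a\<close>
    are bounded by those of \<open>k\<close> and vanish off \<open>keys k\<close>; so
    \<open>a\<close>, and with it \<open>b\<close>, is determined by a point of a finite
    box.\<close>
  define B where "B = PiE (keys k) (\<lambda>v. {..lookup k v})"
  have "finite B"
    unfolding B_def by (rule finite_PiE) auto
  moreover have "(\<lambda>(a, b). restrict (lookup a) (keys k)) ` {(a, b). a + b = k} \<subseteq> B"
    by (auto simp: B_def lookup_add)
  moreover have "inj_on (\<lambda>(a, b). restrict (lookup a) (keys k)) {(a, b). a + b = k}"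
  proof (rule inj_onI)
    fix p q :: "'v monom \<times> 'v monom"
    assume asm: "p \<in> {(a, b). a + b = k}" "q \<in> {(a, b). a + b = k}"
      "(case p of (a, b) \<Rightarrow> restrict (lookup a) (keys k)) = (case q of (a, b) \<Rightarrow> restrict (lookup a) (keys k))"
    obtain a b a' b' where pq: "p = (a, b)" "q = (a', b')" by (meson surj_pair)
    have *: "a + b = a' + b'" "k = a' + b'" "restrict (lookup a) (keys (a' + b')) = restrict (lookup a') (keys (a' + b'))"
      using asm pq by auto
    have "a = a'"
    proof (rule poly_mapping_eqI)
      fix v
      show "lookup a v = lookup a' v"
      proof (cases "v \<in> keys (a' + b')")
        case True
        then show ?thesis using fun_cong[OF *(3), of v] by simp
      next
        case False
        then have "v \<notin> keys a" "v \<notin> keys a'"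
          using keys_add_nat[of a b] keys_add_nat[of a' b'] *(1) by auto
        then show ?thesis by (simp add: in_keys_iff)
      qed
    qed
    then show "p = q" using *(1) pq by simp
  qed
  ultimately show ?thesis
    by (meson inj_on_finite)
qed

text \<open>The index set is the same for all \<open>f\<close> and \<open>g\<close>, unlike a sum
  over their keys. This allows a product of two curves of polynomials, whose supports may vary with
  the parameter, to be differentiated term by term.\<close>

lemma lookup_times:
  "lookup (f * g :: 'v cpoly) k = (\<Sum>(a, b)\<in>{(a, b). a + b = k}. lookup f a * lookup g b)"
proof -
  have "lookup (f * g) k = prod_fun (lookup f) (lookup g) k"
    by (simp add: times_poly_mapping.rep_eq)
  also have "\<dots> = Sum_any (\<lambda>(a, b). lookup f a * lookup g b when k = a + b)"
    by (rule prod_fun_unfold_prod) auto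
  also have "\<dots> = (\<Sum>(a, b)\<in>{(a, b). a + b = k}. lookup f a * lookup g b when k = a + b)"
    by (rule Sum_any.expand_superset[OF finite_decompositions]) auto
  also have "\<dots> = (\<Sum>(a, b)\<in>{(a, b). a + b = k}. lookup f a * lookup g b)"
    by (rule sum.cong) auto
  finally show ?thesis .
qed

lemma lookup_Const_mult [simp]: "lookup (Const c * f) m = c * lookup (f :: 'v cpoly) m"
proof -
  have "Const c * f = Poly_Mapping.map ((*) c) f"
    by (simp add: mult_map_scale_conv_mult Const_def)
  then show ?thesis by (simp add: map.rep_eq when_def)
qed

lemma lookup_Monom_mult_add: "lookup (Monom a * f) (a + m) = lookup (f :: 'v cpoly) m"
proof -
  have "lookup (Monom a * f) (a + m) = (\<Sum>p\<in>{(x, y). x + y = a + m}. if p = (a, m) then lookup f m else 0)"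
    unfolding lookup_times by (rule sum.cong) (auto simp: lookup_Monom split: if_splits)
  also have "\<dots> = lookup f m"
    by (simp add: finite_decompositions)
  finally show ?thesis .
qed

lemma lookup_Monom_mult_not_add:
  assumes "\<And>c. m \<noteq> a + c"
  shows "lookup (Monom a * f :: 'v cpoly) m = 0"
  unfolding lookup_times by (rule sum.neutral) (use assms in \<open>auto simp: lookup_Monom\<close>)

section \<open>Partial derivatives and their monomials\<close>

lemma partial_single: "partial v (single m c) = single (m - single v 1) (of_nat (lookup m v) * c)"
  by (simp add: partial_def)

lemma partial_add: "partial v (f + g) = partial v f + partial v g"
  unfolding partial_def by (rule setsum_keys_plus_distrib) (auto simp: single_add ring_distribs)

lemma partial_0 [simp]: "partial v 0 = 0"
  by (simp add: partial_def)

lemma partial_commute: "partial u (partial v f) = partial v (partial u f)"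
proof (cases "u = v")
  case False
  show ?thesis
  proof (induction f rule: cpoly_induct)
    case (single m c)
    then show ?case using False
      by (simp add: partial_single lookup_minus lookup_single cancel_ab_semigroup_add_class.diff_right_commute[of m] mult_ac)
  qed (auto simp: partial_add)
qed auto

lemma funpow_commute:
  assumes "\<And>x. f (g x) = g (f x)"
  shows "(f ^^ i) ((g ^^ j) x) = (g ^^ j) ((f ^^ i) x)"
proof -
  have 1: "f ((g ^^ j) x) = (g ^^ j) (f x)" for x
    by (induction j) (auto simp: assms)
  show ?thesis by (induction i) (auto simp: 1)
qed

text \<open>\<open>partial_power\<close> folds over a set without an order, which is meaningful only
  because these iterates commute.\<close>

lemma comp_fun_commute_partial: "comp_fun_commute (\<lambda>v. partial v ^^ k v)"
  by standard (auto simp: fun_eq_iff intro!: funpow_commute partial_commute)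

lemma partial_power_empty [simp]: "partial_power {} k f = f"
  by (simp add: partial_power_def)

lemma partial_power_insert:
  "finite A \<Longrightarrow> v \<notin> A \<Longrightarrow> partial_power (insert v A) k f = (partial v ^^ k v) (partial_power A k f)"
  unfolding partial_power_def
  by (rule comp_fun_commute_on.fold_insert[OF comp_fun_commute_partial[unfolded comp_fun_commute_def']]) auto

lemma partial_power_cong:
  assumes "finite A" "\<And>v. v \<in> A \<Longrightarrow> k v = l v"
  shows "partial_power A k f = partial_power A l f"
  using assms by induction (auto simp: partial_power_insert)

text \<open>Reconciles two index sets: \<open>poly_in_partials\<close> takes the product over the
  support of a monomial, \<open>box_operator\<close> over all lattice points. The extra factors are
  zeroth iterates.\<close>

lemma partial_power_superset:
  assumes "finite B" "A \<subseteq> B" "\<And>v. v \<in> B - A \<Longrightarrow> k v = 0"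
  shows "partial_power B k f = partial_power A k f"
proof -
  have "finite A" using assms finite_subset by blast
  have "partial_power (A \<union> C) k f = partial_power A k f" if "finite C" "C \<inter> A = {}" "\<And>v. v \<in> C \<Longrightarrow> k v = 0" for C
    using that by induction (auto simp: partial_power_insert \<open>finite A\<close>)
  from this[of "B - A"] show ?thesis
    using assms by (auto simp: Un_absorb1)
qed

lemma partial_power_partial:
  assumes "finite A"
  shows "(partial v ^^ i) (partial_power A k f) = partial_power A k ((partial v ^^ i) f)"
  using assms
proof induction
  case (insert u A)
  then show ?case
    by (simp add: partial_power_insert funpow_commute[of "partial v" "partial u", OF partial_commute])
qed auto

lemma partial_power_add:
  assumes "finite A"
  shows "partial_power A (\<lambda>v. k v + l v) f = partial_power A k (partial_power A l f)"
  using assms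
  by induction (auto simp: partial_power_insert funpow_add partial_power_partial)

section \<open>The Weyl algebra and its left ideals\<close>

lemma weyl_algebra_add_distrib:
  assumes "P \<in> weyl_algebra A"
  shows "P (f + g) = P f + P g"
  using assms by (induction arbitrary: f g) (auto simp: partial_add algebra_simps)

lemma weyl_algebra_0:
  assumes "P \<in> weyl_algebra A"
  shows "P 0 = 0"
  using assms by induction auto

lemma weyl_algebra_id: "(\<lambda>f. f) \<in> weyl_algebra A"
proof -
  have "(\<lambda>f. Const 1 * f) = (\<lambda>f :: 'a cpoly. f)" by auto
  then show ?thesis using weyl_algebra.const[of 1 A] by metis
qed

lemma weyl_algebra_funpow: "P \<in> weyl_algebra A \<Longrightarrow> P ^^ n \<in> weyl_algebra A"
  by (induction n) (auto intro: weyl_algebra.comp weyl_algebra_id simp: id_def)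

lemma weyl_algebra_partial_power:
  assumes "finite B" "B \<subseteq> A"
  shows "partial_power B k \<in> weyl_algebra A"
  using assms
proof induction
  case empty
  have "partial_power {} k = (\<lambda>f. f)" by auto
  then show ?case by (simp add: weyl_algebra_id)
next
  case (insert v B)
  have "partial_power (insert v B) k = (partial v ^^ k v) \<circ> partial_power B k"
    using insert by (auto simp: partial_power_insert)
  moreover have "(partial v ^^ k v) \<circ> partial_power B k \<in> weyl_algebra A"
    using insert by (intro weyl_algebra.comp weyl_algebra_funpow weyl_algebra.partial) auto
  ultimately show ?case by metis
qed

lemma left_ideal_gen: "Q \<in> X \<Longrightarrow> Q \<in> left_ideal A X"
  using left_ideal.mult[OF weyl_algebra_id, of Q X A] by (simp add: comp_def)

text \<open>\<open>left_ideal\<close> multiplies only generators, so closure under left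
  multiplication has to be derived. Sums are handled because every element of the Weyl algebra is an
  additive map.\<close>

lemma left_ideal_mult:
  assumes "P \<in> weyl_algebra A" "Q \<in> left_ideal A X"
  shows "P \<circ> Q \<in> left_ideal A X"
  using assms(2)
proof induction
  case zero
  have "P \<circ> (\<lambda>f. 0) = (\<lambda>f :: 'a cpoly. 0)"
    using weyl_algebra_0[OF assms(1)] by auto
  then show ?case by (simp only: left_ideal.zero)
next
  case (mult R S)
  have "(P \<circ> R) \<circ> S \<in> left_ideal A X"
    using mult assms(1) by (intro left_ideal.mult weyl_algebra.comp)
  then show ?case by (simp only: o_assoc)
next
  case (add R S)
  have "P \<circ> (\<lambda>f. R f + S f) = (\<lambda>f. (P \<circ> R) f + (P \<circ> S) f)"
    by (auto simp: weyl_algebra_add_distrib[OF assms(1)])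
  then show ?case using add by (simp only: left_ideal.add)
qed

lemma left_ideal_subset:
  assumes "X \<subseteq> left_ideal A Y"
  shows "left_ideal A X \<subseteq> left_ideal A Y"
proof
  fix P assume "P \<in> left_ideal A X"
  then show "P \<in> left_ideal A Y"
    by induction (use assms left_ideal_mult in \<open>blast intro: left_ideal.zero left_ideal.add\<close>)+
qed

lemma left_ideal_scale:
  assumes "Q \<in> left_ideal A X"
  shows "(\<lambda>f. Const c * Q f) \<in> left_ideal A X"
  using left_ideal_mult[OF weyl_algebra.const assms, of c] by (simp add: comp_def)

lemma left_ideal_diff:
  assumes "P \<in> left_ideal A X" "Q \<in> left_ideal A X"
  shows "(\<lambda>f. P f - Q f) \<in> left_ideal A X"
proof -
  have "Const (-1) = (-1 :: 'a cpoly)"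
    by (simp add: Const_def single_uminus)
  then show ?thesis
    using left_ideal.add[OF assms(1) left_ideal_scale[OF assms(2), of "-1"]] by simp
qed

lemma left_ideal_sum:
  assumes "\<And>i. i \<in> I \<Longrightarrow> Q i \<in> left_ideal A X"
  shows "(\<lambda>f. \<Sum>i\<in>I. Q i f) \<in> left_ideal A X"
  using assms
  by (induction I rule: infinite_finite_induct) (auto intro: left_ideal.zero left_ideal.add)

lemma eval_poly_single: "eval_poly (single m c) a = c * (\<Prod>v\<in>keys m. a v ^ lookup m v)"
  by (simp add: eval_poly_def)

lemma eval_poly_add: "eval_poly (f + g) a = eval_poly f a + eval_poly g a"
  unfolding eval_poly_def by (rule setsum_keys_plus_distrib) (auto simp: algebra_simps)

lemma poly_in_partials_single:
  "poly_in_partials (single m c) f = Const c * partial_power (keys m) (lookup m) f"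
  by (simp add: poly_in_partials_def)

lemma poly_in_partials_add:
  "poly_in_partials (p + q) f = poly_in_partials p f + poly_in_partials q f"
  unfolding poly_in_partials_def
  by (rule setsum_keys_plus_distrib) (auto simp: Const_add algebra_simps)

section \<open>The fan\<close>

lemma pairing_add_left: "pairing (a + b) u = pairing a u + pairing b u"
  by (simp add: pairing_def distrib_right sum.distrib)

lemma pairing_diff_left: "pairing (a - b) u = pairing a u - pairing b u"
  by (simp add: pairing_def left_diff_distrib sum_subtractf)

lemma pairing_smult_left: "pairing (k *s a) u = k * pairing a u"
  by (simp add: pairing_def sum_distrib_left mult.assoc)

lemma pairing_0_left [simp]: "pairing 0 u = 0"
  by (simp add: pairing_def)

lemma pairing_sum_left: "pairing (sum f A) u = (\<Sum>i\<in>A. pairing (f i) u)"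
  by (induction A rule: infinite_finite_induct) (auto simp: pairing_add_left)

lemma pairing_smult_right: "pairing a (k *s u) = k * pairing a u"
  by (simp add: pairing_def sum_distrib_left mult_ac)

lemma pairing_axis: "pairing m (axis j 1) = m $ j"
proof -
  have "pairing m (axis j 1) = (\<Sum>i\<in>UNIV. if i = j then m $ i else 0)"
    unfolding pairing_def by (rule sum.cong) (auto simp: axis_def)
  then show ?thesis by simp
qed

lemma inner_real_vec: "real_vec m \<bullet> real_vec u = of_int (pairing m u)"
  by (simp add: real_vec_def inner_vec_def pairing_def)

lemma inner_axis_real_vec: "real_vec m \<bullet> axis j 1 = of_int (m $ j)"
  by (simp add: real_vec_def inner_axis)

lemma primitive_nonzero: "primitive \<rho> \<Longrightarrow> \<rho> \<noteq> 0"
proof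
  assume "primitive \<rho>" "\<rho> = 0"
  then have "is_unit (2 :: int)"
    unfolding primitive_def by (metis vector_smult_rzero)
  then show False by simp
qed

section \<open>Cones, ray generators and completeness\<close>

lemma convex_cone_sums_of:
  fixes g :: "'a \<Rightarrow> 'b :: real_vector"
  assumes "finite A"
  shows "convex_cone {x. \<exists>c. (\<forall>a\<in>A. 0 \<le> c a) \<and> x = (\<Sum>a\<in>A. c a *\<^sub>R g a)}"
  unfolding convex_cone_iff
proof (intro conjI ballI allI impI; clarsimp?)
  show "\<exists>c. (\<forall>a\<in>A. 0 \<le> c a) \<and> (\<Sum>a\<in>A. c a *\<^sub>R g a) = 0"
    by (rule exI[of _ "\<lambda>_. 0"]) auto
next
  fix c d :: "'a \<Rightarrow> real" assume "\<forall>a\<in>A. 0 \<le> c a" "\<forall>a\<in>A. 0 \<le> d a"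
  then show "\<exists>e. (\<forall>a\<in>A. 0 \<le> e a) \<and> (\<Sum>a\<in>A. c a *\<^sub>R g a) + (\<Sum>a\<in>A. d a *\<^sub>R g a) = (\<Sum>a\<in>A. e a *\<^sub>R g a)"
    by (intro exI[of _ "\<lambda>a. c a + d a"]) (auto simp: algebra_simps sum.distrib)
next
  fix k :: real and c :: "'a \<Rightarrow> real" assume "\<forall>a\<in>A. 0 \<le> c a" "0 \<le> k"
  then show "\<exists>e. (\<forall>a\<in>A. 0 \<le> e a) \<and> k *\<^sub>R (\<Sum>a\<in>A. c a *\<^sub>R g a) = (\<Sum>a\<in>A. e a *\<^sub>R g a)"
    by (intro exI[of _ "\<lambda>a. k * c a"]) (auto simp: scaleR_sum_right)
qed

lemma convex_cone_hull_image_finite: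
  fixes g :: "'a \<Rightarrow> 'b :: real_vector"
  assumes "finite A"
  shows "convex_cone hull (g ` A) = {x. \<exists>c. (\<forall>a\<in>A. 0 \<le> c a) \<and> x = (\<Sum>a\<in>A. c a *\<^sub>R g a)}"
    (is "_ = ?R")
proof
  show "convex_cone hull (g ` A) \<subseteq> ?R"
  proof (rule hull_minimal)
    show "g ` A \<subseteq> ?R"
    proof clarify
      fix a assume "a \<in> A"
      have "(\<Sum>b\<in>A. (if b = a then 1 else 0) *\<^sub>R g b) = (\<Sum>b\<in>A. if b = a then g b else 0)"
        by (rule sum.cong) auto
      then show "\<exists>c. (\<forall>a\<in>A. 0 \<le> c a) \<and> g a = (\<Sum>a\<in>A. c a *\<^sub>R g a)"
        using \<open>a \<in> A\<close> assms by (intro exI[of _ "\<lambda>b. if b = a then 1 else 0"]) simp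
    qed
  qed (rule convex_cone_sums_of[OF assms])
next
  have "(\<Sum>a\<in>B. c a *\<^sub>R g a) \<in> convex_cone hull (g ` A)" if "finite B" "B \<subseteq> A" "\<forall>a\<in>A. 0 \<le> c a" for B c
    using that
  proof induction
    case (insert x B)
    then have "c x *\<^sub>R g x \<in> convex_cone hull (g ` A)"
      by (intro convex_cone_hull_mul hull_inc) auto
    with insert show ?case by (auto intro: convex_cone_hull_add)
  qed (simp add: convex_cone_hull_contains_0)
  then show "?R \<subseteq> convex_cone hull (g ` A)"
    using assms by auto
qed

lemma convex_cone_hull_real_vec_singleton:
  "convex_cone hull {real_vec \<rho>} = {t *\<^sub>R real_vec \<rho> | t. 0 \<le> t}"
proof -
  have "convex_cone hull {real_vec \<rho>} = {x. \<exists>c. 0 \<le> c \<rho> \<and> x = c \<rho> *\<^sub>R real_vec \<rho>}"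
    using convex_cone_hull_image_finite[of "{\<rho>}" real_vec] by simp
  also have "\<dots> = {t *\<^sub>R real_vec \<rho> | t. 0 \<le> t}"
    by (auto intro: exI[of _ "\<lambda>_. _ :: real"])
  finally show ?thesis .
qed

text \<open>The two generators are proportional by a nonnegative factor. Cross-multiplying
  coordinates and reducing one ratio to a fraction \<open>a / b\<close> shows that \<open>b\<close>
  divides all of \<open>\<rho>'\<close> and \<open>a\<close> all of \<open>\<rho>\<close>.
  Primitivity makes both units, and the sign of the factor excludes \<open>a = - b\<close>. A finite
  fan therefore has finitely many rays.\<close>

lemma primitive_ray_unique:
  assumes "primitive \<rho>" "primitive \<rho>'" "convex_cone hull {real_vec \<rho>} = convex_cone hull {real_vec \<rho>'}"
  shows "\<rho> = \<rho>'"
proof -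
  have "real_vec \<rho> \<in> convex_cone hull {real_vec \<rho>'}"
    unfolding assms(3)[symmetric] by (rule hull_inc) simp
  then obtain t where t: "t \<ge> 0" "real_vec \<rho> = t *\<^sub>R real_vec \<rho>'"
    unfolding convex_cone_hull_real_vec_singleton by auto
  have comp: "of_int (\<rho> $ i) = t * of_int (\<rho>' $ i)" for i
    using arg_cong[OF t(2), of "\<lambda>v. v $ i"] by (simp add: real_vec_def)
  obtain i where i: "\<rho>' $ i \<noteq> 0"
    using primitive_nonzero[OF assms(2)] by (metis vec_eq_iff zero_index)
  have cross: "\<rho>' $ i * \<rho> $ j = \<rho> $ i * \<rho>' $ j" for j
  proof -
    have "real_of_int (\<rho>' $ i * \<rho> $ j) = real_of_int (\<rho> $ i * \<rho>' $ j)"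
      using comp[of i] comp[of j] by simp
    then show ?thesis by linarith
  qed
  define g where "g = gcd (\<rho> $ i) (\<rho>' $ i)"
  have g0: "g \<noteq> 0" using i by (simp add: g_def)
  obtain a b where ab: "\<rho> $ i = a * g" "\<rho>' $ i = b * g" "coprime a b"
    using gcd_coprime_exists[of "\<rho> $ i" "\<rho>' $ i"] g0 unfolding g_def by metis
  have ab': "b * \<rho> $ j = a * \<rho>' $ j" for j
    using cross[of j] g0 by (simp add: ab)
  have "b dvd \<rho>' $ j" for j
    using ab'[of j] ab(3) by (metis coprime_commute coprime_dvd_mult_right_iff dvd_triv_left)
  then have "\<rho>' = b *s (\<chi> j. \<rho>' $ j div b)"
    by (simp add: vec_eq_iff)
  then have ub: "is_unit b" using assms(2) unfolding primitive_def by blast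
  have "a dvd \<rho> $ j" for j
    using ab'[of j] ab(3) by (metis coprime_dvd_mult_right_iff dvd_triv_left)
  then have "\<rho> = a *s (\<chi> j. \<rho> $ j div a)"
    by (simp add: vec_eq_iff)
  then have ua: "is_unit a" using assms(1) unfolding primitive_def by blast
  have "real_of_int a = t * real_of_int b"
    using comp[of i] g0 by (simp add: ab)
  moreover have "a = 1 \<or> a = -1" "b = 1 \<or> b = -1"
    using ua ub by auto
  ultimately have "a = b" using t(1) by auto
  moreover have "b \<noteq> 0" using ub by auto
  ultimately have "\<rho> $ j = \<rho>' $ j" for j
    using ab'[of j] by auto
  then show ?thesis
    by (simp add: vec_eq_iff)
qed

lemma finite_rays:
  assumes "finite \<Sigma>"
  shows "finite (rays \<Sigma>)"
proof -
  have "inj_on (\<lambda>\<rho>. convex_cone hull {real_vec \<rho>}) (rays \<Sigma>)"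
    by (rule inj_onI) (auto simp: rays_def intro: primitive_ray_unique)
  moreover have "(\<lambda>\<rho>. convex_cone hull {real_vec \<rho>}) ` rays \<Sigma> \<subseteq> \<Sigma>"
    by (auto simp: rays_def)
  ultimately show ?thesis
    using assms by (meson inj_on_finite)
qed

text \<open>By uniqueness of the expansion, the coordinate along \<open>u\<close> is additive and
  homogeneous, hence a linear form; its values on the standard basis are the entries of
  \<open>k\<close>.\<close>

lemma lattice_basis_dual:
  assumes "lattice_basis B" "u \<in> B"
  obtains k where "\<And>v. v \<in> B \<Longrightarrow> pairing k v = (if v = u then 1 else 0)"
proof -
  have fin: "finite B" using assms by (simp add: lattice_basis_def)
  define rep where "rep v c \<longleftrightarrow> (\<forall>u. u \<notin> B \<longrightarrow> c u = 0) \<and> v = (\<Sum>u\<in>B. c u *s u)" for v and c :: "int ^ 'a \<Rightarrow> int"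
  have ex1: "\<exists>!c. rep v c" for v
    using assms(1) unfolding lattice_basis_def rep_def by blast
  define c where "c v = (THE c. rep v c)" for v
  have c: "rep v (c v)" for v
    unfolding c_def using theI'[OF ex1] .
  have cI: "c v = d" if "rep v d" for v d
    using ex1[of v] c[of v] that by blast
  have c_out: "c v u = 0" if "u \<notin> B" for v u
    using c that unfolding rep_def by blast
  have c_eq: "(\<Sum>u\<in>B. c v u *s u) = v" for v
    using c[of v] unfolding rep_def by metis
  have c_add: "c (v + w) x = c v x + c w x" for v w x
  proof -
    have "rep (v + w) (\<lambda>x. c v x + c w x)"
      unfolding rep_def by (simp add: c_out vector_sadd_rdistrib sum.distrib c_eq)
    from cI[OF this] show ?thesis by simp
  qed
  have c_smult: "c (k *s v) x = k * c v x" for k v x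
  proof -
    have "k *s v = k *s (\<Sum>u\<in>B. c v u *s u)" by (simp add: c_eq)
    also have "\<dots> = (\<Sum>u\<in>B. (k * c v u) *s u)"
      by (simp add: vec_eq_iff sum_component sum_distrib_left mult.assoc)
    finally have "rep (k *s v) (\<lambda>x. k * c v x)"
      unfolding rep_def by (simp add: c_out)
    from cI[OF this] show ?thesis by simp
  qed
  have c_0: "c 0 x = 0" for x using c_smult[of 0 0 x] by simp
  have c_sum: "c (sum f I) x = (\<Sum>i\<in>I. c (f i) x)" for f :: "'a \<Rightarrow> int ^ 'a" and I x
    by (induction I rule: infinite_finite_induct) (auto simp: c_0 c_add)
  have c_unit: "c v x = (if x = v then 1 else 0)" if "v \<in> B" for v x
  proof -
    have "(\<Sum>u\<in>B. (if u = v then 1 else 0) *s u) = (\<Sum>u\<in>B. if u = v then u else 0)"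
      by (rule sum.cong) auto
    then have "rep v (\<lambda>x. if x = v then 1 else 0)"
      using that fin unfolding rep_def by auto
    from cI[OF this] show ?thesis by simp
  qed
  define k where "k = (\<chi> i. c (axis i 1) u)"
  have "pairing k v = c v u" for v
  proof -
    have "v = (\<Sum>i\<in>UNIV. (v $ i) *s axis i 1)"
      by (simp add: basis_expansion)
    then have "c v u = (\<Sum>i\<in>UNIV. c ((v $ i) *s axis i 1) u)"
      using c_sum by metis
    then show ?thesis by (simp add: c_smult k_def pairing_def mult.commute)
  qed
  then show ?thesis
    using c_unit by (intro that[of k]) auto
qed

text \<open>A generator \<open>a\<close> is primitive since its dual form takes the value 1 on it,
  and the sum of the dual forms of the other generators supports the cone exactly along the ray
  through \<open>a\<close>. That ray is a face, so it belongs to the fan.\<close>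

lemma smooth_cone_generators:
  assumes fan: "is_fan \<Sigma>" and \<sigma>: "\<sigma> \<in> \<Sigma>" "\<sigma> = convex_cone hull (real_vec ` A)"
    and B: "lattice_basis B" "A \<subseteq> B"
  shows "A \<subseteq> rays \<Sigma>"
proof
  fix a assume a: "a \<in> A"
  have fin: "finite A" using B finite_subset unfolding lattice_basis_def by blast
  have "\<forall>u\<in>B. \<exists>k. \<forall>v\<in>B. pairing k v = (if v = u then 1 else 0)"
    using lattice_basis_dual[OF B(1)] by metis
  then obtain k where k: "\<And>u v. u \<in> B \<Longrightarrow> v \<in> B \<Longrightarrow> pairing (k u) v = (if v = u then 1 else 0)"
    by metis
  have "primitive a"
    unfolding primitive_def
  proof (intro allI impI)
    fix l v assume "a = l *s v"
    then have "1 = l * pairing (k a) v"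
      using k[of a a] a B(2) by (metis pairing_smult_right subsetD)
    then show "is_unit l" by (metis dvd_triv_left)
  qed
  define K where "K = real_vec (\<Sum>u\<in>A - {a}. k u)"
  have K: "K \<bullet> real_vec v = (if v = a then 0 else 1)" if "v \<in> A" for v
  proof -
    have "pairing (\<Sum>u\<in>A - {a}. k u) v = (\<Sum>u\<in>A - {a}. if u = v then 1 else 0)"
      unfolding pairing_sum_left using k that B(2) by (intro sum.cong) (auto simp: subset_iff)
    also have "\<dots> = (if v = a then 0 else 1)"
      using that fin by simp
    finally show ?thesis by (simp add: K_def inner_real_vec)
  qed
  have K_sum: "K \<bullet> (\<Sum>v\<in>A. c v *\<^sub>R real_vec v) = (\<Sum>v\<in>A - {a}. c v)" for c
  proof -
    have "K \<bullet> (\<Sum>v\<in>A. c v *\<^sub>R real_vec v) = (\<Sum>v\<in>A. c v * (if v = a then 0 else 1))"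
      unfolding inner_sum_right using K by (intro sum.cong) auto
    also have "\<dots> = (\<Sum>v\<in>A - {a}. c v)"
      using fin a by (simp add: sum.remove)
    finally show ?thesis .
  qed
  have \<sigma>': "\<sigma> = {x. \<exists>c. (\<forall>v\<in>A. 0 \<le> c v) \<and> x = (\<Sum>v\<in>A. c v *\<^sub>R real_vec v)}"
    unfolding \<sigma>(2) by (rule convex_cone_hull_image_finite[OF fin])
  have "\<sigma> \<inter> {x. K \<bullet> x = 0} face_of \<sigma>"
  proof (rule face_of_Int_supporting_hyperplane_ge)
    show "convex \<sigma>" unfolding \<sigma>(2) by (rule convex_convex_cone_hull)
    show "K \<bullet> x \<ge> 0" if x: "x \<in> \<sigma>" for x
    proof -
      obtain c where c: "\<forall>v\<in>A. 0 \<le> c v" "x = (\<Sum>v\<in>A. c v *\<^sub>R real_vec v)"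
        using x unfolding \<sigma>' by auto
      show ?thesis unfolding c(2) K_sum using c(1) by (auto intro: sum_nonneg)
    qed
  qed
  moreover have "\<sigma> \<inter> {x. K \<bullet> x = 0} = convex_cone hull {real_vec a}"
  proof (intro equalityI subsetI)
    fix x assume x: "x \<in> \<sigma> \<inter> {x. K \<bullet> x = 0}"
    then obtain c where c: "\<forall>v\<in>A. 0 \<le> c v" "x = (\<Sum>v\<in>A. c v *\<^sub>R real_vec v)"
      unfolding \<sigma>' by auto
    have "(\<Sum>v\<in>A - {a}. c v) = 0" using x c K_sum by auto
    then have "c v = 0" if "v \<in> A - {a}" for v
      using c(1) fin that by (subst (asm) sum_nonneg_eq_0_iff) auto
    then have "x = c a *\<^sub>R real_vec a"
      unfolding c(2) using fin a by (subst sum.remove[of _ a]) auto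
    then show "x \<in> convex_cone hull {real_vec a}"
      using c(1) a unfolding convex_cone_hull_real_vec_singleton by auto
  next
    fix x assume "x \<in> convex_cone hull {real_vec a}"
    then obtain t where t: "t \<ge> 0" "x = t *\<^sub>R real_vec a"
      unfolding convex_cone_hull_real_vec_singleton by auto
    have "real_vec a \<in> \<sigma>" unfolding \<sigma>(2) using a by (intro hull_inc) auto
    then have "x \<in> \<sigma>" unfolding \<sigma>(2) t(2) using t(1) by (intro convex_cone_hull_mul)
    then show "x \<in> \<sigma> \<inter> {x. K \<bullet> x = 0}" using K[OF a] t(2) by simp
  qed
  ultimately have "convex_cone hull {real_vec a} face_of \<sigma>" by simp
  moreover have "convex_cone hull {real_vec a} \<noteq> {}" by (rule convex_cone_hull_nonempty)
  ultimately have "convex_cone hull {real_vec a} \<in> \<Sigma>"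
    using fan \<sigma>(1) unfolding is_fan_def by blast
  with \<open>primitive a\<close> show "a \<in> rays \<Sigma>" by (simp add: rays_def)
qed

text \<open>The linear form \<open>u\<close> attains its minimum on the compact polytope, and the
  normal cone of the face of minimisers contains \<open>u\<close>.\<close>

lemma projective_fan_complete:
  assumes "projective_fan \<Sigma>"
  obtains \<sigma> where "\<sigma> \<in> \<Sigma>" "u \<in> \<sigma>"
proof -
  obtain P where P: "full_dim_lattice_polytope P" "\<Sigma> = {normal_cone P F | F. F face_of P \<and> F \<noteq> {}}"
    using assms unfolding projective_fan_def by blast
  obtain V :: "(int ^ 'a) set" where V: "finite V" "P = convex hull (real_vec ` V)"
    using P(1) unfolding full_dim_lattice_polytope_def by blast
  have "P \<noteq> {}"
    using P(1) unfolding full_dim_lattice_polytope_def by (auto simp: aff_dim_empty)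
  moreover have "compact P"
    unfolding V(2) using V(1) by (intro compact_convex_hull finite_imp_compact) auto
  ultimately obtain m where m: "m \<in> P" "\<And>m'. m' \<in> P \<Longrightarrow> m \<bullet> u \<le> m' \<bullet> u"
    using continuous_attains_inf[of P "\<lambda>m. m \<bullet> u"] continuous_on_inner[OF continuous_on_id continuous_on_const]
    by metis
  define F where "F = P \<inter> {x. u \<bullet> x = u \<bullet> m}"
  have "F face_of P"
    unfolding F_def
    by (rule face_of_Int_supporting_hyperplane_ge) (use m(2) V(2) in \<open>auto simp: inner_commute\<close>)
  moreover have "F \<noteq> {}" using m(1) by (auto simp: F_def)
  moreover have "u \<in> normal_cone P F"
    using m(2) unfolding normal_cone_def F_def by (auto simp: inner_commute)
  ultimately show ?thesis
    using P(2) that by blast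
qed

lemma rays_positively_span:
  assumes "is_fan \<Sigma>" "smooth_fan \<Sigma>" "projective_fan \<Sigma>"
  obtains c where "\<And>\<rho>. \<rho> \<in> rays \<Sigma> \<Longrightarrow> 0 \<le> c \<rho>" "u = (\<Sum>\<rho>\<in>rays \<Sigma>. c \<rho> *\<^sub>R real_vec \<rho>)"
proof -
  have fin: "finite (rays \<Sigma>)"
    using assms(1) by (intro finite_rays) (simp add: is_fan_def)
  obtain \<sigma> where \<sigma>: "\<sigma> \<in> \<Sigma>" "u \<in> \<sigma>"
    using projective_fan_complete[OF assms(3)] .
  then obtain B A where A: "lattice_basis B" "A \<subseteq> B" "\<sigma> = convex_cone hull (real_vec ` A)"
    using assms(2) unfolding smooth_fan_def by blast
  have "A \<subseteq> rays \<Sigma>"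
    using smooth_cone_generators[OF assms(1) \<sigma>(1) A(3,1,2)] .
  then have "convex_cone hull (real_vec ` A) \<subseteq> convex_cone hull (real_vec ` rays \<Sigma>)"
    by (intro hull_mono) auto
  then have "u \<in> convex_cone hull (real_vec ` rays \<Sigma>)"
    using \<sigma>(2) A(3) by blast
  then show ?thesis
    using that unfolding convex_cone_hull_image_finite[OF fin] by blast
qed

section \<open>Bounds on characters from completeness\<close>

lemma lattice_points_iff: "\<mu> \<in> lattice_points \<Sigma> \<longleftrightarrow> (\<forall>\<rho>\<in>rays \<Sigma>. pairing \<mu> \<rho> \<ge> -1)"
  unfolding lattice_points_def anticanonical_polytope_def
  by (auto simp: inner_real_vec)

text \<open>Both signs of each standard basis vector are nonnegative combinations of rays, so lower
  bounds on the pairings with the rays bound every coordinate from both sides. The bound is linear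
  in \<open>l\<close> so that it serves twice: \<open>l = 1\<close> makes the set of lattice points
  finite, and \<open>l = 0\<close> forces a character with nonnegative pairings to vanish.\<close>

lemma complete_fan_bound:
  assumes "is_fan \<Sigma>" "smooth_fan \<Sigma>" "projective_fan \<Sigma>"
  obtains C :: real where "C \<ge> 0"
    "\<And>m l j. l \<ge> 0 \<Longrightarrow> (\<And>\<rho>. \<rho> \<in> rays \<Sigma> \<Longrightarrow> pairing m \<rho> \<ge> - l) \<Longrightarrow> \<bar>of_int (m $ j)\<bar> \<le> of_int l * C"
proof -
  have "\<exists>c. (\<forall>\<rho>\<in>rays \<Sigma>. 0 \<le> c \<rho>) \<and> u = (\<Sum>\<rho>\<in>rays \<Sigma>. c \<rho> *\<^sub>R real_vec \<rho>)" for u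
    using rays_positively_span[OF assms] by metis
  then obtain c where c: "\<And>u \<rho>. \<rho> \<in> rays \<Sigma> \<Longrightarrow> 0 \<le> c u \<rho>" "\<And>u. u = (\<Sum>\<rho>\<in>rays \<Sigma>. c u \<rho> *\<^sub>R real_vec \<rho>)"
    by metis
  define S where "S u = (\<Sum>\<rho>\<in>rays \<Sigma>. c u \<rho>)" for u
  have S: "S u \<ge> 0" for u unfolding S_def using c(1) by (auto intro: sum_nonneg)
  \<comment> \<open>\<open>S\<close> at the two signs of \<open>axis j 1\<close> bounds the
    \<open>j\<close>-th coordinate from the two sides; summing over all \<open>j\<close> makes the
    constant uniform.\<close>
  define C where "C = (\<Sum>j\<in>UNIV. S (axis j 1) + S (- axis j 1))"
  have *: "real_vec m \<bullet> u \<ge> - of_int l * S u" if "l \<ge> 0" "\<And>\<rho>. \<rho> \<in> rays \<Sigma> \<Longrightarrow> pairing m \<rho> \<ge> - l" for m l u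
  proof -
    have "real_vec m \<bullet> u = (\<Sum>\<rho>\<in>rays \<Sigma>. c u \<rho> * of_int (pairing m \<rho>))"
      by (subst c(2)[of u]) (simp add: inner_sum_right inner_real_vec)
    also have "\<dots> \<ge> (\<Sum>\<rho>\<in>rays \<Sigma>. c u \<rho> * of_int (- l))"
      using that(2) c(1) by (intro sum_mono mult_left_mono) (auto simp only: of_int_le_iff)
    also have "(\<Sum>\<rho>\<in>rays \<Sigma>. c u \<rho> * of_int (- l)) = - of_int l * S u"
      by (simp add: S_def sum_distrib_left sum_negf mult.commute)
    finally show ?thesis .
  qed
  show ?thesis
  proof
    show "C \<ge> 0" unfolding C_def using S by (auto intro!: sum_nonneg add_nonneg_nonneg)
  next
    fix m l j assume l: "l \<ge> 0" "\<And>\<rho>. \<rho> \<in> rays \<Sigma> \<Longrightarrow> pairing m \<rho> \<ge> - l"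
    have CS: "S (axis j 1) + S (- axis j 1) \<le> C"
      unfolding C_def using S by (intro member_le_sum) (auto intro: add_nonneg_nonneg)
    have "of_int l * S (axis j 1) \<le> of_int l * C" "of_int l * S (- axis j 1) \<le> of_int l * C"
      using CS S[of "axis j 1"] S[of "- axis j 1"] l(1) by (auto intro!: mult_left_mono)
    then show "\<bar>of_int (m $ j)\<bar> \<le> of_int l * C"
      using *[OF l, of "axis j 1"] *[OF l, of "- axis j 1"]
      by (simp add: inner_axis_real_vec abs_le_iff)
  qed
qed

lemma finite_lattice_points:
  assumes "is_fan \<Sigma>" "smooth_fan \<Sigma>" "projective_fan \<Sigma>"
  shows "finite (lattice_points \<Sigma>)"
proof -
  obtain C :: real where C: "C \<ge> 0"
    "\<And>m l j. l \<ge> 0 \<Longrightarrow> (\<And>\<rho>. \<rho> \<in> rays \<Sigma> \<Longrightarrow> pairing m \<rho> \<ge> - l) \<Longrightarrow> \<bar>of_int (m $ j)\<bar> \<le> of_int l * C"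
    using complete_fan_bound[OF assms] by metis
  define T where "T = {- \<lfloor>C\<rfloor>..\<lfloor>C\<rfloor>}"
  have "m $ j \<in> T" if "m \<in> lattice_points \<Sigma>" for m j
  proof -
    have "\<bar>real_of_int (m $ j)\<bar> \<le> C"
      using C(2)[of 1 m j] that by (auto simp: lattice_points_iff)
    then have "- \<lfloor>C\<rfloor> \<le> m $ j \<and> m $ j \<le> \<lfloor>C\<rfloor>" by linarith
    then show ?thesis by (simp add: T_def)
  qed
  then have "vec_nth ` lattice_points \<Sigma> \<subseteq> PiE UNIV (\<lambda>_. T)"
    by auto
  moreover have "finite (PiE (UNIV :: 'a set) (\<lambda>_. T))"
    by (intro finite_PiE) (auto simp: T_def)
  moreover have "inj_on vec_nth (lattice_points \<Sigma>)"
    by (auto intro!: inj_onI simp: vec_eq_iff)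
  ultimately show ?thesis
    using inj_on_finite by blast
qed

lemma pairing_nonneg_imp_0:
  assumes "is_fan \<Sigma>" "smooth_fan \<Sigma>" "projective_fan \<Sigma>" "\<And>\<rho>. \<rho> \<in> rays \<Sigma> \<Longrightarrow> pairing m \<rho> \<ge> 0"
  shows "m = 0"
proof -
  obtain C :: real where C: "C \<ge> 0"
    "\<And>m l j. l \<ge> 0 \<Longrightarrow> (\<And>\<rho>. \<rho> \<in> rays \<Sigma> \<Longrightarrow> pairing m \<rho> \<ge> - l) \<Longrightarrow> \<bar>of_int (m $ j)\<bar> \<le> of_int l * C"
    using complete_fan_bound[OF assms(1-3)] by metis
  show ?thesis
    using C(2)[of 0 m] assms(4) by (simp add: vec_eq_iff)
qed

section \<open>The Lie algebra of the graded automorphism group\<close>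

lemma monom_induct [consumes 1, case_names zero add]:
  fixes m :: "'v monom"
  assumes "keys m \<subseteq> A" "P 0"
    and step: "\<And>m v. keys m \<subseteq> A \<Longrightarrow> v \<in> A \<Longrightarrow> P m \<Longrightarrow> P (m + single v 1)"
  shows "P m"
proof -
  \<comment> \<open>Removing a variable may shrink the support, so the induction runs on the total
    degree over a fixed finite set \<open>K\<close>.\<close>
  have "P m'" if "finite K" "K \<subseteq> A" "keys m' \<subseteq> K" "(\<Sum>v\<in>K. lookup m' v) = n" for K m' n
    using that(3,4)
  proof (induction n arbitrary: m')
    case 0
    then have "lookup m' v = 0" for v
      using that(1) by (cases "v \<in> K") (auto simp: in_keys_iff)
    then have "m' = 0" by (intro poly_mapping_eqI) auto
    then show ?case using assms(2) by simp
  next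
    case (Suc n)
    then obtain v where v: "v \<in> K" "lookup m' v \<noteq> 0"
      by (metis nat.distinct(1) sum.neutral)
    define m'' where "m'' = m' - single v 1"
    have m': "m' = m'' + single v 1"
      using v by (intro poly_mapping_eqI) (auto simp: m''_def lookup_add lookup_minus lookup_single when_def)
    have sub: "keys m'' \<subseteq> K" using Suc.prems(1) m' by (simp add: keys_add_nat)
    have "(\<Sum>u\<in>K. lookup m' u) = (\<Sum>u\<in>K. lookup m'' u) + (\<Sum>u\<in>K. if u = v then 1 else 0)"
      unfolding m' lookup_add sum.distrib by (intro arg_cong2[of _ _ _ _ "(+)"] sum.cong) (auto simp: lookup_single when_def)
    then have "(\<Sum>u\<in>K. lookup m'' u) = n"
      using Suc.prems(2) v(1) that(1) by simp
    then have "P m''" using Suc.IH sub by blast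
    then show ?case
      unfolding m' using sub that(2) v(1) by (intro step) auto
  qed
  from this[of "keys m" m] show ?thesis using assms(1) by simp
qed

section \<open>Coefficientwise derivatives of curves of polynomials\<close>

definition coeffs_deriv :: "(complex \<Rightarrow> 'v cpoly) \<Rightarrow> 'v cpoly \<Rightarrow> bool" where
  "coeffs_deriv F d \<longleftrightarrow> (\<forall>m. ((\<lambda>t. lookup (F t) m) has_field_derivative lookup d m) (at 0))"

lemma coeffs_deriv_unique: "coeffs_deriv F d \<Longrightarrow> coeffs_deriv F e \<Longrightarrow> d = e"
  unfolding coeffs_deriv_def by (intro poly_mapping_eqI) (blast intro: DERIV_unique)

lemma coeffs_deriv_const: "coeffs_deriv (\<lambda>_. f) 0"
  by (simp add: coeffs_deriv_def)

lemma coeffs_deriv_add: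
  "coeffs_deriv F d \<Longrightarrow> coeffs_deriv G e \<Longrightarrow> coeffs_deriv (\<lambda>t. F t + G t) (d + e)"
  by (auto simp: coeffs_deriv_def lookup_add intro: DERIV_add)

lemma coeffs_deriv_Const_mult:
  "coeffs_deriv F d \<Longrightarrow> coeffs_deriv (\<lambda>t. Const c * F t) (Const c * d)"
  by (auto simp: coeffs_deriv_def intro: DERIV_cmult)

lemma coeffs_deriv_mult:
  fixes F G :: "complex \<Rightarrow> 'v cpoly"
  assumes "coeffs_deriv F d" "coeffs_deriv G e"
  shows "coeffs_deriv (\<lambda>t. F t * G t) (d * G 0 + F 0 * e)"
  unfolding coeffs_deriv_def
proof
  fix m :: "'v monom"
  let ?S = "{(a :: 'v monom, b). a + b = m}"
  have "((\<lambda>t. \<Sum>p\<in>?S. lookup (F t) (fst p) * lookup (G t) (snd p)) has_field_derivative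
      (\<Sum>p\<in>?S. lookup d (fst p) * lookup (G 0) (snd p) + lookup (F 0) (fst p) * lookup e (snd p))) (at 0)"
    using assms unfolding coeffs_deriv_def
    by (auto intro!: derivative_eq_intros sum.cong simp: algebra_simps)
  then show "((\<lambda>t. lookup (F t * G t) m) has_field_derivative lookup (d * G 0 + F 0 * e) m) (at 0)"
    by (simp add: lookup_add lookup_times sum.distrib case_prod_unfold)
qed

subsection \<open>Velocities of one-parameter subgroups are derivations\<close>

lemma one_parameter_subgroupD:
  assumes "one_parameter_subgroup \<Sigma> \<gamma> x"
  shows "f \<in> cox_ring \<Sigma> \<Longrightarrow> coeffs_deriv (\<lambda>t. \<gamma> t f) (x f)"
    and "f \<in> cox_ring \<Sigma> \<Longrightarrow> g \<in> cox_ring \<Sigma> \<Longrightarrow> \<gamma> t (f + g) = \<gamma> t f + \<gamma> t g"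
    and "f \<in> cox_ring \<Sigma> \<Longrightarrow> g \<in> cox_ring \<Sigma> \<Longrightarrow> \<gamma> t (f * g) = \<gamma> t f * \<gamma> t g"
    and "\<gamma> t 1 = 1"
    and "f \<in> cox_ring \<Sigma> \<Longrightarrow> \<gamma> 0 f = f"
proof -
  have \<gamma>: "\<gamma> t \<in> Aut_g \<Sigma>" "\<gamma> (s + t) = compose (cox_ring \<Sigma>) (\<gamma> s) (\<gamma> t)" for s t
    using assms unfolding one_parameter_subgroup_def by auto
  show "f \<in> cox_ring \<Sigma> \<Longrightarrow> coeffs_deriv (\<lambda>t. \<gamma> t f) (x f)"
    using assms unfolding one_parameter_subgroup_def coeffs_deriv_def by auto
  show "f \<in> cox_ring \<Sigma> \<Longrightarrow> g \<in> cox_ring \<Sigma> \<Longrightarrow> \<gamma> t (f + g) = \<gamma> t f + \<gamma> t g"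
    and "f \<in> cox_ring \<Sigma> \<Longrightarrow> g \<in> cox_ring \<Sigma> \<Longrightarrow> \<gamma> t (f * g) = \<gamma> t f * \<gamma> t g"
    and "\<gamma> t 1 = 1"
    using \<gamma>(1)[of t] unfolding Aut_g_def by auto
  have bij: "bij_betw (\<gamma> 0) (cox_ring \<Sigma>) (cox_ring \<Sigma>)"
    using \<gamma>(1)[of 0] unfolding Aut_g_def by auto
  show "\<gamma> 0 f = f" if "f \<in> cox_ring \<Sigma>"
  proof -
    \<comment> \<open>The group law at 0 + 0 makes \<open>\<gamma> 0\<close> idempotent, and an
      injective idempotent map is the identity.\<close>
    have "\<gamma> 0 (\<gamma> 0 f) = \<gamma> 0 f"
      using \<gamma>(2)[of 0 0] that by (metis add_0 compose_eq)
    moreover have "\<gamma> 0 f \<in> cox_ring \<Sigma>" using bij that by (auto dest: bij_betwE)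
    ultimately show ?thesis
      using bij that unfolding bij_betw_def by (blast dest: inj_onD)
  qed
qed

text \<open>Differentiates the multiplicativity of \<open>\<gamma> t\<close> at 0, where
  \<open>\<gamma> 0\<close> is the identity.\<close>

lemma velocity_mult:
  assumes "one_parameter_subgroup \<Sigma> \<gamma> x" "f \<in> cox_ring \<Sigma>" "g \<in> cox_ring \<Sigma>"
  shows "x (f * g) = x f * g + f * x g"
proof -
  note D = one_parameter_subgroupD[OF assms(1)]
  have "f * g \<in> cox_ring \<Sigma>" using assms by (simp add: cox_ring_def poly_ring_mult)
  from D(1)[OF this] have "coeffs_deriv (\<lambda>t. \<gamma> t f * \<gamma> t g) (x (f * g))"
    using assms by (simp add: D)
  moreover have "coeffs_deriv (\<lambda>t. \<gamma> t f * \<gamma> t g) (x f * \<gamma> 0 g + \<gamma> 0 f * x g)"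
    using assms by (intro coeffs_deriv_mult D(1))
  ultimately show ?thesis
    using assms by (simp add: D coeffs_deriv_unique)
qed

lemma velocity_1:
  assumes "one_parameter_subgroup \<Sigma> \<gamma> x"
  shows "x 1 = 0"
proof -
  note D = one_parameter_subgroupD[OF assms(1)]
  have "coeffs_deriv (\<lambda>t. \<gamma> t 1) (x 1)" by (rule D(1)) (auto simp: cox_ring_def)
  then show ?thesis
    using coeffs_deriv_unique[OF _ coeffs_deriv_const[of 1]] by (simp add: D(4))
qed

text \<open>Subtraction of exponents is truncated, so adding \<open>v\<close> and removing
  \<open>\<rho>\<close> need not commute. Where they fail to, \<open>\<rho>\<close> does not occur
  in \<open>m\<close> and the coefficient is 0.\<close>

lemma Monom_minus_add:
  "Const (of_nat (lookup m \<rho>)) * Monom (m + single v 1 - single \<rho> 1)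
    = Const (of_nat (lookup m \<rho>)) * Monom (m - single \<rho> 1) * Var v"
proof (cases "lookup m \<rho> = 0")
  case False
  have "m + single v 1 - single \<rho> 1 = (m - single \<rho> 1) + single v 1"
    using False
    by (intro poly_mapping_eqI) (auto simp: lookup_add lookup_minus lookup_single when_def)
  then show ?thesis by (simp add: Monom_add Var_def mult.assoc)
qed auto

lemma velocity_Monom:
  assumes "one_parameter_subgroup \<Sigma> \<gamma> x" "finite (rays \<Sigma>)" "keys m \<subseteq> rays \<Sigma>"
  shows "x (Monom m) = (\<Sum>\<rho>\<in>rays \<Sigma>. Const (of_nat (lookup m \<rho>)) * Monom (m - single \<rho> 1) * x (Var \<rho>))"
  using assms(3)
proof (induction m rule: monom_induct)
  case zero
  then show ?case using velocity_1[OF assms(1)] by simp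
next
  case (add m v)
  have "x (Monom (m + single v 1)) = x (Monom m * Var v)"
    by (simp add: Monom_add Var_def)
  also have "\<dots> = x (Monom m) * Var v + Monom m * x (Var v)"
    using add by (intro velocity_mult[OF assms(1)]) (auto simp: cox_ring_def poly_ring_Monom poly_ring_Var)
  also have "x (Monom m) * Var v =
      (\<Sum>\<rho>\<in>rays \<Sigma>. Const (of_nat (lookup m \<rho>)) * Monom (m + single v 1 - single \<rho> 1) * x (Var \<rho>))"
    unfolding add.IH sum_distrib_right Monom_minus_add by (intro sum.cong) (auto simp: mult_ac)
  also have "Monom m * x (Var v) =
      (\<Sum>\<rho>\<in>rays \<Sigma>. if \<rho> = v then Monom (m + single v 1 - single \<rho> 1) * x (Var \<rho>) else 0)"
    using add.hyps assms(2) by simp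
  finally show ?case
    unfolding sum.distrib[symmetric]
    by (simp only:) (intro sum.cong, auto simp: lookup_add lookup_single when_def Const_add algebra_simps)
qed

text \<open>The monomials of degree \<open>[D\<^sub>\<rho>]\<close> are the \<open>w\<^sub>\<rho> t\<^sup>\<alpha>\<close> with \<open>\<alpha> \<in> shifts \<Sigma> \<rho>\<close>.\<close>

definition shifts :: "(real ^ 'n) set set \<Rightarrow> int ^ 'n \<Rightarrow> (int ^ 'n) set" where
  "shifts \<Sigma> \<rho> = {\<alpha>. \<forall>\<rho>'\<in>rays \<Sigma>. pairing \<alpha> \<rho>' \<ge> (if \<rho>' = \<rho> then -1 else 0)}"

definition shift_exponent :: "(real ^ 'n) set set \<Rightarrow> int ^ 'n \<Rightarrow> int ^ 'n \<Rightarrow> (int ^ 'n) monom" where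
  "shift_exponent \<Sigma> \<rho> \<alpha> =
     (\<Sum>\<rho>'\<in>rays \<Sigma>. single \<rho>' (nat (pairing \<alpha> \<rho>' + (if \<rho>' = \<rho> then 1 else 0))))"

section \<open>Action of a velocity on the anticanonical monomials\<close>

lemma lookup_sum_single:
  "finite R \<Longrightarrow> lookup (\<Sum>\<rho>\<in>R. single \<rho> (f \<rho>)) \<rho>' = (if \<rho>' \<in> R then f \<rho>' else 0)"
proof -
  assume "finite R"
  moreover have "lookup (\<Sum>\<rho>\<in>R. single \<rho> (f \<rho>)) \<rho>' = (\<Sum>\<rho>\<in>R. if \<rho> = \<rho>' then f \<rho> else 0)"
    unfolding lookup_sum by (rule sum.cong) (auto simp: lookup_single when_def)
  ultimately show ?thesis by simp
qed

lemma lookup_section_exponent: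
  "finite (rays \<Sigma>) \<Longrightarrow>
    lookup (section_exponent \<Sigma> \<mu>) \<rho> = (if \<rho> \<in> rays \<Sigma> then nat (pairing \<mu> \<rho> + 1) else 0)"
  unfolding section_exponent_def by (rule lookup_sum_single)

lemma lookup_shift_exponent:
  "finite (rays \<Sigma>) \<Longrightarrow>
    lookup (shift_exponent \<Sigma> \<rho> \<alpha>) \<rho>' =
      (if \<rho>' \<in> rays \<Sigma> then nat (pairing \<alpha> \<rho>' + (if \<rho>' = \<rho> then 1 else 0)) else 0)"
  unfolding shift_exponent_def by (rule lookup_sum_single)

text \<open>A nonnegative pairing of \<open>\<mu>\<close> with \<open>\<rho>\<close> means that
  w_\<rho> divides the monomial of t^\<mu>, so the truncated subtraction is exact.\<close>

lemma section_exponent_shift: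
  assumes "finite (rays \<Sigma>)" "\<mu> \<in> lattice_points \<Sigma>" "\<nu> \<in> lattice_points \<Sigma>" "\<rho> \<in> rays \<Sigma>" "pairing \<mu> \<rho> \<ge> 0"
    "\<nu> - \<mu> \<in> shifts \<Sigma> \<rho>"
  shows "section_exponent \<Sigma> \<nu> = section_exponent \<Sigma> \<mu> - single \<rho> 1 + shift_exponent \<Sigma> \<rho> (\<nu> - \<mu>)"
proof (rule poly_mapping_eqI)
  fix \<rho>'
  show "lookup (section_exponent \<Sigma> \<nu>) \<rho>' =
    lookup (section_exponent \<Sigma> \<mu> - single \<rho> 1 + shift_exponent \<Sigma> \<rho> (\<nu> - \<mu>)) \<rho>'"
  proof (cases "\<rho>' \<in> rays \<Sigma>")
    case True
    then have "pairing \<mu> \<rho>' \<ge> -1" "pairing \<nu> \<rho>' \<ge> -1" "pairing \<nu> \<rho>' - pairing \<mu> \<rho>' \<ge> (if \<rho>' = \<rho> then -1 else 0)"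
      using assms(2,3,6) by (auto simp: lattice_points_iff shifts_def pairing_diff_left)
    then show ?thesis using True assms(1,5)
      by (auto simp: lookup_add lookup_minus lookup_single when_def lookup_section_exponent
          lookup_shift_exponent pairing_diff_left nat_add_distrib[symmetric] nat_diff_distrib[symmetric] split: if_splits)
  next
    case False
    then show ?thesis using assms(1,4)
      by (auto simp: lookup_add lookup_minus lookup_single when_def lookup_section_exponent lookup_shift_exponent)
  qed
qed

text \<open>Used contrapositively: if \<open>\<nu> - \<mu>\<close> is outside \<open>shifts\<close>,
  the monomial of t^\<nu> is not a multiple of that of t^\<mu> / w_\<rho>, and its coefficient is
  0.\<close>

lemma section_exponent_not_shift:
  assumes "finite (rays \<Sigma>)" "\<mu> \<in> lattice_points \<Sigma>" "\<nu> \<in> lattice_points \<Sigma>"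
    "section_exponent \<Sigma> \<nu> = section_exponent \<Sigma> \<mu> - single \<rho> 1 + c"
  shows "\<nu> - \<mu> \<in> shifts \<Sigma> \<rho>"
  unfolding shifts_def
proof (clarify)
  fix \<rho>' assume \<rho>': "\<rho>' \<in> rays \<Sigma>"
  have "nat (pairing \<nu> \<rho>' + 1) \<ge> nat (pairing \<mu> \<rho>' + 1) - (if \<rho>' = \<rho> then 1 else 0)"
    using arg_cong[OF assms(4), of "\<lambda>m. lookup m \<rho>'"] \<rho>' assms(1)
    by (auto simp: lookup_add lookup_minus lookup_single when_def lookup_section_exponent)
  moreover have "pairing \<mu> \<rho>' \<ge> -1" "pairing \<nu> \<rho>' \<ge> -1"
    using assms(2,3) \<rho>' by (auto simp: lattice_points_iff)
  ultimately show "pairing (\<nu> - \<mu>) \<rho>' \<ge> (if \<rho>' = \<rho> then -1 else 0)"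
    by (auto simp: pairing_diff_left split: if_splits)
qed

text \<open>By the Leibniz rule, x(t^\<mu>) is the sum over the rays of (<\<mu>,\<rho>> + 1)
  (t^\<mu> / w_\<rho>) x(w_\<rho>). Reading off the coefficient of t^\<nu> leaves from x(w_\<rho>)
  only the coefficient of w_\<rho> t^(\<nu>-\<mu>).\<close>

lemma lookup_velocity_section_monom:
  assumes x: "one_parameter_subgroup \<Sigma> \<gamma> x" and fin: "finite (rays \<Sigma>)"
    and \<mu>: "\<mu> \<in> lattice_points \<Sigma>" and \<nu>: "\<nu> \<in> lattice_points \<Sigma>"
  shows "lookup (x (section_monom \<Sigma> \<mu>)) (section_exponent \<Sigma> \<nu>) =
    (\<Sum>\<rho>\<in>rays \<Sigma>. of_int (pairing \<mu> \<rho> + 1) *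
      (if \<nu> - \<mu> \<in> shifts \<Sigma> \<rho> then lookup (x (Var \<rho>)) (shift_exponent \<Sigma> \<rho> (\<nu> - \<mu>)) else 0))"
proof -
  have "keys (section_exponent \<Sigma> \<mu>) \<subseteq> rays \<Sigma>"
    using fin by (auto simp: in_keys_iff lookup_section_exponent split: if_splits)
  note velocity_Monom[OF x fin this]
  then have "lookup (x (section_monom \<Sigma> \<mu>)) (section_exponent \<Sigma> \<nu>) =
    (\<Sum>\<rho>\<in>rays \<Sigma>. of_nat (nat (pairing \<mu> \<rho> + 1)) *
       lookup (Monom (section_exponent \<Sigma> \<mu> - single \<rho> 1) * x (Var \<rho>)) (section_exponent \<Sigma> \<nu>))"
    unfolding section_monom_def
    by (simp add: lookup_sum mult.assoc lookup_section_exponent fin)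
  also have "\<dots> = (\<Sum>\<rho>\<in>rays \<Sigma>. of_int (pairing \<mu> \<rho> + 1) *
      (if \<nu> - \<mu> \<in> shifts \<Sigma> \<rho> then lookup (x (Var \<rho>)) (shift_exponent \<Sigma> \<rho> (\<nu> - \<mu>)) else 0))"
  proof (rule sum.cong[OF refl])
    fix \<rho> assume \<rho>: "\<rho> \<in> rays \<Sigma>"
    have ge: "pairing \<mu> \<rho> \<ge> -1" using \<mu> \<rho> by (auto simp: lattice_points_iff)
    show "of_nat (nat (pairing \<mu> \<rho> + 1)) *
        lookup (Monom (section_exponent \<Sigma> \<mu> - single \<rho> 1) * x (Var \<rho>)) (section_exponent \<Sigma> \<nu>) =
      of_int (pairing \<mu> \<rho> + 1) *
        (if \<nu> - \<mu> \<in> shifts \<Sigma> \<rho> then lookup (x (Var \<rho>)) (shift_exponent \<Sigma> \<rho> (\<nu> - \<mu>)) else 0)"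
    \<comment> \<open>If the pairing is -1, then w_\<rho> does not occur in t^\<mu> and both sides
      carry the factor 0; otherwise the division by w_\<rho> is genuine.\<close>
    proof (cases "pairing \<mu> \<rho> = -1")
      case False
      with ge have ge0: "pairing \<mu> \<rho> \<ge> 0" by simp
      have nn: "(of_nat (nat (pairing \<mu> \<rho> + 1)) :: complex) = of_int (pairing \<mu> \<rho> + 1)"
        using ge by (metis diff_ge_0_iff_ge diff_minus_eq_add of_nat_nat)
      show ?thesis
      proof (cases "\<nu> - \<mu> \<in> shifts \<Sigma> \<rho>")
        case True
        show ?thesis
          unfolding nn section_exponent_shift[OF fin \<mu> \<nu> \<rho> ge0 True] lookup_Monom_mult_add using True by simp
      next
        case False
        then have "lookup (Monom (section_exponent \<Sigma> \<mu> - single \<rho> 1) * x (Var \<rho>)) (section_exponent \<Sigma> \<nu>) = 0"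
          using section_exponent_not_shift[OF fin \<mu> \<nu>] by (intro lookup_Monom_mult_not_add) blast
        with False show ?thesis by simp
      qed
    qed simp
  qed
  finally show ?thesis .
qed

subsection \<open>The derivative of the character\<close>

text \<open>Jacobi's formula at the identity matrix. A permutation other than the identity moves at
  least two points, so even after one factor is differentiated an off-diagonal entry of the identity
  matrix remains.\<close>

lemma det_on_deriv:
  fixes A :: "complex \<Rightarrow> 'a \<Rightarrow> 'a \<Rightarrow> complex"
  assumes "finite K"
    and D: "\<And>i j. i \<in> K \<Longrightarrow> j \<in> K \<Longrightarrow> ((\<lambda>t. A t i j) has_field_derivative D i j) (at 0)"
    and A0: "\<And>i j. i \<in> K \<Longrightarrow> j \<in> K \<Longrightarrow> A 0 i j = (if i = j then 1 else 0)"
  shows "((\<lambda>t. det_on K (A t)) has_field_derivative (\<Sum>i\<in>K. D i i)) (at 0)"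
    and "det_on K (A 0) = 1"
proof -
  have fin: "finite {p. p permutes K}" using assms(1) by (rule finite_permutations)
  have zero: "(\<Prod>j\<in>K - {i}. A 0 j (p j)) = 0" if p: "p permutes K" "p \<noteq> id" for p i
  proof -
    have "\<exists>j\<in>K. j \<noteq> i \<and> p j \<noteq> j"
    proof (rule ccontr)
      assume *: "\<not> ?thesis"
      have fix1: "p j = j" if "j \<noteq> i" for j
        using * that p(1) by (cases "j \<in> K") (auto simp: permutes_def)
      have "p i = i"
      proof (rule ccontr)
        assume "p i \<noteq> i"
        then have "p (p i) = p i" by (rule fix1)
        then show False using \<open>p i \<noteq> i\<close> permutes_inj[OF p(1)] by (auto dest: injD)
      qed
      then show False using fix1 p(2) by (metis eq_id_iff)
    qed
    then obtain j where j: "j \<in> K" "j \<noteq> i" "p j \<noteq> j" by blast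
    then have "A 0 j (p j) = 0"
      using A0[of j "p j"] permutes_in_image[OF p(1)] by auto
    then show ?thesis using j assms(1) by (intro prod_zero) auto
  qed
  have "((\<lambda>t. det_on K (A t)) has_field_derivative
      (\<Sum>p\<in>{p. p permutes K}. of_int (sign p) * (\<Sum>i\<in>K. D i (p i) * (\<Prod>j\<in>K - {i}. A 0 j (p j))))) (at 0)"
    unfolding det_on_def
  proof (rule DERIV_sum)
    fix p assume "p \<in> {p. p permutes K}"
    then have "p i \<in> K" if "i \<in> K" for i using that permutes_in_image by fastforce
    then show "((\<lambda>t. of_int (sign p) * (\<Prod>i\<in>K. A t i (p i))) has_field_derivative
        of_int (sign p) * (\<Sum>i\<in>K. D i (p i) * (\<Prod>j\<in>K - {i}. A 0 j (p j)))) (at 0)"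
      by (intro DERIV_cmult has_field_derivative_prod D)
  qed
  also have "(\<Sum>p\<in>{p. p permutes K}. of_int (sign p) * (\<Sum>i\<in>K. D i (p i) * (\<Prod>j\<in>K - {i}. A 0 j (p j)))) =
      (\<Sum>p\<in>{p. p permutes K}. if p = id then (\<Sum>i\<in>K. D i i) else 0)"
  proof (rule sum.cong[OF refl])
    fix p assume p: "p \<in> {p. p permutes K}"
    show "of_int (sign p) * (\<Sum>i\<in>K. D i (p i) * (\<Prod>j\<in>K - {i}. A 0 j (p j))) =
      (if p = id then (\<Sum>i\<in>K. D i i) else 0)"
      using p zero[of p] A0 by auto
  qed
  also have "\<dots> = (\<Sum>i\<in>K. D i i)"
    using fin by (simp add: permutes_id)
  finally show "((\<lambda>t. det_on K (A t)) has_field_derivative (\<Sum>i\<in>K. D i i)) (at 0)" .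
  have "det_on K (A 0) = (\<Sum>p\<in>{p. p permutes K}. if p = id then 1 else 0)"
    unfolding det_on_def
  proof (rule sum.cong[OF refl])
    fix p assume p: "p \<in> {p. p permutes K}"
    have "(\<Prod>i\<in>K. A 0 i (p i)) = 0" if ne: "p \<noteq> id"
    proof -
      obtain j where "p j \<noteq> j" using ne by (metis eq_id_iff)
      then have "j \<in> K" using p unfolding permutes_def by blast
      moreover have "p j \<in> K" using p \<open>j \<in> K\<close> permutes_in_image by fastforce
      ultimately show ?thesis using \<open>p j \<noteq> j\<close> A0[of j "p j"] assms(1) by (intro prod_zero) auto
    qed
    then show "of_int (sign p) * (\<Prod>i\<in>K. A 0 i (p i)) = (if p = id then 1 else 0)"
      using A0 by auto
  qed
  then show "det_on K (A 0) = 1" using fin by (simp add: permutes_id)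
qed

text \<open>The derivative of each determinant is the trace of its block, and the classes of rays
  partition the rays. The value depends on \<open>x\<close> alone and not on the curve
  \<open>\<gamma>\<close>, which is what makes the \<open>THE\<close> in \<open>dchi\<close>
  meaningful.\<close>

lemma dchi_velocity:
  assumes x: "one_parameter_subgroup \<Sigma> \<gamma> x" and fin: "finite (rays \<Sigma>)"
  shows "dchi \<Sigma> x = (\<Sum>\<rho>\<in>rays \<Sigma>. lookup (x (Var \<rho>)) (single \<rho> 1))"
proof -
  define r where "r = {(\<rho>, \<rho>'). \<rho> \<in> rays \<Sigma> \<and> \<rho>' \<in> rays \<Sigma> \<and>
        monom_deg \<Sigma> (single \<rho> 1) = monom_deg \<Sigma> (single \<rho>' 1)}"
  have r: "equiv (rays \<Sigma>) r"
    unfolding r_def by (auto simp: equiv_def refl_on_def sym_def trans_def)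
  have classes: "ray_classes \<Sigma> = rays \<Sigma> // r" by (simp add: ray_classes_def r_def)
  have Un: "\<Union> (rays \<Sigma> // r) = rays \<Sigma>" using Union_quotient[OF r] .
  have finK: "finite K" if "K \<in> rays \<Sigma> // r" for K
    using that Un fin by (metis Sup_upper finite_subset)
  have fin_classes: "finite (rays \<Sigma> // r)"
    using Un fin by (metis finite_UnionD)
  have sum_classes: "(\<Sum>K\<in>rays \<Sigma> // r. \<Sum>\<rho>\<in>K. F \<rho>) = (\<Sum>\<rho>\<in>rays \<Sigma>. F \<rho>)" for F :: "_ \<Rightarrow> complex"
  proof -
    have "(\<Sum>\<rho>\<in>\<Union> (rays \<Sigma> // r). F \<rho>) = (\<Sum>K\<in>rays \<Sigma> // r. \<Sum>\<rho>\<in>K. F \<rho>)"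
      using finK quotient_disj[OF r] by (subst sum.Union_disjoint) auto
    then show ?thesis using Un by simp
  qed
  have main: "((\<lambda>t. chi \<Sigma> (\<gamma>' t)) has_field_derivative (\<Sum>\<rho>\<in>rays \<Sigma>. lookup (x (Var \<rho>)) (single \<rho> 1))) (at 0)"
    if \<gamma>': "one_parameter_subgroup \<Sigma> \<gamma>' x" for \<gamma>'
  proof -
    note D = one_parameter_subgroupD[OF \<gamma>']
    have VarR: "Var \<rho> \<in> cox_ring \<Sigma>" if "\<rho> \<in> rays \<Sigma>" for \<rho>
      using that by (simp add: cox_ring_def poly_ring_Var)
    define M where "M t \<rho> \<rho>' = lookup (\<gamma>' t (Var \<rho>)) (single \<rho>' 1)" for t \<rho> \<rho>'
    define D' where "D' \<rho> \<rho>' = lookup (x (Var \<rho>)) (single \<rho>' 1)" for \<rho> \<rho>'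
    have M_deriv: "((\<lambda>t. M t \<rho> \<rho>') has_field_derivative D' \<rho> \<rho>') (at 0)" if "\<rho> \<in> rays \<Sigma>" for \<rho> \<rho>'
      using D(1)[OF VarR[OF that]] unfolding coeffs_deriv_def M_def D'_def by blast
    have M0: "M 0 \<rho> \<rho>' = (if \<rho> = \<rho>' then 1 else 0)" if "\<rho> \<in> rays \<Sigma>" for \<rho> \<rho>'
      unfolding M_def D(5)[OF VarR[OF that]]
      by (auto simp: Var_def lookup_Monom dest!: arg_cong[where f = "\<lambda>m. lookup m \<rho>"] simp: lookup_single when_def split: if_splits)
    have sub: "\<rho> \<in> rays \<Sigma>" if "K \<in> rays \<Sigma> // r" "\<rho> \<in> K" for K \<rho>
      using that Un by blast
    have det: "((\<lambda>t. det_on K (M t)) has_field_derivative (\<Sum>\<rho>\<in>K. D' \<rho> \<rho>)) (at 0)" "det_on K (M 0) = 1"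
      if "K \<in> rays \<Sigma> // r" for K
      using det_on_deriv[of K M D'] finK[OF that] M_deriv M0 sub[OF that] by auto
    have "((\<lambda>t. \<Prod>K\<in>rays \<Sigma> // r. det_on K (M t)) has_field_derivative
        (\<Sum>K\<in>rays \<Sigma> // r. (\<Sum>\<rho>\<in>K. D' \<rho> \<rho>) * (\<Prod>K'\<in>rays \<Sigma> // r - {K}. det_on K' (M 0)))) (at 0)"
      by (intro has_field_derivative_prod det(1))
    also have "(\<Sum>K\<in>rays \<Sigma> // r. (\<Sum>\<rho>\<in>K. D' \<rho> \<rho>) * (\<Prod>K'\<in>rays \<Sigma> // r - {K}. det_on K' (M 0))) =
        (\<Sum>\<rho>\<in>rays \<Sigma>. D' \<rho> \<rho>)"
      using det(2) by (simp add: sum_classes)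
    finally show ?thesis
      unfolding chi_def classes M_def D'_def .
  qed
  show ?thesis
    unfolding dchi_def
  proof (rule the_equality)
    show "\<exists>\<gamma>. one_parameter_subgroup \<Sigma> \<gamma> x \<and>
      ((\<lambda>t. chi \<Sigma> (\<gamma> t)) has_field_derivative (\<Sum>\<rho>\<in>rays \<Sigma>. lookup (x (Var \<rho>)) (single \<rho> 1))) (at 0)"
      using x main by blast
  next
    fix c assume "\<exists>\<gamma>. one_parameter_subgroup \<Sigma> \<gamma> x \<and> ((\<lambda>t. chi \<Sigma> (\<gamma> t)) has_field_derivative c) (at 0)"
    then show "c = (\<Sum>\<rho>\<in>rays \<Sigma>. lookup (x (Var \<rho>)) (single \<rho> 1))"
      using main DERIV_unique by blast
  qed
qed

subsection \<open>Substitution homomorphisms\<close>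

definition subst_monom :: "('v \<Rightarrow> 'w cpoly) \<Rightarrow> 'v monom \<Rightarrow> 'w cpoly" where
  "subst_monom h m = (\<Prod>v\<in>keys m. h v ^ lookup m v)"

definition subst :: "('v \<Rightarrow> 'w cpoly) \<Rightarrow> 'v cpoly \<Rightarrow> 'w cpoly" where
  "subst h f = (\<Sum>m\<in>keys f. Const (lookup f m) * subst_monom h m)"

lemma subst_monom_superset:
  assumes "finite K" "keys m \<subseteq> K"
  shows "subst_monom h m = (\<Prod>v\<in>K. h v ^ lookup m v)"
  unfolding subst_monom_def
  by (rule prod.mono_neutral_left) (use assms in \<open>auto simp: in_keys_iff\<close>)

lemma subst_monom_add: "subst_monom h (a + b) = subst_monom h a * subst_monom h b"
proof -
  let ?K = "keys a \<union> keys b"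
  have "subst_monom h (a + b) = (\<Prod>v\<in>?K. h v ^ lookup (a + b) v)"
    by (rule subst_monom_superset) (auto simp: keys_add_nat)
  also have "\<dots> = (\<Prod>v\<in>?K. h v ^ lookup a v) * (\<Prod>v\<in>?K. h v ^ lookup b v)"
    by (simp add: lookup_add power_add prod.distrib)
  also have "\<dots> = subst_monom h a * subst_monom h b"
    by (subst (1 2) subst_monom_superset[where K = ?K]) auto
  finally show ?thesis .
qed

lemma subst_monom_0 [simp]: "subst_monom h 0 = 1"
  by (simp add: subst_monom_def)

lemma subst_monom_var: "subst_monom h (single v 1) = h v"
  by (simp add: subst_monom_def)

lemma subst_single: "subst h (single m c) = Const c * subst_monom h m"
  by (simp add: subst_def)

lemma subst_0 [simp]: "subst h 0 = 0"
  by (simp add: subst_def)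

lemma subst_add: "subst h (f + g) = subst h f + subst h g"
  unfolding subst_def by (rule setsum_keys_plus_distrib) (auto simp: Const_add algebra_simps)

lemma subst_mult: "subst h (f * g) = subst h f * subst h g"
proof (induction f rule: cpoly_induct)
  case (single m c)
  show ?case
    by (induction g rule: cpoly_induct)
      (auto simp: mult_single subst_single subst_monom_add subst_add Const_mult algebra_simps)
qed (auto simp: subst_add algebra_simps)

lemma subst_Const [simp]: "subst h (Const c) = Const c"
  by (simp add: Const_def subst_single[of h 0 c, simplified])

lemma subst_1 [simp]: "subst h 1 = 1"
  using subst_Const[of h 1] by simp

lemma subst_Monom: "subst h (Monom m) = subst_monom h m"
  by (simp add: Monom_def subst_single)

lemma subst_Var [simp]: "subst h (Var v) = h v"
  unfolding Var_def by (simp only: subst_Monom subst_monom_var)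

lemma subst_power: "subst h (f ^ n) = subst h f ^ n"
  by (induction n) (auto simp: subst_mult)

lemma subst_prod: "subst h (prod f A) = (\<Prod>i\<in>A. subst h (f i))"
  by (induction A rule: infinite_finite_induct) (auto simp: subst_mult)

lemma subst_subst: "subst h (subst g f) = subst (\<lambda>v. subst h (g v)) f"
  by (induction f rule: cpoly_induct)
    (auto simp: subst_add subst_single subst_mult subst_monom_def subst_prod subst_power)

lemma subst_cong:
  assumes "f \<in> poly_ring A" "\<And>v. v \<in> A \<Longrightarrow> g v = h v"
  shows "subst g f = subst h f"
  using assms(1)
proof (induction f rule: poly_ring_induct)
  case (single m c)
  then have "subst_monom g m = subst_monom h m"
    unfolding subst_monom_def using assms(2) by (intro prod.cong) auto
  then show ?case by (simp add: subst_single)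
qed (auto simp: subst_add)

lemma Monom_eq_prod: "Monom m = (\<Prod>v\<in>keys m. Var v ^ lookup m v)"
proof -
  have "Monom m = subst_monom Var m"
    using subset_UNIV[of "keys m"]
  proof (induction m rule: monom_induct)
    case (add m v)
    then show ?case by (simp only: Monom_add subst_monom_add subst_monom_var Var_def)
  qed auto
  then show ?thesis by (simp add: subst_monom_def)
qed

lemma subst_Var_id: "subst Var f = f"
proof (induction f rule: cpoly_induct)
  case (single m c)
  show ?case
    unfolding subst_single subst_monom_def Monom_eq_prod[symmetric] single_conv_Monom[symmetric] ..
qed (auto simp: subst_add)

lemma subst_in_poly_ring:
  assumes "f \<in> poly_ring A" "\<And>v. v \<in> A \<Longrightarrow> h v \<in> poly_ring B"
  shows "subst h f \<in> poly_ring B"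
  using assms(1)
proof (induction f rule: poly_ring_induct)
  case (single m c)
  then show ?case
    unfolding subst_single subst_monom_def
    by (intro poly_ring_mult poly_ring_Const poly_ring_prod poly_ring_power assms(2)) auto
qed (auto simp: subst_add poly_ring_add)

section \<open>Degrees of monomials under substitution\<close>

lemma monom_deg_eq_iff:
  "monom_deg \<Sigma> a = monom_deg \<Sigma> b \<longleftrightarrow>
    (\<exists>m. \<forall>\<rho>\<in>rays \<Sigma>. int (lookup b \<rho>) = int (lookup a \<rho>) + pairing m \<rho>)"
proof
  assume eq: "monom_deg \<Sigma> a = monom_deg \<Sigma> b"
  \<comment> \<open>The exponents are cut off outside the rays because the members of a class are
    invariant divisors, which vanish there.\<close>
  define b' where "b' \<rho> = (if \<rho> \<in> rays \<Sigma> then int (lookup b \<rho>) else 0)" for \<rho>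
  have "b' \<in> monom_deg \<Sigma> b"
    unfolding monom_deg_def div_class_def invariant_divisors_def
    by (auto simp: b'_def intro!: exI[of _ 0])
  then have "b' \<in> monom_deg \<Sigma> a" using eq by simp
  then show "\<exists>m. \<forall>\<rho>\<in>rays \<Sigma>. int (lookup b \<rho>) = int (lookup a \<rho>) + pairing m \<rho>"
    unfolding monom_deg_def div_class_def b'_def by auto
next
  assume "\<exists>m. \<forall>\<rho>\<in>rays \<Sigma>. int (lookup b \<rho>) = int (lookup a \<rho>) + pairing m \<rho>"
  then obtain m where m: "\<And>\<rho>. \<rho> \<in> rays \<Sigma> \<Longrightarrow> int (lookup b \<rho>) = int (lookup a \<rho>) + pairing m \<rho>"
    by blast
  have "(\<exists>k. \<forall>\<rho>\<in>rays \<Sigma>. c \<rho> = int (lookup a \<rho>) + pairing k \<rho>) \<longleftrightarrow>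
        (\<exists>k. \<forall>\<rho>\<in>rays \<Sigma>. c \<rho> = int (lookup b \<rho>) + pairing k \<rho>)" (is "(\<exists>k. ?A k) \<longleftrightarrow> (\<exists>k. ?B k)") for c
  proof
    assume "\<exists>k. ?A k"
    then obtain k where "?A k" ..
    then have "?B (k - m)" using m by (auto simp: pairing_diff_left)
    then show "\<exists>k. ?B k" ..
  next
    assume "\<exists>k. ?B k"
    then obtain k where "?B k" ..
    then have "?A (k + m)" using m by (auto simp: pairing_add_left)
    then show "\<exists>k. ?A k" ..
  qed
  then show "monom_deg \<Sigma> a = monom_deg \<Sigma> b"
    unfolding monom_deg_def div_class_def by auto
qed

lemma monom_deg_add_cong:
  assumes "monom_deg \<Sigma> a = monom_deg \<Sigma> a'" "monom_deg \<Sigma> b = monom_deg \<Sigma> b'"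
  shows "monom_deg \<Sigma> (a + b) = monom_deg \<Sigma> (a' + b')"
proof -
  obtain m n where "\<forall>\<rho>\<in>rays \<Sigma>. int (lookup a' \<rho>) = int (lookup a \<rho>) + pairing m \<rho>"
      "\<forall>\<rho>\<in>rays \<Sigma>. int (lookup b' \<rho>) = int (lookup b \<rho>) + pairing n \<rho>"
    using assms unfolding monom_deg_eq_iff by blast
  then show ?thesis
    unfolding monom_deg_eq_iff
    by (intro exI[of _ "m + n"]) (auto simp: lookup_add pairing_add_left)
qed

lemma monom_deg_mult:
  assumes "\<And>k. k \<in> keys f \<Longrightarrow> monom_deg \<Sigma> k = monom_deg \<Sigma> a"
    "\<And>k. k \<in> keys g \<Longrightarrow> monom_deg \<Sigma> k = monom_deg \<Sigma> b" "k \<in> keys (f * g)"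
  shows "monom_deg \<Sigma> k = monom_deg \<Sigma> (a + b)"
proof -
  obtain k1 k2 where "k = k1 + k2" "k1 \<in> keys f" "k2 \<in> keys g"
    using keys_mult[of f g] assms(3) by blast
  then show ?thesis using assms(1,2) by (metis monom_deg_add_cong)
qed

lemma monom_deg_subst_monom:
  assumes "keys m \<subseteq> rays \<Sigma>"
    and h: "\<And>\<rho> k. \<rho> \<in> rays \<Sigma> \<Longrightarrow> k \<in> keys (h \<rho>) \<Longrightarrow> monom_deg \<Sigma> k = monom_deg \<Sigma> (single \<rho> 1)"
    and "k \<in> keys (subst_monom h m)"
  shows "monom_deg \<Sigma> k = monom_deg \<Sigma> m"
  using assms(1,3)
proof (induction m arbitrary: k rule: monom_induct)
  case (add m v)
  have "k \<in> keys (subst_monom h m * h v)"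
    using add.prems unfolding subst_monom_add subst_monom_var .
  with add.IH h[OF add.hyps(2)] show ?case by (intro monom_deg_mult)
qed simp

subsection \<open>One-parameter subgroups from substitutions\<close>

text \<open>Beyond differentiability of each coefficient, the point is that the derivatives are
  again the coefficients of a polynomial in the same variables; this is carried along through
  products and sums.\<close>

lemma coeffs_deriv_subst:
  assumes "f \<in> poly_ring A"
    and h: "\<And>v. v \<in> A \<Longrightarrow> \<exists>d\<in>poly_ring A. coeffs_deriv (\<lambda>t. h t v) d"
    and hA: "\<And>t v. v \<in> A \<Longrightarrow> h t v \<in> poly_ring A"
  shows "\<exists>d\<in>poly_ring A. coeffs_deriv (\<lambda>t. subst (h t) f) d"
  using assms(1)
proof (induction f rule: poly_ring_induct)
  case zero
  show ?case using coeffs_deriv_const[where f = 0] by auto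
next
  case (single m c)
  have "\<exists>d\<in>poly_ring A. coeffs_deriv (\<lambda>t. subst_monom (h t) m) d"
    using single
  proof (induction m rule: monom_induct)
    case zero
    show ?case using coeffs_deriv_const[where f = 1] by auto
  next
    case (add m v)
    then obtain d e where d: "d \<in> poly_ring A" "coeffs_deriv (\<lambda>t. subst_monom (h t) m) d"
      and e: "e \<in> poly_ring A" "coeffs_deriv (\<lambda>t. h t v) e"
      using h by meson
    have "coeffs_deriv (\<lambda>t. subst_monom (h t) (m + single v 1)) (d * h 0 v + subst_monom (h 0) m * e)"
      unfolding subst_monom_add subst_monom_var by (rule coeffs_deriv_mult[OF d(2) e(2)])
    moreover have "subst_monom (h 0) m \<in> poly_ring A"
      using subst_in_poly_ring[OF poly_ring_Monom[OF add.hyps(1)], of "h 0" A] hA by (simp add: subst_Monom)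
    moreover have "h 0 v \<in> poly_ring A" by (rule hA[OF add.hyps(2)])
    ultimately show ?case
      using d(1) e(1) by (intro bexI[of _ "d * h 0 v + subst_monom (h 0) m * e"] poly_ring_add poly_ring_mult)
  qed
  then obtain d where "d \<in> poly_ring A" "coeffs_deriv (\<lambda>t. subst_monom (h t) m) d"
    by blast
  then show ?case
    unfolding subst_single
    by (intro bexI[of _ "Const c * d"] coeffs_deriv_Const_mult poly_ring_mult poly_ring_Const)
next
  case (add f g)
  then obtain d e where "d \<in> poly_ring A" "coeffs_deriv (\<lambda>t. subst (h t) f) d"
    "e \<in> poly_ring A" "coeffs_deriv (\<lambda>t. subst (h t) g) e"
    by blast
  then show ?case
    unfolding subst_add by (intro bexI[of _ "d + e"] coeffs_deriv_add poly_ring_add)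
qed

text \<open>Reduces the construction of an element of the Lie algebra to a flow on the variables:
  \<open>hadd\<close> is the group law there, \<open>hdeg\<close> preserves the grading and
  \<open>d\<close> is the velocity. Substitution extends all of this to the ring, and time
  \<open>- t\<close> inverts time \<open>t\<close>.\<close>

lemma velocity_of_substitution:
  assumes hA: "\<And>t \<rho>. \<rho> \<in> rays \<Sigma> \<Longrightarrow> h t \<rho> \<in> cox_ring \<Sigma>"
    and hdeg: "\<And>t \<rho> k. \<rho> \<in> rays \<Sigma> \<Longrightarrow> k \<in> keys (h t \<rho>) \<Longrightarrow> monom_deg \<Sigma> k = monom_deg \<Sigma> (single \<rho> 1)"
    and hadd: "\<And>s t \<rho>. \<rho> \<in> rays \<Sigma> \<Longrightarrow> subst (h s) (h t \<rho>) = h (s + t) \<rho>"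
    and h0: "\<And>\<rho>. \<rho> \<in> rays \<Sigma> \<Longrightarrow> h 0 \<rho> = Var \<rho>"
    and hd: "\<And>\<rho>. \<rho> \<in> rays \<Sigma> \<Longrightarrow> d \<rho> \<in> cox_ring \<Sigma> \<and> coeffs_deriv (\<lambda>t. h t \<rho>) (d \<rho>)"
  obtains x where "x \<in> Lie_Aut_g \<Sigma>" "\<And>\<rho>. \<rho> \<in> rays \<Sigma> \<Longrightarrow> x (Var \<rho>) = d \<rho>"
proof -
  define S where "S = cox_ring \<Sigma>"
  define \<gamma> where "\<gamma> t = restrict (subst (h t)) S" for t
  have S: "S = poly_ring (rays \<Sigma>)" by (simp add: S_def cox_ring_def)
  have closed: "subst (h t) f \<in> S" if "f \<in> S" for f t
    using that hA unfolding S by (intro subst_in_poly_ring) (auto simp: cox_ring_def)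
  have add: "subst (h s) (subst (h t) f) = subst (h (s + t)) f" if "f \<in> S" for s t f
    unfolding subst_subst using that hadd unfolding S by (intro subst_cong) auto
  have id: "subst (h 0) f = f" if "f \<in> S" for f
    using subst_cong[of f "rays \<Sigma>" "h 0" Var] that h0 unfolding S by (simp add: subst_Var_id)
  have ops: "1 \<in> S" "Const c \<in> S" "f \<in> S \<Longrightarrow> g \<in> S \<Longrightarrow> f + g \<in> S" "f \<in> S \<Longrightarrow> g \<in> S \<Longrightarrow> f * g \<in> S" for c f g
    unfolding S by (auto intro: poly_ring_add poly_ring_mult)
  have bij: "bij_betw (\<gamma> t) S S" for t
  proof (rule bij_betwI[where g = "\<gamma> (- t)"])
    show "\<gamma> (- t) (\<gamma> t f) = f" if "f \<in> S" for f
      using that by (simp add: \<gamma>_def closed add id)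
    show "\<gamma> t (\<gamma> (- t) f) = f" if "f \<in> S" for f
      using that by (simp add: \<gamma>_def closed add id)
  qed (auto simp: \<gamma>_def closed)
  have deg: "monom_deg \<Sigma> k = \<delta>"
    if f: "f \<in> S" "\<And>m. m \<in> keys f \<Longrightarrow> monom_deg \<Sigma> m = \<delta>" "k \<in> keys (subst (h t) f)" for f k \<delta> t
  proof -
    obtain m where m: "m \<in> keys f" "k \<in> keys (Const (lookup f m) * subst_monom (h t) m)"
      using f(3) keys_sum[of "\<lambda>m. Const (lookup f m) * subst_monom (h t) m" "keys f"]
      unfolding subst_def by fast
    then have "k \<in> keys (subst_monom (h t) m)" by (auto simp: in_keys_iff)
    moreover have "keys m \<subseteq> rays \<Sigma>" using f(1) m(1) by (auto simp: S poly_ring_def)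
    ultimately have "monom_deg \<Sigma> k = monom_deg \<Sigma> m"
      using monom_deg_subst_monom[of m \<Sigma> "h t" k] hdeg by blast
    then show ?thesis using f(2) m(1) by simp
  qed
  have Aut: "\<gamma> t \<in> Aut_g \<Sigma>" for t
    unfolding Aut_g_def S_def[symmetric]
  proof (intro CollectI conjI)
    show "\<gamma> t \<in> S \<rightarrow>\<^sub>E S" by (auto simp: \<gamma>_def closed)
    show "\<forall>d\<in>class_group \<Sigma>. \<gamma> t ` graded_piece \<Sigma> d \<subseteq> graded_piece \<Sigma> d"
    proof (intro ballI subsetI)
      fix d g assume "g \<in> \<gamma> t ` graded_piece \<Sigma> d"
      then obtain f where f: "f \<in> S" "\<And>m. m \<in> keys f \<Longrightarrow> monom_deg \<Sigma> m = d" "g = subst (h t) f"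
        unfolding graded_piece_def S_def[symmetric] by (auto simp: \<gamma>_def)
      show "g \<in> graded_piece \<Sigma> d"
        unfolding graded_piece_def S_def[symmetric] f(3) using deg[OF f(1,2)] closed[OF f(1)] by blast
    qed
  qed (use bij ops in \<open>auto simp: \<gamma>_def subst_add subst_mult\<close>)
  have "\<exists>d\<in>S. coeffs_deriv (\<lambda>t. subst (h t) f) d" if "f \<in> S" for f
    unfolding S
  proof (rule coeffs_deriv_subst)
    show "f \<in> poly_ring (rays \<Sigma>)" using that by (simp add: S)
  qed (use hA hd in \<open>auto simp: cox_ring_def\<close>)
  \<comment> \<open>The velocity is prescribed on the variables only; on other polynomials its value
    is chosen, and uniqueness of derivatives makes the choice agree with \<open>d\<close> on the
    variables.\<close>
  then obtain y where y: "\<And>f. f \<in> S \<Longrightarrow> y f \<in> S" "\<And>f. f \<in> S \<Longrightarrow> coeffs_deriv (\<lambda>t. subst (h t) f) (y f)"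
    by metis
  define x where "x = restrict y S"
  have "one_parameter_subgroup \<Sigma> \<gamma> x"
    unfolding one_parameter_subgroup_def S_def[symmetric]
  proof (intro conjI allI ballI)
    show "\<gamma> t \<in> Aut_g \<Sigma>" for t by (rule Aut)
    show "\<gamma> (s + t) = compose S (\<gamma> s) (\<gamma> t)" for s t
      by (auto simp: fun_eq_iff compose_def \<gamma>_def closed add)
    show "((\<lambda>t. lookup (\<gamma> t f) m) has_field_derivative lookup (x f) m) (at 0)" if "f \<in> S" for f m
      using y(2)[OF that] that unfolding coeffs_deriv_def x_def \<gamma>_def by simp
  qed
  then have "x \<in> Lie_Aut_g \<Sigma>"
    unfolding Lie_Aut_g_def S_def[symmetric] using y(1) by (auto simp: x_def)
  moreover have "x (Var \<rho>) = d \<rho>" if "\<rho> \<in> rays \<Sigma>" for \<rho>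
  proof -
    have "Var \<rho> \<in> S" using that by (simp add: S poly_ring_Var)
    then have "coeffs_deriv (\<lambda>t. h t \<rho>) (x (Var \<rho>))"
      using y(2)[of "Var \<rho>"] by (simp add: x_def)
    then show ?thesis using hd[OF that] coeffs_deriv_unique by blast
  qed
  ultimately show ?thesis using that by blast
qed

text \<open>Comes from the one-parameter subgroup of the torus that multiplies the variable of
  \<open>\<rho>0\<close> by e^t.\<close>

lemma torus_velocity:
  assumes "\<rho>0 \<in> rays \<Sigma>"
  obtains x where "x \<in> Lie_Aut_g \<Sigma>" "\<And>\<rho>. \<rho> \<in> rays \<Sigma> \<Longrightarrow> x (Var \<rho>) = (if \<rho> = \<rho>0 then Var \<rho>0 else 0)"
proof -
  define h :: "complex \<Rightarrow> _ \<Rightarrow> _ cpoly" where "h t \<rho> = (if \<rho> = \<rho>0 then Const (exp t) * Var \<rho> else Var \<rho>)" for t \<rho>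
  show ?thesis
  proof (rule velocity_of_substitution[of \<Sigma> h "\<lambda>\<rho>. if \<rho> = \<rho>0 then Var \<rho>0 else 0"])
    show "h t \<rho> \<in> cox_ring \<Sigma>" if "\<rho> \<in> rays \<Sigma>" for t \<rho>
      using that unfolding h_def cox_ring_def by (auto intro!: poly_ring_mult poly_ring_Var)
    show "monom_deg \<Sigma> k = monom_deg \<Sigma> (single \<rho> 1)" if "k \<in> keys (h t \<rho>)" for t \<rho> k
      using that by (auto simp: h_def in_keys_iff Var_def lookup_Monom split: if_splits)
    show "subst (h s) (h t \<rho>) = h (s + t) \<rho>" for s t \<rho>
      by (auto simp: h_def subst_mult exp_add Const_mult mult_ac)
    show "(if \<rho> = \<rho>0 then Var \<rho>0 else 0) \<in> cox_ring \<Sigma> \<and>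
        coeffs_deriv (\<lambda>t. h t \<rho>) (if \<rho> = \<rho>0 then Var \<rho>0 else 0)" for \<rho>
    proof (cases "\<rho> = \<rho>0")
      case True
      have "coeffs_deriv (\<lambda>t. h t \<rho>0) (Var \<rho>0)"
        unfolding coeffs_deriv_def h_def by (auto intro!: derivative_eq_intros)
      then show ?thesis using True assms by (simp add: cox_ring_def poly_ring_Var)
    next
      case False
      then show ?thesis by (auto simp: h_def coeffs_deriv_const cox_ring_def)
    qed
  qed (use that in \<open>auto simp: h_def\<close>)
qed

text \<open>The flow adds \<open>t\<close> times the monomial w_\<rho>0 t^\<alpha> to w_\<rho>0.
  Since <\<alpha>,\<rho>0> = -1, that monomial does not involve w_\<rho>0, so the flow fixes it and
  times add up.\<close>

lemma root_velocity:
  assumes fin: "finite (rays \<Sigma>)" and root: "is_root_ray \<Sigma> \<alpha> \<rho>0"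
  obtains x where "x \<in> Lie_Aut_g \<Sigma>"
    "\<And>\<rho>. \<rho> \<in> rays \<Sigma> \<Longrightarrow> x (Var \<rho>) = (if \<rho> = \<rho>0 then Monom (shift_exponent \<Sigma> \<rho>0 \<alpha>) else 0)"
proof -
  define e where "e = shift_exponent \<Sigma> \<rho>0 \<alpha>"
  define h :: "complex \<Rightarrow> _ \<Rightarrow> _ cpoly" where "h t \<rho> = (if \<rho> = \<rho>0 then Var \<rho> + Const t * Monom e else Var \<rho>)" for t \<rho>
  have \<rho>0: "\<rho>0 \<in> rays \<Sigma>" using root by (simp add: is_root_ray_def)
  have lk: "lookup e \<rho> = (if \<rho> \<in> rays \<Sigma> then nat (pairing \<alpha> \<rho> + (if \<rho> = \<rho>0 then 1 else 0)) else 0)" for \<rho>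
    unfolding e_def by (rule lookup_shift_exponent[OF fin])
  have keys_e: "keys e \<subseteq> rays \<Sigma> - {\<rho>0}"
    using root by (auto simp: in_keys_iff lk is_root_ray_def split: if_splits)
  then have subst_e: "subst (h s) (Monom e) = Monom e" for s
    using subst_cong[OF poly_ring_Monom[OF keys_e], of "h s" Var] by (auto simp: subst_Var_id h_def)
  have deg_e: "monom_deg \<Sigma> (single \<rho>0 1) = monom_deg \<Sigma> e"
    unfolding monom_deg_eq_iff
    by (rule exI[of _ \<alpha>]) (use root in \<open>auto simp: lk lookup_single when_def is_root_ray_def\<close>)
  have e_ring: "Monom e \<in> cox_ring \<Sigma>"
    unfolding cox_ring_def using keys_e by (intro poly_ring_Monom) auto
  show ?thesis
  proof (rule velocity_of_substitution[of \<Sigma> h "\<lambda>\<rho>. if \<rho> = \<rho>0 then Monom e else 0"])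
    show "h t \<rho> \<in> cox_ring \<Sigma>" if "\<rho> \<in> rays \<Sigma>" for t \<rho>
      using that e_ring unfolding h_def cox_ring_def
      by (auto intro!: poly_ring_mult poly_ring_add poly_ring_Var)
    show "monom_deg \<Sigma> k = monom_deg \<Sigma> (single \<rho> 1)" if "k \<in> keys (h t \<rho>)" for t \<rho> k
      using that deg_e by (auto simp: h_def in_keys_iff Var_def lookup_Monom lookup_add split: if_splits)
    show "subst (h s) (h t \<rho>) = h (s + t) \<rho>" for s t \<rho>
    proof (cases "\<rho> = \<rho>0")
      case True
      have "subst (h s) (h t \<rho>) = h s \<rho>0 + Const t * Monom e"
        using True by (simp add: h_def[of t] subst_add subst_mult subst_e)
      then show ?thesis using True by (simp add: h_def Const_add algebra_simps)
    qed (simp add: h_def)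
    show "(if \<rho> = \<rho>0 then Monom e else 0) \<in> cox_ring \<Sigma> \<and>
        coeffs_deriv (\<lambda>t. h t \<rho>) (if \<rho> = \<rho>0 then Monom e else 0)" for \<rho>
    proof (cases "\<rho> = \<rho>0")
      case True
      have "coeffs_deriv (\<lambda>t. h t \<rho>0) (Monom e)"
        unfolding coeffs_deriv_def h_def lookup_add by (auto intro!: derivative_eq_intros simp: lookup_add)
      then show ?thesis using True e_ring by simp
    next
      case False
      then show ?thesis by (auto simp: h_def coeffs_deriv_const cox_ring_def)
    qed
  qed (use that in \<open>auto simp: h_def e_def\<close>)
qed

section \<open>The toric ideal\<close>

text \<open>Dedekind's argument: subtracting \<open>\<phi>0 y\<close> times the relation at
  \<open>x\<close> from the relation at \<open>opr x y\<close> removes \<open>\<phi>0\<close>, and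
  \<open>y\<close> is chosen to tell \<open>\<phi>0\<close> from a given \<open>\<phi>\<close>.
  Multiplicative functions on a bare binary operation are allowed, which covers a scaling parameter
  of the cone that may be 0.\<close>

lemma characters_independent:
  fixes opr :: "'p \<Rightarrow> 'p \<Rightarrow> 'p" and a :: "('p \<Rightarrow> complex) \<Rightarrow> complex"
  assumes "finite S" "\<And>\<phi> x y. \<phi> \<in> S \<Longrightarrow> \<phi> (opr x y) = \<phi> x * \<phi> y" "\<And>\<phi>. \<phi> \<in> S \<Longrightarrow> \<phi> e \<noteq> 0"
    "\<And>x. (\<Sum>\<phi>\<in>S. a \<phi> * \<phi> x) = 0" "\<phi> \<in> S"
  shows "a \<phi> = 0"
  using assms
proof (induction S arbitrary: a \<phi> rule: finite_induct)
  case (insert \<phi>0 S)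
  have mult: "\<phi> (opr x y) = \<phi> x * \<phi> y" if "\<phi> \<in> insert \<phi>0 S" for \<phi> x y
    using insert.prems(1) that by blast
  have split: "(\<Sum>\<phi>\<in>S. a \<phi> * \<phi> x) = - a \<phi>0 * \<phi>0 x" for x
    using insert.prems(3)[of x] insert.hyps by (simp add: eq_neg_iff_add_eq_0 add.commute)
  have S0: "a \<phi> = 0" if \<phi>: "\<phi> \<in> S" for \<phi>
  proof -
    have "\<phi> \<noteq> \<phi>0" using \<phi> insert.hyps by blast
    then obtain y where y: "\<phi> y \<noteq> \<phi>0 y" by (auto simp: fun_eq_iff)
    have "(\<Sum>\<phi>\<in>S. a \<phi> * (\<phi> y - \<phi>0 y) * \<phi> x) = 0" for x
    proof -
      have "(\<Sum>\<phi>\<in>S. a \<phi> * (\<phi> y - \<phi>0 y) * \<phi> x) = (\<Sum>\<phi>\<in>S. a \<phi> * \<phi> (opr x y)) - \<phi>0 y * (\<Sum>\<phi>\<in>S. a \<phi> * \<phi> x)"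
        unfolding sum_distrib_left sum_subtractf[symmetric]
        using mult by (intro sum.cong) (auto simp: algebra_simps)
      also have "\<dots> = 0" unfolding split using mult[of \<phi>0] by simp
      finally show ?thesis .
    qed
    then have "a \<phi> * (\<phi> y - \<phi>0 y) = 0"
      using insert.IH[of "\<lambda>\<phi>. a \<phi> * (\<phi> y - \<phi>0 y)" \<phi>] insert.prems(1,2) \<phi> by blast
    with y show ?thesis by simp
  qed
  then have "a \<phi>0 * \<phi>0 e = 0"
    using split[of e] by (simp add: sum.neutral)
  then have "a \<phi>0 = 0" using insert.prems(2) by auto
  with S0 insert.prems(4) show ?case by blast
qed auto

section \<open>Monomials on the cone and box operators\<close>

definition total_degree :: "'v set \<Rightarrow> 'v monom \<Rightarrow> nat" where
  "total_degree L m = (\<Sum>\<mu>\<in>L. lookup m \<mu>)"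

definition weight :: "(int ^ 'n) set \<Rightarrow> (int ^ 'n) monom \<Rightarrow> int ^ 'n" where
  "weight L m = (\<Sum>\<mu>\<in>L. int (lookup m \<mu>) *s \<mu>)"

text \<open>The exponent of w_\<rho> after each t^\<mu> in \<open>m\<close> is replaced by its
  monomial in the homogeneous coordinates.\<close>

definition cox_exponent :: "(real ^ 'n) set set \<Rightarrow> (int ^ 'n) monom \<Rightarrow> int ^ 'n \<Rightarrow> nat" where
  "cox_exponent \<Sigma> m \<rho> = (\<Sum>\<mu>\<in>lattice_points \<Sigma>. lookup m \<mu> * nat (pairing \<mu> \<rho> + 1))"

text \<open>At lattice points \<open>pairing \<mu> \<rho> + 1\<close> is nonnegative, so
  \<open>nat\<close> loses nothing. The formula translates between equality of monomials on the cone
  and the two linear relations imposed on box operators.\<close>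

lemma cox_exponent_eq:
  assumes "\<rho> \<in> rays \<Sigma>"
  shows "int (cox_exponent \<Sigma> m \<rho>) =
    pairing (weight (lattice_points \<Sigma>) m) \<rho> + int (total_degree (lattice_points \<Sigma>) m)"
proof -
  have "int (cox_exponent \<Sigma> m \<rho>) = (\<Sum>\<mu>\<in>lattice_points \<Sigma>. int (lookup m \<mu>) * (pairing \<mu> \<rho> + 1))"
    unfolding cox_exponent_def of_nat_sum of_nat_mult
    using assms by (intro sum.cong) (auto simp: lattice_points_iff)
  also have "\<dots> = pairing (weight (lattice_points \<Sigma>) m) \<rho> + int (total_degree (lattice_points \<Sigma>) m)"
    by (simp add: weight_def total_degree_def pairing_sum_left pairing_smult_left distrib_left sum.distrib)
  finally show ?thesis .
qed

lemma eval_section_monom: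
  assumes "finite (rays \<Sigma>)"
  shows "eval_poly (section_monom \<Sigma> \<mu>) w = (\<Prod>\<rho>\<in>rays \<Sigma>. w \<rho> ^ nat (pairing \<mu> \<rho> + 1))"
proof -
  have "eval_poly (section_monom \<Sigma> \<mu>) w =
      (\<Prod>\<rho>\<in>keys (section_exponent \<Sigma> \<mu>). w \<rho> ^ lookup (section_exponent \<Sigma> \<mu>) \<rho>)"
    by (simp add: section_monom_def Monom_def eval_poly_single)
  also have "\<dots> = (\<Prod>\<rho>\<in>rays \<Sigma>. w \<rho> ^ lookup (section_exponent \<Sigma> \<mu>) \<rho>)"
    using assms by (intro prod.mono_neutral_left) (auto simp: in_keys_iff lookup_section_exponent split: if_splits)
  finally show ?thesis using assms by (simp add: lookup_section_exponent)
qed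

lemma eval_monom_cone:
  assumes "finite (rays \<Sigma>)" "finite (lattice_points \<Sigma>)" "keys m \<subseteq> lattice_points \<Sigma>"
    and a: "a = (\<lambda>\<mu>. if \<mu> \<in> lattice_points \<Sigma> then c * eval_poly (section_monom \<Sigma> \<mu>) w else 0)"
  shows "(\<Prod>\<mu>\<in>keys m. a \<mu> ^ lookup m \<mu>) =
    c ^ total_degree (lattice_points \<Sigma>) m * (\<Prod>\<rho>\<in>rays \<Sigma>. w \<rho> ^ cox_exponent \<Sigma> m \<rho>)"
proof -
  let ?L = "lattice_points \<Sigma>"
  have "(\<Prod>\<mu>\<in>keys m. a \<mu> ^ lookup m \<mu>) = (\<Prod>\<mu>\<in>?L. a \<mu> ^ lookup m \<mu>)"
    using assms(2,3) by (intro prod.mono_neutral_left) (auto simp: in_keys_iff)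
  also have "\<dots> = (\<Prod>\<mu>\<in>?L. c ^ lookup m \<mu> * (\<Prod>\<rho>\<in>rays \<Sigma>. w \<rho> ^ (lookup m \<mu> * nat (pairing \<mu> \<rho> + 1))))"
    unfolding a using assms(1)
    by (intro prod.cong) (auto simp: eval_section_monom power_mult_distrib prod_power_distrib power_mult[symmetric] mult.commute)
  also have "\<dots> = c ^ total_degree ?L m * (\<Prod>\<rho>\<in>rays \<Sigma>. w \<rho> ^ cox_exponent \<Sigma> m \<rho>)"
    unfolding prod.distrib total_degree_def cox_exponent_def power_sum
    by (subst prod.swap) simp
  finally show ?thesis .
qed

definition box_operators :: "(real ^ 'n) set set \<Rightarrow> ((int ^ 'n) cpoly \<Rightarrow> (int ^ 'n) cpoly) set" where
  "box_operators \<Sigma> = {box_operator \<Sigma> l | l.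
     (\<Sum>\<mu>\<in>lattice_points \<Sigma>. l \<mu>) = 0 \<and> (\<Sum>\<mu>\<in>lattice_points \<Sigma>. l \<mu> *s \<mu>) = 0}"

lemma partial_power_monom:
  assumes "finite L" "keys m \<subseteq> L"
  shows "partial_power (keys m) (lookup m) f = partial_power L (lookup m) f"
  by (rule partial_power_superset[symmetric]) (use assms in \<open>auto simp: in_keys_iff\<close>)

text \<open>The common part of the two monomials cancels: with \<open>g\<close> the pointwise
  minimum, their exponents are \<open>g\<close> plus the positive and negative parts of
  \<open>l\<close>. The derivatives belonging to \<open>g\<close> are pulled out on the left, as a
  left ideal demands.\<close>

lemma binomial_in_box_ideal:
  assumes fin: "finite (lattice_points \<Sigma>)"
    and keys: "keys m \<subseteq> lattice_points \<Sigma>" "keys m' \<subseteq> lattice_points \<Sigma>"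
    and deg: "total_degree (lattice_points \<Sigma>) m = total_degree (lattice_points \<Sigma>) m'"
    and wt: "weight (lattice_points \<Sigma>) m = weight (lattice_points \<Sigma>) m'"
  shows "(\<lambda>f. partial_power (keys m) (lookup m) f - partial_power (keys m') (lookup m') f)
    \<in> left_ideal (lattice_points \<Sigma>) (box_operators \<Sigma>)"
proof -
  let ?L = "lattice_points \<Sigma>"
  define l where "l \<mu> = int (lookup m \<mu>) - int (lookup m' \<mu>)" for \<mu>
  define g where "g \<mu> = min (lookup m \<mu>) (lookup m' \<mu>)" for \<mu>
  have m: "lookup m = (\<lambda>\<mu>. g \<mu> + nat (l \<mu>))" "lookup m' = (\<lambda>\<mu>. g \<mu> + nat (- l \<mu>))"
    by (auto simp: fun_eq_iff g_def l_def)
  have P: "partial_power ?L g \<in> weyl_algebra ?L"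
    using fin by (intro weyl_algebra_partial_power) auto
  have "(\<Sum>\<mu>\<in>?L. l \<mu>) = 0"
    using deg unfolding l_def total_degree_def sum_subtractf by (simp flip: of_nat_sum)
  moreover have "(\<Sum>\<mu>\<in>?L. l \<mu> *s \<mu>) = 0"
    using wt unfolding l_def weight_def by (simp add: vec.scale_left_diff_distrib sum_subtractf)
  ultimately have "box_operator \<Sigma> l \<in> box_operators \<Sigma>"
    unfolding box_operators_def by blast
  then have "partial_power ?L g \<circ> box_operator \<Sigma> l \<in> left_ideal ?L (box_operators \<Sigma>)"
    by (rule left_ideal.mult[OF P])
  moreover have "partial_power ?L g \<circ> box_operator \<Sigma> l =
    (\<lambda>f. partial_power (keys m) (lookup m) f - partial_power (keys m') (lookup m') f)"
  proof
    fix f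
    have diff: "partial_power ?L g (u - v) = partial_power ?L g u - partial_power ?L g v" for u v
      using weyl_algebra_add_distrib[OF P, of "u - v" v] by simp
    show "(partial_power ?L g \<circ> box_operator \<Sigma> l) f =
      partial_power (keys m) (lookup m) f - partial_power (keys m') (lookup m') f"
      unfolding partial_power_monom[OF fin keys(1)] partial_power_monom[OF fin keys(2)]
      unfolding m partial_power_add[OF fin] box_operator_def comp_def diff ..
  qed
  ultimately show ?thesis by simp
qed

text \<open>Restricted to the torus \<open>w\<^sub>\<rho> = exp u\<^sub>\<rho>\<close>, the monomials on the cone become characters in
  \<open>(c, u)\<close>; by their independence the coefficients of \<open>p\<close> sum to zero over the monomials with a given
  character, so \<open>p\<close> is a combination of binomials.\<close>

lemma vanishing_in_box_ideal:
  assumes fan: "is_fan \<Sigma>" "smooth_fan \<Sigma>" "projective_fan \<Sigma>" and p: "p \<in> vanishing_ideal \<Sigma>"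
  shows "poly_in_partials p \<in> left_ideal (lattice_points \<Sigma>) (box_operators \<Sigma>)"
proof -
  let ?L = "lattice_points \<Sigma>"
  have finR: "finite (rays \<Sigma>)" using fan(1) by (intro finite_rays) (simp add: is_fan_def)
  have finL: "finite ?L" using finite_lattice_points[OF fan] .
  define ch :: "(int ^ 'a) monom \<Rightarrow> complex \<times> (int ^ 'a \<Rightarrow> complex) \<Rightarrow> complex"
    where "ch m = (\<lambda>(c, u). c ^ total_degree ?L m * (\<Prod>\<rho>\<in>rays \<Sigma>. exp (u \<rho>) ^ cox_exponent \<Sigma> m \<rho>))" for m
  define opr :: "complex \<times> (int ^ 'a \<Rightarrow> complex) \<Rightarrow> complex \<times> (int ^ 'a \<Rightarrow> complex) \<Rightarrow> complex \<times> (int ^ 'a \<Rightarrow> complex)"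
    where "opr = (\<lambda>(c, u) (c', u'). (c * c', \<lambda>\<rho>. u \<rho> + u' \<rho>))"
  have ch_mult: "ch m (opr x y) = ch m x * ch m y" for m x y
    by (cases x; cases y)
      (simp add: ch_def opr_def exp_add power_mult_distrib prod.distrib mult_ac)
  have ch_1: "ch m (1, \<lambda>_. 0) = 1" for m by (simp add: ch_def)
  have ch_eq: "total_degree ?L m = total_degree ?L m' \<and> weight ?L m = weight ?L m'" if eq: "ch m = ch m'" for m m'
  proof
    \<comment> \<open>At \<open>u = 0\<close> a character is a power of the scaling parameter. The
      value 2 makes the exponent readable, and norms turn the equality into one of real
      powers.\<close>
    have "ch m (2, \<lambda>_. 0) = ch m' (2, \<lambda>_. 0)" using eq by simp
    then have "(2 :: complex) ^ total_degree ?L m = 2 ^ total_degree ?L m'" by (simp add: ch_def)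
    then have "norm ((2 :: complex) ^ total_degree ?L m) = norm ((2 :: complex) ^ total_degree ?L m')" by simp
    then show deg: "total_degree ?L m = total_degree ?L m'" by (simp add: norm_power)
    have "pairing (weight ?L m - weight ?L m') \<rho> = 0" if \<rho>: "\<rho> \<in> rays \<Sigma>" for \<rho>
    proof -
      \<comment> \<open>The torus point whose coordinate at \<open>\<rho>\<close> is e and whose
        other coordinates are 1 isolates the exponent of w_\<rho>.\<close>
      define u :: "int ^ 'a \<Rightarrow> complex" where "u = (\<lambda>\<rho>'. if \<rho>' = \<rho> then 1 else 0)"
      have "(\<Prod>\<rho>'\<in>rays \<Sigma>. exp (u \<rho>') ^ cox_exponent \<Sigma> m \<rho>') = exp 1 ^ cox_exponent \<Sigma> m \<rho>" for m
      proof -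
        have "(\<Prod>\<rho>'\<in>rays \<Sigma>. exp (u \<rho>') ^ cox_exponent \<Sigma> m \<rho>') =
          (\<Prod>\<rho>'\<in>rays \<Sigma>. if \<rho>' = \<rho> then exp 1 ^ cox_exponent \<Sigma> m \<rho>' else 1)"
          by (rule prod.cong) (auto simp: u_def)
        then show ?thesis using finR \<rho> by simp
      qed
      moreover have "ch m (1, u) = ch m' (1, u)" using eq by simp
      ultimately have "exp (1 :: complex) ^ cox_exponent \<Sigma> m \<rho> = exp 1 ^ cox_exponent \<Sigma> m' \<rho>"
        by (simp add: ch_def)
      then have "norm (exp (1 :: complex) ^ cox_exponent \<Sigma> m \<rho>) = norm (exp (1 :: complex) ^ cox_exponent \<Sigma> m' \<rho>)"
        by simp
      then have "cox_exponent \<Sigma> m \<rho> = cox_exponent \<Sigma> m' \<rho>" by (simp add: norm_power)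
      then show ?thesis
        using cox_exponent_eq[OF \<rho>, of m] cox_exponent_eq[OF \<rho>, of m'] deg by (simp add: pairing_diff_left)
    qed
    \<comment> \<open>Completeness: a character that pairs to 0 with every ray is 0.\<close>
    then have "weight ?L m - weight ?L m' = 0"
      by (intro pairing_nonneg_imp_0[OF fan]) simp
    then show "weight ?L m = weight ?L m'" by simp
  qed
  let ?K = "keys p"
  have keysL: "keys m \<subseteq> ?L" if "m \<in> ?K" for m
    using p that unfolding vanishing_ideal_def poly_ring_def by blast
  have vanish: "(\<Sum>m\<in>?K. lookup p m * ch m x) = 0" for x
  proof -
    obtain c u where x: "x = (c, u)" by (cases x)
    define w where "w \<rho> = exp (u \<rho>)" for \<rho>
    define a where "a = (\<lambda>\<mu>. if \<mu> \<in> ?L then c * eval_poly (section_monom \<Sigma> \<mu>) w else 0)"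
    have "\<Sigma> \<noteq> {}" using fan(1) by (simp add: is_fan_def)
    then have "w \<in> homogeneous_points \<Sigma>"
      using finR unfolding homogeneous_points_def w_def by auto
    then have "a \<in> cone_over_image \<Sigma>"
      unfolding cone_over_image_def a_def by blast
    then have "0 = eval_poly p a" using p unfolding vanishing_ideal_def by simp
    also have "\<dots> = (\<Sum>m\<in>?K. lookup p m * ch m x)"
      unfolding eval_poly_def
      using eval_monom_cone[OF finR finL keysL a_def]
      by (intro sum.cong) (auto simp: ch_def x w_def)
    finally show ?thesis by simp
  qed
  define A where "A \<phi> = (\<Sum>m\<in>{m \<in> ?K. ch m = \<phi>}. lookup p m)" for \<phi>
  have A0: "A \<phi> = 0" if "\<phi> \<in> ch ` ?K" for \<phi>
  proof (rule characters_independent[where opr = opr and a = A and S = "ch ` ?K" and e = "(1, \<lambda>_. 0)"])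
    fix x
    have "(\<Sum>\<phi>\<in>ch ` ?K. A \<phi> * \<phi> x) = (\<Sum>\<phi>\<in>ch ` ?K. \<Sum>m\<in>{m \<in> ?K. ch m = \<phi>}. lookup p m * ch m x)"
      unfolding A_def sum_distrib_right by (intro sum.cong) auto
    also have "\<dots> = (\<Sum>m\<in>?K. lookup p m * ch m x)"
      by (rule sum.image_gen[symmetric]) simp
    finally show "(\<Sum>\<phi>\<in>ch ` ?K. A \<phi> * \<phi> x) = 0" using vanish by simp
  qed (use that in \<open>auto simp: ch_mult ch_1\<close>)
  \<comment> \<open>One representative monomial per character. Replacing each monomial of
    \<open>p\<close> by its representative costs a binomial in the box ideal, and the
    representatives are left with the coefficients \<open>A \<phi>\<close>, which are 0.\<close>
  define r where "r \<phi> = inv_into ?K ch \<phi>" for \<phi>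
  have r: "r (ch m) \<in> ?K" "ch (r (ch m)) = ch m" if "m \<in> ?K" for m
    using that unfolding r_def by (auto intro: inv_into_into f_inv_into_f)
  define pp where "pp m f = partial_power (keys m) (lookup m) f" for m :: "(int ^ 'a) monom" and f
  have "(\<lambda>f. pp m f - pp (r (ch m)) f) \<in> left_ideal ?L (box_operators \<Sigma>)" if "m \<in> ?K" for m
    unfolding pp_def using ch_eq[OF r(2)[OF that]] keysL r(1) that
    by (intro binomial_in_box_ideal finL) auto
  then have "(\<lambda>f. \<Sum>m\<in>?K. Const (lookup p m) * (pp m f - pp (r (ch m)) f)) \<in> left_ideal ?L (box_operators \<Sigma>)"
    by (intro left_ideal_sum left_ideal_scale)
  also have "(\<lambda>f. \<Sum>m\<in>?K. Const (lookup p m) * (pp m f - pp (r (ch m)) f)) = poly_in_partials p"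
  proof
    fix f
    have "(\<Sum>m\<in>?K. Const (lookup p m) * pp (r (ch m)) f) =
        (\<Sum>\<phi>\<in>ch ` ?K. \<Sum>m\<in>{m \<in> ?K. ch m = \<phi>}. Const (lookup p m) * pp (r (ch m)) f)"
      by (rule sum.image_gen) simp
    also have "\<dots> = (\<Sum>\<phi>\<in>ch ` ?K. Const (A \<phi>) * pp (r \<phi>) f)"
      unfolding A_def Const_sum sum_distrib_right by (intro sum.cong) auto
    also have "\<dots> = 0" using A0 by simp
    finally show "(\<Sum>m\<in>?K. Const (lookup p m) * (pp m f - pp (r (ch m)) f)) = poly_in_partials p f"
      by (simp add: right_diff_distrib sum_subtractf poly_in_partials_def pp_def)
  qed
  finally show ?thesis .
qed

text \<open>The two monomials of a box relation have equal degree and weight, hence equal exponents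
  in the homogeneous coordinates, so they take the same value at every point of the cone.\<close>

lemma box_in_vanishing:
  assumes finR: "finite (rays \<Sigma>)" and finL: "finite (lattice_points \<Sigma>)" and box: "P \<in> box_operators \<Sigma>"
  obtains p where "p \<in> vanishing_ideal \<Sigma>" "P = poly_in_partials p"
proof -
  let ?L = "lattice_points \<Sigma>"
  obtain l where l: "P = box_operator \<Sigma> l" "(\<Sum>\<mu>\<in>?L. l \<mu>) = 0" "(\<Sum>\<mu>\<in>?L. l \<mu> *s \<mu>) = 0"
    using box unfolding box_operators_def by blast
  define mon :: "(int ^ 'a \<Rightarrow> nat) \<Rightarrow> (int ^ 'a) monom" where "mon k = (\<Sum>\<mu>\<in>?L. single \<mu> (k \<mu>))" for k
  have lk: "lookup (mon k) \<mu> = (if \<mu> \<in> ?L then k \<mu> else 0)" for k \<mu>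
    unfolding mon_def by (rule lookup_sum_single[OF finL])
  have keys: "keys (mon k) \<subseteq> ?L" for k by (auto simp: in_keys_iff lk split: if_splits)
  have PP: "partial_power (keys (mon k)) (lookup (mon k)) f = partial_power ?L k f" for k f
    unfolding partial_power_monom[OF finL keys] using finL by (intro partial_power_cong) (auto simp: lk)
  define a b where "a = mon (\<lambda>\<mu>. nat (l \<mu>))" and "b = mon (\<lambda>\<mu>. nat (- l \<mu>))"
  have "int (total_degree ?L a) - int (total_degree ?L b) = (\<Sum>\<mu>\<in>?L. l \<mu>)"
    unfolding total_degree_def of_nat_sum sum_subtractf[symmetric] a_def b_def
    by (intro sum.cong) (auto simp: lk)
  then have deg: "total_degree ?L a = total_degree ?L b" using l(2) by simp
  have "weight ?L a - weight ?L b = (\<Sum>\<mu>\<in>?L. l \<mu> *s \<mu>)"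
    unfolding weight_def sum_subtractf[symmetric] vec.scale_left_diff_distrib[symmetric] a_def b_def
    by (intro sum.cong) (auto simp: lk vec_eq_iff)
  then have wt: "weight ?L a = weight ?L b" using l(3) by simp
  have ex: "cox_exponent \<Sigma> a \<rho> = cox_exponent \<Sigma> b \<rho>" if "\<rho> \<in> rays \<Sigma>" for \<rho>
    using cox_exponent_eq[OF that, of a] cox_exponent_eq[OF that, of b] deg wt by simp
  \<comment> \<open>Written as a sum so that additivity of evaluation applies even when
    \<open>a = b\<close> and \<open>p\<close> is 0.\<close>
  define p where "p = single a 1 + single b (-1 :: complex)"
  have "p \<in> vanishing_ideal \<Sigma>"
    unfolding vanishing_ideal_def
  proof (intro CollectI conjI ballI)
    show "p \<in> poly_ring ?L"
      unfolding p_def a_def b_def by (intro poly_ring_add poly_ring_single keys)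
    fix y assume "y \<in> cone_over_image \<Sigma>"
    then obtain c w where y: "y = (\<lambda>\<mu>. if \<mu> \<in> ?L then c * eval_poly (section_monom \<Sigma> \<mu>) w else 0)"
      unfolding cone_over_image_def by blast
    have "(\<Prod>\<mu>\<in>keys a. y \<mu> ^ lookup a \<mu>) = (\<Prod>\<mu>\<in>keys b. y \<mu> ^ lookup b \<mu>)"
      using eval_monom_cone[OF finR finL _ y, of a] eval_monom_cone[OF finR finL _ y, of b]
      by (simp add: deg ex a_def[symmetric] b_def[symmetric] keys[of "\<lambda>\<mu>. nat (l \<mu>)", folded a_def]
          keys[of "\<lambda>\<mu>. nat (- l \<mu>)", folded b_def])
    then show "eval_poly p y = 0"
      by (simp add: p_def eval_poly_add eval_poly_single)
  qed
  moreover have "P = poly_in_partials p"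
  proof
    fix f
    have "Const (-1) = (-1 :: (int ^ 'a) cpoly)"
      by (simp add: Const_def single_uminus)
    then show "P f = poly_in_partials p f"
      unfolding l(1) p_def poly_in_partials_add poly_in_partials_single a_def b_def PP box_operator_def by simp
  qed
  ultimately show ?thesis using that by blast
qed

section \<open>Comparison of the generators\<close>

lemma is_root_ray_unique: "is_root_ray \<Sigma> \<alpha> \<rho> \<Longrightarrow> is_root_ray \<Sigma> \<alpha> \<rho>' \<Longrightarrow> \<rho> = \<rho>'"
  unfolding is_root_ray_def by force

lemma root_ray_eq: "is_root_ray \<Sigma> \<alpha> \<rho> \<Longrightarrow> root_ray \<Sigma> \<alpha> = \<rho>"
  unfolding root_ray_def by (rule the_equality) (auto intro: is_root_ray_unique)

lemma roots_iff: "\<alpha> \<in> roots \<Sigma> \<longleftrightarrow> is_root_ray \<Sigma> \<alpha> (root_ray \<Sigma> \<alpha>)"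
  unfolding roots_def using is_root_ray_unique root_ray_eq by blast

text \<open>If the pairing with \<open>\<rho>\<close> reaches -1, then \<open>\<alpha>\<close> is a
  root with this ray; otherwise all pairings are nonnegative and completeness forces
  \<open>\<alpha> = 0\<close>.\<close>

lemma shifts_eq:
  assumes fan: "is_fan \<Sigma>" "smooth_fan \<Sigma>" "projective_fan \<Sigma>" and \<rho>: "\<rho> \<in> rays \<Sigma>"
  shows "shifts \<Sigma> \<rho> = insert 0 {\<alpha> \<in> roots \<Sigma>. root_ray \<Sigma> \<alpha> = \<rho>}"
proof (intro equalityI subsetI)
  fix \<alpha> assume \<alpha>: "\<alpha> \<in> shifts \<Sigma> \<rho>"
  have ge: "pairing \<alpha> \<rho>' \<ge> (if \<rho>' = \<rho> then -1 else 0)" if "\<rho>' \<in> rays \<Sigma>" for \<rho>'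
    using \<alpha> that unfolding shifts_def by blast
  show "\<alpha> \<in> insert 0 {\<alpha> \<in> roots \<Sigma>. root_ray \<Sigma> \<alpha> = \<rho>}"
  proof (cases "pairing \<alpha> \<rho> = -1")
    case True
    moreover have "pairing \<alpha> \<rho>' \<ge> 0" if "\<rho>' \<in> rays \<Sigma> - {\<rho>}" for \<rho>'
      using ge[of \<rho>'] that by auto
    ultimately have "is_root_ray \<Sigma> \<alpha> \<rho>"
      using \<rho> unfolding is_root_ray_def by blast
    then show ?thesis using root_ray_eq[of \<Sigma> \<alpha> \<rho>] by (simp add: roots_iff)
  next
    case False
    have "pairing \<alpha> \<rho>' \<ge> 0" if "\<rho>' \<in> rays \<Sigma>" for \<rho>'
      using ge[OF that] False by (auto split: if_splits)
    then show ?thesis using pairing_nonneg_imp_0[OF fan] by blast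
  qed
next
  fix \<alpha> assume "\<alpha> \<in> insert 0 {\<alpha> \<in> roots \<Sigma>. root_ray \<Sigma> \<alpha> = \<rho>}"
  then show "\<alpha> \<in> shifts \<Sigma> \<rho>"
    by (auto simp: roots_iff is_root_ray_def shifts_def)
qed

text \<open>Makes the set of roots finite, so that sums over roots are genuine.\<close>

lemma roots_subset_lattice_points: "roots \<Sigma> \<subseteq> lattice_points \<Sigma>"
  by (auto simp: roots_iff is_root_ray_def lattice_points_iff) force

text \<open>This is Z(x) + d\<chi>(x) for x = w_\<rho> \<partial>/\<partial>w_\<rho>: the
  coefficient is the exponent of w_\<rho> in t^\<mu>, and the final \<open>f\<close> is d\<chi>(x) =
  1.\<close>

definition ray_operator :: "(real ^ 'n) set set \<Rightarrow> int ^ 'n \<Rightarrow> (int ^ 'n) cpoly \<Rightarrow> (int ^ 'n) cpoly" where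
  "ray_operator \<Sigma> \<rho> f =
     (\<Sum>\<mu>\<in>lattice_points \<Sigma>. Const (of_int (pairing \<mu> \<rho> + 1)) * (Var \<mu> * partial \<mu> f)) + f"

lemma ray_operator_eq:
  "ray_operator \<Sigma> \<rho> f =
    (\<Sum>j\<in>UNIV. Const (of_int (\<rho> $ j)) * torus_operator \<Sigma> j f) + (euler_operator (lattice_points \<Sigma>) f + f)"
proof -
  have "(\<Sum>j\<in>UNIV. Const (of_int (\<rho> $ j)) * torus_operator \<Sigma> j f) =
      (\<Sum>\<mu>\<in>lattice_points \<Sigma>. Const (of_int (pairing \<mu> \<rho>)) * (Var \<mu> * partial \<mu> f))"
    unfolding torus_operator_def sum_distrib_left pairing_axis
    by (subst sum.swap) (simp add: pairing_def Const_sum sum_distrib_left sum_distrib_right Const_mult mult_ac)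
  then show ?thesis
    unfolding ray_operator_def euler_operator_def
    by (simp add: Const_add distrib_right sum.distrib algebra_simps)
qed

lemma sum_shift:
  fixes L S :: "'a :: ab_group_add set" and F :: "'a \<Rightarrow> 'a \<Rightarrow> 'b :: comm_monoid_add"
  assumes "finite L" "finite S"
  shows "(\<Sum>\<nu>\<in>L. if \<nu> - \<mu> \<in> S then F (\<nu> - \<mu>) \<nu> else 0) = (\<Sum>\<alpha>\<in>S. if \<mu> + \<alpha> \<in> L then F \<alpha> (\<mu> + \<alpha>) else 0)"
  unfolding sum.inter_filter[OF assms(1), symmetric] sum.inter_filter[OF assms(2), symmetric]
  by (rule sum.reindex_bij_witness[of _ "\<lambda>\<alpha>. \<mu> + \<alpha>" "\<lambda>\<nu>. \<nu> - \<mu>"]) auto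

text \<open>The operator is linear in the coefficients of the x(w_\<rho>). Those at shift 0 combine
  with the trace d\<chi>(x) into ray operators, those at roots give root operators. Both inclusions
  are read off from this formula.\<close>

lemma Z_operator_eq:
  assumes fan: "is_fan \<Sigma>" "smooth_fan \<Sigma>" "projective_fan \<Sigma>" and x: "x \<in> Lie_Aut_g \<Sigma>"
  shows "Z_operator \<Sigma> (x, c) f + Const (beta_chi \<Sigma> (x, c)) * f =
    (\<Sum>\<rho>\<in>rays \<Sigma>. Const (lookup (x (Var \<rho>)) (single \<rho> 1)) * ray_operator \<Sigma> \<rho> f) +
    (\<Sum>\<rho>\<in>rays \<Sigma>. \<Sum>\<alpha>\<in>{\<alpha> \<in> roots \<Sigma>. root_ray \<Sigma> \<alpha> = \<rho>}.
       Const (lookup (x (Var \<rho>)) (shift_exponent \<Sigma> \<rho> \<alpha>)) * root_operator \<Sigma> \<alpha> f) +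
    Const c * (euler_operator (lattice_points \<Sigma>) f + f)"
proof -
  let ?L = "lattice_points \<Sigma>"
  obtain \<gamma> where \<gamma>: "one_parameter_subgroup \<Sigma> \<gamma> x"
    using x unfolding Lie_Aut_g_def by blast
  have finR: "finite (rays \<Sigma>)" using fan(1) by (intro finite_rays) (simp add: is_fan_def)
  have finL: "finite ?L" using finite_lattice_points[OF fan] .
  define C where "C \<rho> \<alpha> = lookup (x (Var \<rho>)) (shift_exponent \<Sigma> \<rho> \<alpha>)" for \<rho> \<alpha>
  define X where "X \<mu> \<nu> = Var \<mu> * partial \<nu> f" for \<mu> \<nu>
  define k where "k \<mu> \<rho> = (of_int (pairing \<mu> \<rho> + 1) :: complex)" for \<mu> \<rho> :: "int ^ 'a"
  define rts where "rts \<rho> = {\<alpha> \<in> roots \<Sigma>. root_ray \<Sigma> \<alpha> = \<rho>}" for \<rho>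
  have fin_rts: "finite (rts \<rho>)" for \<rho>
    unfolding rts_def using finL roots_subset_lattice_points by (metis (no_types, lifting) finite_subset mem_Collect_eq subset_iff)
  have rts0: "0 \<notin> rts \<rho>" for \<rho>
    by (auto simp: rts_def roots_iff is_root_ray_def)
  \<comment> \<open>Shift 0 is w_\<rho> itself, so \<open>C \<rho> 0\<close> is the diagonal
    coefficient that occurs in d\<chi>.\<close>
  have e0: "shift_exponent \<Sigma> \<rho> 0 = single \<rho> 1" if "\<rho> \<in> rays \<Sigma>" for \<rho>
    using that by (intro poly_mapping_eqI) (auto simp: lookup_shift_exponent[OF finR] lookup_single when_def)
  have "(\<Sum>\<mu>\<in>?L. \<Sum>\<nu>\<in>?L. Const (lookup (x (section_monom \<Sigma> \<mu>)) (section_exponent \<Sigma> \<nu>)) * X \<mu> \<nu>) =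
      (\<Sum>\<mu>\<in>?L. \<Sum>\<nu>\<in>?L. \<Sum>\<rho>\<in>rays \<Sigma>. if \<nu> - \<mu> \<in> shifts \<Sigma> \<rho> then Const (k \<mu> \<rho> * C \<rho> (\<nu> - \<mu>)) * X \<mu> \<nu> else 0)"
    by (intro sum.cong refl)
      (auto simp: lookup_velocity_section_monom[OF \<gamma> finR] Const_sum sum_distrib_right k_def C_def intro!: sum.cong)
  also have "\<dots> = (\<Sum>\<mu>\<in>?L. \<Sum>\<rho>\<in>rays \<Sigma>. \<Sum>\<nu>\<in>?L. if \<nu> - \<mu> \<in> shifts \<Sigma> \<rho> then Const (k \<mu> \<rho> * C \<rho> (\<nu> - \<mu>)) * X \<mu> \<nu> else 0)"
    by (intro sum.cong refl sum.swap)
  also have "\<dots> = (\<Sum>\<rho>\<in>rays \<Sigma>. \<Sum>\<mu>\<in>?L. \<Sum>\<nu>\<in>?L. if \<nu> - \<mu> \<in> shifts \<Sigma> \<rho> then Const (k \<mu> \<rho> * C \<rho> (\<nu> - \<mu>)) * X \<mu> \<nu> else 0)"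
    by (rule sum.swap)
  also have "\<dots> = (\<Sum>\<rho>\<in>rays \<Sigma>. (\<Sum>\<mu>\<in>?L. Const (k \<mu> \<rho> * C \<rho> 0) * X \<mu> \<mu>) +
      (\<Sum>\<alpha>\<in>rts \<rho>. Const (C \<rho> \<alpha>) * root_operator \<Sigma> \<alpha> f))"
  proof (rule sum.cong[OF refl])
    fix \<rho> assume \<rho>: "\<rho> \<in> rays \<Sigma>"
    have sh: "shifts \<Sigma> \<rho> = insert 0 (rts \<rho>)" unfolding rts_def by (rule shifts_eq[OF fan \<rho>])
    have "(\<Sum>\<mu>\<in>?L. \<Sum>\<nu>\<in>?L. if \<nu> - \<mu> \<in> shifts \<Sigma> \<rho> then Const (k \<mu> \<rho> * C \<rho> (\<nu> - \<mu>)) * X \<mu> \<nu> else 0) =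
      (\<Sum>\<mu>\<in>?L. \<Sum>\<alpha>\<in>insert 0 (rts \<rho>). if \<mu> + \<alpha> \<in> ?L then Const (k \<mu> \<rho> * C \<rho> \<alpha>) * X \<mu> (\<mu> + \<alpha>) else 0)"
      unfolding sh using fin_rts finL
      by (intro sum.cong refl sum_shift[where F = "\<lambda>\<alpha> \<nu>. Const (k _ \<rho> * C \<rho> \<alpha>) * X _ \<nu>"]) auto
    also have "\<dots> = (\<Sum>\<mu>\<in>?L. Const (k \<mu> \<rho> * C \<rho> 0) * X \<mu> \<mu>) +
      (\<Sum>\<mu>\<in>?L. \<Sum>\<alpha>\<in>rts \<rho>. if \<mu> + \<alpha> \<in> ?L then Const (k \<mu> \<rho> * C \<rho> \<alpha>) * X \<mu> (\<mu> + \<alpha>) else 0)"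
      unfolding sum.insert[OF fin_rts rts0] sum.distrib by simp
    also have "(\<Sum>\<mu>\<in>?L. \<Sum>\<alpha>\<in>rts \<rho>. if \<mu> + \<alpha> \<in> ?L then Const (k \<mu> \<rho> * C \<rho> \<alpha>) * X \<mu> (\<mu> + \<alpha>) else 0) =
      (\<Sum>\<alpha>\<in>rts \<rho>. \<Sum>\<mu>\<in>?L. if \<mu> + \<alpha> \<in> ?L then Const (k \<mu> \<rho> * C \<rho> \<alpha>) * X \<mu> (\<mu> + \<alpha>) else 0)"
      by (rule sum.swap)
    also have "\<dots> = (\<Sum>\<alpha>\<in>rts \<rho>. Const (C \<rho> \<alpha>) * root_operator \<Sigma> \<alpha> f)"
    proof (rule sum.cong[OF refl])
      fix \<alpha> assume "\<alpha> \<in> rts \<rho>"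
      then have \<alpha>: "root_ray \<Sigma> \<alpha> = \<rho>" "pairing \<alpha> \<rho> = -1"
        by (auto simp: rts_def roots_iff is_root_ray_def)
      \<comment> \<open>Since <\<alpha>,\<rho>> = -1, the exponent <\<mu>,\<rho>> + 1 is
        <\<mu>-\<alpha>,\<rho>>, the coefficient in Z_\<alpha>.\<close>
      show "(\<Sum>\<mu>\<in>?L. if \<mu> + \<alpha> \<in> ?L then Const (k \<mu> \<rho> * C \<rho> \<alpha>) * X \<mu> (\<mu> + \<alpha>) else 0) =
        Const (C \<rho> \<alpha>) * root_operator \<Sigma> \<alpha> f"
        unfolding root_operator_def sum_distrib_left \<alpha>(1) pairing_diff_left \<alpha>(2)
        by (rule sum.cong) (auto simp: k_def X_def Const_mult mult_ac)
    qed
    finally show "(\<Sum>\<mu>\<in>?L. \<Sum>\<nu>\<in>?L. if \<nu> - \<mu> \<in> shifts \<Sigma> \<rho> then Const (k \<mu> \<rho> * C \<rho> (\<nu> - \<mu>)) * X \<mu> \<nu> else 0) =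
      (\<Sum>\<mu>\<in>?L. Const (k \<mu> \<rho> * C \<rho> 0) * X \<mu> \<mu>) + (\<Sum>\<alpha>\<in>rts \<rho>. Const (C \<rho> \<alpha>) * root_operator \<Sigma> \<alpha> f)" .
  qed
  finally have Z: "Z_operator \<Sigma> (x, c) f = (\<Sum>\<rho>\<in>rays \<Sigma>. \<Sum>\<mu>\<in>?L. Const (k \<mu> \<rho> * C \<rho> 0) * X \<mu> \<mu>) +
      (\<Sum>\<rho>\<in>rays \<Sigma>. \<Sum>\<alpha>\<in>rts \<rho>. Const (C \<rho> \<alpha>) * root_operator \<Sigma> \<alpha> f) + Const c * euler_operator ?L f"
    unfolding Z_operator_def by (simp add: X_def sum.distrib)
  have beta: "Const (beta_chi \<Sigma> (x, c)) * f = (\<Sum>\<rho>\<in>rays \<Sigma>. Const (C \<rho> 0) * f) + Const c * f"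
    unfolding beta_chi_def using dchi_velocity[OF \<gamma> finR] e0
    by (simp add: C_def Const_add Const_sum sum_distrib_right distrib_right)
  have "(\<Sum>\<rho>\<in>rays \<Sigma>. Const (lookup (x (Var \<rho>)) (single \<rho> 1)) * ray_operator \<Sigma> \<rho> f) =
      (\<Sum>\<rho>\<in>rays \<Sigma>. (\<Sum>\<mu>\<in>?L. Const (k \<mu> \<rho> * C \<rho> 0) * X \<mu> \<mu>) + Const (C \<rho> 0) * f)"
    unfolding ray_operator_def distrib_left sum_distrib_left
    by (intro sum.cong refl arg_cong2[of _ _ _ _ "(+)"]) (auto simp: C_def e0 k_def X_def Const_mult mult_ac)
  then show ?thesis
    unfolding Z beta rts_def[symmetric] C_def[symmetric] by (simp add: sum.distrib algebra_simps)
qed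

section \<open>The two inclusions of ideals\<close>

lemma tautological_subset_extended_gkz:
  assumes fan: "is_fan \<Sigma>" "smooth_fan \<Sigma>" "projective_fan \<Sigma>"
  shows "tautological_ideal \<Sigma> (beta_chi \<Sigma>) \<subseteq> extended_gkz_ideal \<Sigma>"
proof -
  let ?L = "lattice_points \<Sigma>"
  define E where "E = (\<lambda>f. euler_operator ?L f + f)"
  define Y where "Y = box_operators \<Sigma> \<union> range (torus_operator \<Sigma>) \<union> {E} \<union> root_operator \<Sigma> ` roots \<Sigma>"
  have ext: "extended_gkz_ideal \<Sigma> = left_ideal ?L Y"
    by (simp add: extended_gkz_ideal_def Y_def box_operators_def E_def)
  have "left_ideal ?L (box_operators \<Sigma>) \<subseteq> left_ideal ?L Y"
    by (intro left_ideal_subset subsetI left_ideal_gen) (simp add: Y_def)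
  then have van: "poly_in_partials p \<in> left_ideal ?L Y" if "p \<in> vanishing_ideal \<Sigma>" for p
    using vanishing_in_box_ideal[OF fan that] by blast
  have E: "E \<in> left_ideal ?L Y" and torus: "torus_operator \<Sigma> j \<in> left_ideal ?L Y"
    and root: "\<alpha> \<in> roots \<Sigma> \<Longrightarrow> root_operator \<Sigma> \<alpha> \<in> left_ideal ?L Y" for j \<alpha>
    by (auto intro!: left_ideal_gen simp: Y_def)
  have ray: "ray_operator \<Sigma> \<rho> \<in> left_ideal ?L Y" for \<rho>
  proof -
    have "ray_operator \<Sigma> \<rho> = (\<lambda>f. (\<Sum>j\<in>UNIV. Const (of_int (\<rho> $ j)) * torus_operator \<Sigma> j f) + E f)"
      by (simp add: fun_eq_iff ray_operator_eq E_def)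
    also have "\<dots> \<in> left_ideal ?L Y"
      by (intro left_ideal.add left_ideal_sum left_ideal_scale torus E)
    finally show ?thesis .
  qed
  have "(\<lambda>f. Z_operator \<Sigma> \<xi> f + Const (beta_chi \<Sigma> \<xi>) * f) \<in> left_ideal ?L Y" if \<xi>: "\<xi> \<in> Lie_Aut_g \<Sigma> \<times> UNIV" for \<xi>
  proof -
    obtain x c where xc: "\<xi> = (x, c)" "x \<in> Lie_Aut_g \<Sigma>" using \<xi> by blast
    show ?thesis
      unfolding xc(1) Z_operator_eq[OF fan xc(2)]
      by (intro left_ideal.add left_ideal_sum left_ideal_scale ray root E[unfolded E_def]) auto
  qed
  then show ?thesis
    unfolding tautological_ideal_def ext using van by (intro left_ideal_subset) auto
qed

lemma extended_gkz_subset_tautological: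
  assumes fan: "is_fan \<Sigma>" "smooth_fan \<Sigma>" "projective_fan \<Sigma>"
  shows "extended_gkz_ideal \<Sigma> \<subseteq> tautological_ideal \<Sigma> (beta_chi \<Sigma>)"
proof -
  let ?L = "lattice_points \<Sigma>"
  have finR: "finite (rays \<Sigma>)" using fan(1) by (intro finite_rays) (simp add: is_fan_def)
  have finL: "finite ?L" using finite_lattice_points[OF fan] .
  define E where "E = (\<lambda>f. euler_operator ?L f + f)"
  define Y where "Y = {poly_in_partials p | p. p \<in> vanishing_ideal \<Sigma>} \<union>
        {(\<lambda>f. Z_operator \<Sigma> \<xi> f + Const (beta_chi \<Sigma> \<xi>) * f) | \<xi>. \<xi> \<in> Lie_Aut_g \<Sigma> \<times> UNIV}"
  define J where "J = left_ideal ?L Y"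
  have Z: "(\<lambda>f. Z_operator \<Sigma> (x, c) f + Const (beta_chi \<Sigma> (x, c)) * f) \<in> J" if "x \<in> Lie_Aut_g \<Sigma>" for x c
    unfolding J_def Y_def using that by (intro left_ideal_gen) auto
  have ray_at: "ray_operator \<Sigma> \<rho>0 \<in> J \<and> E \<in> J" if \<rho>0: "\<rho>0 \<in> rays \<Sigma>" for \<rho>0
  proof -
    obtain x where x: "x \<in> Lie_Aut_g \<Sigma>" "\<And>\<rho>. \<rho> \<in> rays \<Sigma> \<Longrightarrow> x (Var \<rho>) = (if \<rho> = \<rho>0 then Var \<rho>0 else 0)"
      using torus_velocity[OF \<rho>0] by blast
    have "Z_operator \<Sigma> (x, c) f + Const (beta_chi \<Sigma> (x, c)) * f = ray_operator \<Sigma> \<rho>0 f + Const c * E f" for c f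
    proof -
      have "(\<Sum>\<rho>\<in>rays \<Sigma>. Const (lookup (x (Var \<rho>)) (single \<rho> 1)) * ray_operator \<Sigma> \<rho> f) =
          (\<Sum>\<rho>\<in>rays \<Sigma>. if \<rho> = \<rho>0 then ray_operator \<Sigma> \<rho> f else 0)"
        using x(2) by (intro sum.cong) (auto simp: Var_def lookup_Monom)
      also have "\<dots> = ray_operator \<Sigma> \<rho>0 f" using finR \<rho>0 by simp
      finally have 1: "(\<Sum>\<rho>\<in>rays \<Sigma>. Const (lookup (x (Var \<rho>)) (single \<rho> 1)) * ray_operator \<Sigma> \<rho> f) = ray_operator \<Sigma> \<rho>0 f" .
      \<comment> \<open>The exponent of w_\<rho> is 1 in w_\<rho> but 0 in the monomial of a root
        with ray \<open>\<rho>\<close>, so the torus velocity has no root component.\<close>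
      have "lookup (x (Var \<rho>)) (shift_exponent \<Sigma> \<rho> \<alpha>) = 0" if "\<rho> \<in> rays \<Sigma>" "\<alpha> \<in> roots \<Sigma>" "root_ray \<Sigma> \<alpha> = \<rho>" for \<rho> \<alpha>
      proof -
        have "lookup (shift_exponent \<Sigma> \<rho> \<alpha>) \<rho> = 0"
          using that by (auto simp: lookup_shift_exponent[OF finR] roots_iff is_root_ray_def)
        then have "single \<rho> 1 \<noteq> shift_exponent \<Sigma> \<rho> \<alpha>" by (metis lookup_single_eq zero_neq_one)
        then show ?thesis using x(2)[OF that(1)] by (auto simp: Var_def lookup_Monom)
      qed
      then have 2: "(\<Sum>\<rho>\<in>rays \<Sigma>. \<Sum>\<alpha>\<in>{\<alpha> \<in> roots \<Sigma>. root_ray \<Sigma> \<alpha> = \<rho>}.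
         Const (lookup (x (Var \<rho>)) (shift_exponent \<Sigma> \<rho> \<alpha>)) * root_operator \<Sigma> \<alpha> f) = 0"
        by (intro sum.neutral ballI) auto
      show ?thesis unfolding Z_operator_eq[OF fan x(1)] 1 2 E_def by simp
    qed
    \<comment> \<open>The scalar \<open>c\<close> is free: \<open>c = 0\<close> leaves the ray
      operator, and the difference between \<open>c = 1\<close> and \<open>c = 0\<close> is
      \<open>E\<close>.\<close>
    then have *: "(\<lambda>f. ray_operator \<Sigma> \<rho>0 f + Const c * E f) \<in> J" for c
      using Z[OF x(1), of c] by simp
    from *[of 0] have ray: "ray_operator \<Sigma> \<rho>0 \<in> J" by simp
    have "E = (\<lambda>f. (ray_operator \<Sigma> \<rho>0 f + Const 1 * E f) - ray_operator \<Sigma> \<rho>0 f)" by simp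
    also have "\<dots> \<in> J" unfolding J_def by (intro left_ideal_diff *[unfolded J_def] ray[unfolded J_def])
    finally show ?thesis using ray by blast
  qed
  \<comment> \<open>\<open>E\<close> was obtained alongside a ray, so one ray must exist. Without
    rays, completeness would make every character zero, even a standard basis vector.\<close>
  have "rays \<Sigma> \<noteq> {}"
  proof
    assume "rays \<Sigma> = {}"
    then have "axis undefined 1 = (0 :: int ^ 'a)"
      by (intro pairing_nonneg_imp_0[OF fan]) simp
    then show False by (simp add: axis_eq_0_iff)
  qed
  then have E: "E \<in> J" using ray_at by blast
  have root: "root_operator \<Sigma> \<alpha>0 \<in> J" if \<alpha>0: "\<alpha>0 \<in> roots \<Sigma>" for \<alpha>0
  proof -
    define \<rho>0 where "\<rho>0 = root_ray \<Sigma> \<alpha>0"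
    have rr: "is_root_ray \<Sigma> \<alpha>0 \<rho>0" using \<alpha>0 by (simp add: roots_iff \<rho>0_def)
    have \<rho>0: "\<rho>0 \<in> rays \<Sigma>" using rr by (simp add: is_root_ray_def)
    obtain x where x: "x \<in> Lie_Aut_g \<Sigma>"
      "\<And>\<rho>. \<rho> \<in> rays \<Sigma> \<Longrightarrow> x (Var \<rho>) = (if \<rho> = \<rho>0 then Monom (shift_exponent \<Sigma> \<rho>0 \<alpha>0) else 0)"
      using root_velocity[OF finR rr] by blast
    have "Z_operator \<Sigma> (x, 0) f + Const (beta_chi \<Sigma> (x, 0)) * f = root_operator \<Sigma> \<alpha>0 f" for f
    proof -
      have "lookup (shift_exponent \<Sigma> \<rho>0 \<alpha>0) \<rho>0 = 0"
        using rr by (auto simp: lookup_shift_exponent[OF finR] is_root_ray_def)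
      then have "shift_exponent \<Sigma> \<rho>0 \<alpha>0 \<noteq> single \<rho>0 1" by (metis lookup_single_eq zero_neq_one)
      then have 1: "(\<Sum>\<rho>\<in>rays \<Sigma>. Const (lookup (x (Var \<rho>)) (single \<rho> 1)) * ray_operator \<Sigma> \<rho> f) = 0"
        using x(2) by (intro sum.neutral ballI) (auto simp: lookup_Monom)
      \<comment> \<open>A root is determined by its monomial: equal exponents give equal pairings
        with all rays, hence equal characters by completeness. So the velocity picks out the single
        root operator of \<open>\<alpha>0\<close>.\<close>
      have inj: "\<alpha> = \<alpha>0" if "\<alpha> \<in> roots \<Sigma>" "root_ray \<Sigma> \<alpha> = \<rho>0" "shift_exponent \<Sigma> \<rho>0 \<alpha>0 = shift_exponent \<Sigma> \<rho>0 \<alpha>" for \<alpha>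
      proof -
        have "is_root_ray \<Sigma> \<alpha> \<rho>0" using that by (auto simp: roots_iff)
        then have "pairing (\<alpha> - \<alpha>0) \<rho> = 0" if "\<rho> \<in> rays \<Sigma>" for \<rho>
          using arg_cong[OF \<open>shift_exponent \<Sigma> \<rho>0 \<alpha>0 = _\<close>, of "\<lambda>m. lookup m \<rho>"] rr that
          by (cases "\<rho> = \<rho>0") (auto simp: lookup_shift_exponent[OF finR] is_root_ray_def pairing_diff_left eq_nat_nat_iff)
        then have "\<alpha> - \<alpha>0 = 0" by (intro pairing_nonneg_imp_0[OF fan]) simp
        then show ?thesis by simp
      qed
      have "(\<Sum>\<rho>\<in>rays \<Sigma>. \<Sum>\<alpha>\<in>{\<alpha> \<in> roots \<Sigma>. root_ray \<Sigma> \<alpha> = \<rho>}.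
         Const (lookup (x (Var \<rho>)) (shift_exponent \<Sigma> \<rho> \<alpha>)) * root_operator \<Sigma> \<alpha> f) =
         (\<Sum>\<rho>\<in>rays \<Sigma>. if \<rho> = \<rho>0 then (\<Sum>\<alpha>\<in>{\<alpha> \<in> roots \<Sigma>. root_ray \<Sigma> \<alpha> = \<rho>0}. if \<alpha> = \<alpha>0 then root_operator \<Sigma> \<alpha> f else 0) else 0)"
        using x(2) inj by (intro sum.cong) (auto simp: lookup_Monom intro!: sum.cong)
      also have "\<dots> = root_operator \<Sigma> \<alpha>0 f"
        using finR \<rho>0 \<alpha>0 finite_subset[OF roots_subset_lattice_points finL] by (simp add: \<rho>0_def)
      finally show ?thesis unfolding Z_operator_eq[OF fan x(1)] 1 by simp
    qed
    then show ?thesis using Z[OF x(1), of 0] by simp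
  qed
  have torus: "torus_operator \<Sigma> j \<in> J" for j
  proof -
    \<comment> \<open>Real coefficients suffice, since the operators have complex ones. Subtracting
      \<open>E\<close> from a ray operator leaves the bare pairing with \<open>\<rho>\<close>, and
      these combine to the \<open>j\<close>-th coordinate.\<close>
    obtain c where c: "axis j 1 = (\<Sum>\<rho>\<in>rays \<Sigma>. c \<rho> *\<^sub>R real_vec \<rho>)"
      using rays_positively_span[OF fan] by metis
    have coord: "(\<Sum>\<rho>\<in>rays \<Sigma>. complex_of_real (c \<rho>) * of_int (pairing \<mu> \<rho>)) = of_int (\<mu> $ j)" for \<mu>
    proof -
      have "real_of_int (\<mu> $ j) = real_vec \<mu> \<bullet> axis j 1" by (simp add: inner_axis_real_vec)
      also have "\<dots> = (\<Sum>\<rho>\<in>rays \<Sigma>. c \<rho> * of_int (pairing \<mu> \<rho>))"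
        unfolding c by (simp add: inner_sum_right inner_real_vec)
      finally have "complex_of_real (real_of_int (\<mu> $ j)) = complex_of_real (\<Sum>\<rho>\<in>rays \<Sigma>. c \<rho> * of_int (pairing \<mu> \<rho>))" by simp
      then show ?thesis by simp
    qed
    have "torus_operator \<Sigma> j f = (\<Sum>\<rho>\<in>rays \<Sigma>. Const (of_real (c \<rho>)) * (ray_operator \<Sigma> \<rho> f - E f))" for f
    proof -
      have "ray_operator \<Sigma> \<rho> f - E f = (\<Sum>\<mu>\<in>?L. Const (of_int (pairing \<mu> \<rho>)) * (Var \<mu> * partial \<mu> f))" for \<rho>
        unfolding ray_operator_def E_def euler_operator_def
        by (simp add: Const_add distrib_right sum.distrib)
      then have "(\<Sum>\<rho>\<in>rays \<Sigma>. Const (of_real (c \<rho>)) * (ray_operator \<Sigma> \<rho> f - E f)) =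
          (\<Sum>\<mu>\<in>?L. \<Sum>\<rho>\<in>rays \<Sigma>. Const (of_real (c \<rho>) * of_int (pairing \<mu> \<rho>)) * (Var \<mu> * partial \<mu> f))"
        by (subst sum.swap) (simp add: sum_distrib_left Const_mult mult.assoc)
      also have "\<dots> = (\<Sum>\<mu>\<in>?L. Const (of_int (\<mu> $ j)) * (Var \<mu> * partial \<mu> f))"
        by (simp add: sum_distrib_right[symmetric] Const_sum[symmetric] coord)
      finally show ?thesis by (simp add: torus_operator_def pairing_axis)
    qed
    then have "torus_operator \<Sigma> j = (\<lambda>f. \<Sum>\<rho>\<in>rays \<Sigma>. Const (of_real (c \<rho>)) * (ray_operator \<Sigma> \<rho> f - E f))" by blast
    also have "\<dots> \<in> J"
      using ray_at unfolding J_def by (intro left_ideal_sum left_ideal_scale left_ideal_diff) auto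
    finally show ?thesis .
  qed
  have box: "P \<in> J" if P: "P \<in> box_operators \<Sigma>" for P
  proof -
    obtain p where "p \<in> vanishing_ideal \<Sigma>" "P = poly_in_partials p"
      using box_in_vanishing[OF finR finL P] .
    then show ?thesis unfolding J_def Y_def by (intro left_ideal_gen) blast
  qed
  have "box_operators \<Sigma> \<union> range (torus_operator \<Sigma>) \<union> {E} \<union> root_operator \<Sigma> ` roots \<Sigma> \<subseteq> left_ideal ?L Y"
    using box torus E root unfolding J_def by blast
  from left_ideal_subset[OF this] show ?thesis
    unfolding extended_gkz_ideal_def tautological_ideal_def Y_def E_def box_operators_def .
qed

theorem theorem3p2:
  fixes \<Sigma> :: "(real ^ 'n) set set"
  assumes "is_fan \<Sigma>"
    and "smooth_fan \<Sigma>"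
    and "projective_fan \<Sigma>"
    and "anticanonical_base_point_free \<Sigma>"
  shows "tautological_ideal \<Sigma> (beta_chi \<Sigma>) = extended_gkz_ideal \<Sigma>"
  using tautological_subset_extended_gkz[OF assms(1-3)] extended_gkz_subset_tautological[OF assms(1-3)]
  by (rule equalityI)

end
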